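(* Let $R\subseteq S$ be an FCP extension of commutative rings where $S$ is semilocal. There exists a greatest $T\in[R,S]$ (with respect to inclusion) such that $R\subseteq T$ is SL. It satisfies the following properties: (1) $T$ is the product (compositum) of all $V\in[R,S]$ such that $R\subseteq V$ is seminormal and infra-integral and $R/M\cong\mathbb Z/2\mathbb Z$ for any $M\in\mathrm{MSupp}(V/R)$. (2) $T$ is the product (compositum) of all $V\in[R,S]$ such that $R\subseteq V$ is SL. (3) $T=\sup\{V\in[R,S]\mid R\subseteq V \text{ is SL}\}$ in the lattice $[R,S]$. (4) $T=\bigcup\{V\in[R,S]\mid R\subseteq V\text{ is SL}\}$.
   Context: All rings are commutative, unital and nonzero. $[R,S]$ is the set of all $R$-subalgebras of $S$, ordered by inclusion; it is a lattice in which the product (compositum) of a family of elements is the $R$-subalgebra of $S$ they generate. An extension $R\subseteq S$ is an FCP extension if each chain in $[R,S]$ is finite. A ring is semilocal if it has finitely many maximal ideals. An extension $R\subseteq V$ is strongly local (SL) if $\mathrm U(R)=\mathrm U(V)$, where $\mathrm U$ denotes the group of units. It is seminormal if every $b\in V$ with $b^2\in R$ and $b^3\in R$ belongs to $R$. It is infra-integral if it is integral and, for each prime ideal $Q$ of $V$ with $P:=Q\cap R$, the residual field extension $R_P/PR_P\to V_Q/QV_Q$ is an isomorphism. $\mathrm{MSupp}(V/R)$ is the set of maximal ideals $M$ of $R$ with $(V/R)_M\neq0$. *)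

theory Defs
  imports "HOL-Algebra.Algebra"
begin

text \<open>
  An extension \<open>R \<subseteq> B\<close> is given by a commutative ring record \<open>B\<close> and a subring \<open>R\<close> of \<open>B\<close>, the latter
  being a set; as a ring it is \<open>restr B R\<close>.  All subrings contain the unit of \<open>B\<close>.
\<close>

abbreviation restr :: "('a, 'b) ring_scheme \<Rightarrow> 'a set \<Rightarrow> ('a, 'b) ring_scheme" where
  "restr B R \<equiv> B\<lparr>carrier := R\<rparr>"


subsection \<open>The lattice of intermediate rings\<close>

text \<open>
  The \<open>R\<close>-subalgebras of \<open>S\<close> are the subrings of \<open>S\<close> containing \<open>R\<close>.  (The library's
  \<^const>\<open>subalgebra\<close> does not require the unit to be an element.)
\<close>

definition intermediate :: "('a, 'b) ring_scheme \<Rightarrow> 'a set \<Rightarrow> 'a set set" where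
  "intermediate S R = {V. subring V S \<and> R \<subseteq> V}"

definition intermediate_lattice :: "('a, 'b) ring_scheme \<Rightarrow> 'a set \<Rightarrow> 'a set gorder" where
  "intermediate_lattice S R = \<lparr>carrier = intermediate S R, eq = (=), le = (\<subseteq>)\<rparr>"

definition compositum :: "('a, 'b) ring_scheme \<Rightarrow> 'a set \<Rightarrow> 'a set set \<Rightarrow> 'a set" where
  "compositum S R F = generate_ring S (R \<union> \<Union>F)"

definition FCP :: "('a, 'b) ring_scheme \<Rightarrow> 'a set \<Rightarrow> bool" where
  "FCP S R \<longleftrightarrow> (\<forall>C. subset.chain (intermediate S R) C \<longrightarrow> finite C)"

definition semilocal :: "('a, 'b) ring_scheme \<Rightarrow> bool" where
  "semilocal A \<longleftrightarrow> finite {M. maximalideal M A}"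


subsection \<open>Localization of rings\<close>

definition frac_rel :: "('a, 'b) ring_scheme \<Rightarrow> 'a set \<Rightarrow> (('a \<times> 'a) \<times> ('a \<times> 'a)) set" where
  "frac_rel A D = {((a, s), (b, t)). a \<in> carrier A \<and> b \<in> carrier A \<and> s \<in> D \<and> t \<in> D \<and>
     (\<exists>u\<in>D. u \<otimes>\<^bsub>A\<^esub> (t \<otimes>\<^bsub>A\<^esub> a) = u \<otimes>\<^bsub>A\<^esub> (s \<otimes>\<^bsub>A\<^esub> b))}"

text \<open>\<open>fraction A D a s\<close> is the fraction \<open>a/s\<close>.\<close>

definition fraction :: "('a, 'b) ring_scheme \<Rightarrow> 'a set \<Rightarrow> 'a \<Rightarrow> 'a \<Rightarrow> ('a \<times> 'a) set" where
  "fraction A D a s = frac_rel A D `` {(a, s)}"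

text \<open>
  The operations are defined through all representatives at once, as in \<^const>\<open>rcoset_mult\<close>; the
  sets in the unions all coincide when \<open>D\<close> is a multiplicative subset of \<open>A\<close>.
\<close>

definition localization :: "('a, 'b) ring_scheme \<Rightarrow> 'a set \<Rightarrow> ('a \<times> 'a) set ring" where
  "localization A D =
     \<lparr>carrier = (carrier A \<times> D) // frac_rel A D,
      monoid.mult = (\<lambda>U W. \<Union>(a, s)\<in>U. \<Union>(b, t)\<in>W. fraction A D (a \<otimes>\<^bsub>A\<^esub> b) (s \<otimes>\<^bsub>A\<^esub> t)),
      one = fraction A D \<one>\<^bsub>A\<^esub> \<one>\<^bsub>A\<^esub>,
      ring.zero = fraction A D \<zero>\<^bsub>A\<^esub> \<one>\<^bsub>A\<^esub>,
      add = (\<lambda>U W. \<Union>(a, s)\<in>U. \<Union>(b, t)\<in>W.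
               fraction A D ((t \<otimes>\<^bsub>A\<^esub> a) \<oplus>\<^bsub>A\<^esub> (s \<otimes>\<^bsub>A\<^esub> b)) (s \<otimes>\<^bsub>A\<^esub> t))\<rparr>"

abbreviation local_at :: "('a, 'b) ring_scheme \<Rightarrow> 'a set \<Rightarrow> ('a \<times> 'a) set ring" where
  "local_at A P \<equiv> localization A (carrier A - P)"

text \<open>The extended ideal \<open>P A\<^sub>P\<close>.\<close>

definition local_ideal :: "('a, 'b) ring_scheme \<Rightarrow> 'a set \<Rightarrow> ('a \<times> 'a) set set" where
  "local_ideal A P = Idl\<^bsub>local_at A P\<^esub> ((\<lambda>p. fraction A (carrier A - P) p \<one>\<^bsub>A\<^esub>) ` P)"

definition residue_field :: "('a, 'b) ring_scheme \<Rightarrow> 'a set \<Rightarrow> ('a \<times> 'a) set set ring" where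
  "residue_field A P = local_at A P Quot local_ideal A P"

text \<open>
  For a prime ideal \<open>Q\<close> of \<open>B\<close> and \<open>P = Q \<inter> R\<close>, the map from the residue field of \<open>R\<close> at \<open>P\<close> to that
  of \<open>B\<close> at \<open>Q\<close> sending the class of \<open>a/s\<close> to the class of \<open>a/s\<close>.
\<close>

definition residual_map ::
    "('a, 'b) ring_scheme \<Rightarrow> 'a set \<Rightarrow> ('a \<times> 'a) set set \<Rightarrow> ('a \<times> 'a) set set" where
  "residual_map B Q U =
     (\<Union>\<phi>\<in>U. \<Union>(a, s)\<in>\<phi>. local_ideal B Q +>\<^bsub>local_at B Q\<^esub> fraction B (carrier B - Q) a s)"


subsection \<open>Localization of modules and support\<close>

text \<open>
  The record type of modules extends that of rings; its fields \<open>monoid.mult\<close> and \<open>one\<close> play no role for a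
  module.  \<open>quot_module B R\<close> is the \<open>R\<close>-module \<open>B/R\<close>.
\<close>

definition quot_module :: "('a, 'b) ring_scheme \<Rightarrow> 'a set \<Rightarrow> ('a, 'a set) module" where
  "quot_module B R =
     \<lparr>carrier = a_rcosets\<^bsub>B\<^esub> R, monoid.mult = undefined, one = undefined,
      ring.zero = R, add = set_add B,
      smult = (\<lambda>r U. \<Union>x\<in>U. R +>\<^bsub>B\<^esub> (r \<otimes>\<^bsub>B\<^esub> x))\<rparr>"

definition mod_frac_rel ::
    "'a set \<Rightarrow> ('a, 'm, 'c) module_scheme \<Rightarrow> (('m \<times> 'a) \<times> ('m \<times> 'a)) set" where
  "mod_frac_rel D N = {((x, s), (y, t)). x \<in> carrier N \<and> y \<in> carrier N \<and> s \<in> D \<and> t \<in> D \<and>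
     (\<exists>u\<in>D. u \<odot>\<^bsub>N\<^esub> (t \<odot>\<^bsub>N\<^esub> x) = u \<odot>\<^bsub>N\<^esub> (s \<odot>\<^bsub>N\<^esub> y))}"

definition mod_frac :: "'a set \<Rightarrow> ('a, 'm, 'c) module_scheme \<Rightarrow> 'm \<Rightarrow> 'a \<Rightarrow> ('m \<times> 'a) set" where
  "mod_frac D N x s = mod_frac_rel D N `` {(x, s)}"

text \<open>The localization of the \<open>A\<close>-module \<open>N\<close>, as a module over \<open>localization A D\<close>.\<close>

definition mod_localization ::
    "('a, 'b) ring_scheme \<Rightarrow> 'a set \<Rightarrow> ('a, 'm, 'c) module_scheme
      \<Rightarrow> (('a \<times> 'a) set, ('m \<times> 'a) set) module" where
  "mod_localization A D N =
     \<lparr>carrier = (carrier N \<times> D) // mod_frac_rel D N, monoid.mult = undefined, one = undefined,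
      ring.zero = mod_frac D N \<zero>\<^bsub>N\<^esub> \<one>\<^bsub>A\<^esub>,
      add = (\<lambda>U W. \<Union>(x, s)\<in>U. \<Union>(y, t)\<in>W.
               mod_frac D N ((t \<odot>\<^bsub>N\<^esub> x) \<oplus>\<^bsub>N\<^esub> (s \<odot>\<^bsub>N\<^esub> y)) (s \<otimes>\<^bsub>A\<^esub> t)),
      smult = (\<lambda>\<alpha> U. \<Union>(a, s)\<in>\<alpha>. \<Union>(x, t)\<in>U. mod_frac D N (a \<odot>\<^bsub>N\<^esub> x) (s \<otimes>\<^bsub>A\<^esub> t))\<rparr>"

definition MSupp :: "('a, 'b) ring_scheme \<Rightarrow> ('a, 'm, 'c) module_scheme \<Rightarrow> 'a set set" where
  "MSupp A N = {M. maximalideal M A \<and>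
     carrier (mod_localization A (carrier A - M) N)
       \<noteq> {\<zero>\<^bsub>mod_localization A (carrier A - M) N\<^esub>}}"


subsection \<open>Properties of an extension\<close>

definition strongly_local :: "('a, 'b) ring_scheme \<Rightarrow> 'a set \<Rightarrow> bool" where
  "strongly_local B R \<longleftrightarrow> Units (restr B R) = Units B"

definition seminormal :: "('a, 'b) ring_scheme \<Rightarrow> 'a set \<Rightarrow> bool" where
  "seminormal B R \<longleftrightarrow>
     (\<forall>b\<in>carrier B. b [^]\<^bsub>B\<^esub> (2::nat) \<in> R \<and> b [^]\<^bsub>B\<^esub> (3::nat) \<in> R \<longrightarrow> b \<in> R)"

definition integral_ext :: "('a, 'b) ring_scheme \<Rightarrow> 'a set \<Rightarrow> bool" where
  "integral_ext B R \<longleftrightarrow>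
     (\<forall>b\<in>carrier B. \<exists>p. polynomial\<^bsub>B\<^esub> R p \<and> p \<noteq> [] \<and> lead_coeff p = \<one>\<^bsub>B\<^esub>
        \<and> ring.eval B p b = \<zero>\<^bsub>B\<^esub>)"

definition infra_integral :: "('a, 'b) ring_scheme \<Rightarrow> 'a set \<Rightarrow> bool" where
  "infra_integral B R \<longleftrightarrow> integral_ext B R \<and>
     (\<forall>Q. primeideal Q B \<longrightarrow>
        residual_map B Q \<in> ring_iso (residue_field (restr B R) (Q \<inter> R)) (residue_field B Q))"

end

theory Submission
  imports Defs
begin

text \<open>
  Call an intermediate ring \<open>V\<close> Boolean over \<open>R\<close> if \<open>(x\<^sup>2 - x) y \<in> R\<close> for all \<open>x, y \<in> V\<close>, that is, if
  \<open>V/(R : V)\<close> is a Boolean ring.  Both the condition SL and the condition in (1) turn out to be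
  equivalent to this one.

  If \<open>V\<close> is Boolean over \<open>R\<close>, then \<open>u - 1 = (u\<^sup>2 - u) u\<^sup>-\<^sup>1 \<in> R\<close> for every unit \<open>u\<close> of \<open>V\<close>, and the properties
  in (1) are equally direct.  Conversely, let \<open>z = (x\<^sup>2 - x) y\<close>.  By FCP and semilocality finitely many
  primes of \<open>V\<close> detect its units, and modulo each of them with residue ring \<open>\<int>/2\<int>\<close> the element \<open>z\<close>
  vanishes; so prime avoidance yields \<open>a\<close> with \<open>a\<close> and \<open>a + z\<close> both units, and \<open>z \<in> R\<close> if
  \<open>R \<subseteq> V\<close> is SL.  Under (1), \<open>z\<close> lies in every prime of \<open>V\<close> above a given \<open>M \<in> MSupp(V/R)\<close>, hence is
  integral over \<open>M R\<^sub>M\<close>; as the descending chain \<open>R + z\<^sup>n R[z]\<close> stops, Nakayama's lemma shows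
  \<open>z\<^sup>n \<in> R\<^sub>M\<close> for large \<open>n\<close>, and seminormality gives \<open>z \<in> R\<^sub>M\<close>.

  Finally, the rings Boolean over \<open>R\<close> form a directed family, since two of them are Boolean over
  \<open>R\<close> with respect to the intersection of their conductors, and then both lie in the largest ring
  having that property.  The union of the family is the greatest SL extension.
\<close>

subsection \<open>Localization\<close>

text \<open>The auxiliary lemmas in \<open>cring\<close> write \<open>R\<close> for the large ring
  and \<open>K\<close> for the small one. FCP has to supply finiteness in two places. An element of
  \<open>V\<close> outside the maximal ideals of \<open>S\<close> has an inverse in
  \<open>S\<close>; that this inverse belongs to \<open>V\<close> is a condition at every maximal
  ideal of \<open>V\<close>, and a minimal choice among intermediate rings reduces it to finitely
  many of them. For Nakayama's lemma no module is assumed finitely generated: integrality over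
  \<open>M\<close> bounds the powers of \<open>z\<close> up to a denominator, and the stationary
  chain puts \<open>z^n\<close> back into \<open>R + z^m R[z]\<close> for all larger
  \<open>m\<close>. Primes with residue ring Z/2Z are the only ones that avoidance cannot handle,
  since there \<open>a\<close> and \<open>a + z\<close> would both have to be 1, forcing
  \<open>z = 0\<close>; this explains the shape \<open>(x^2 - x) y\<close>. Directedness is not read
  off the compositum of \<open>V\<close> and \<open>W\<close>, whose elements mix factors from both:
  for a fixed ideal \<open>J\<close> of \<open>R\<close>, the test that \<open>J z\<close> and
  \<open>z^2 - z\<close> lie in \<open>J\<close> concerns a single \<open>z\<close>, and the
  elements passing it already form a ring.\<close>

locale multiplicative_subset = cring A for A (structure) and D +
  assumes sub: "D \<subseteq> carrier A"
    and one_mem: "\<one> \<in> D"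
    and mult_mem: "\<lbrakk>s \<in> D; t \<in> D\<rbrakk> \<Longrightarrow> s \<otimes> t \<in> D"
begin

lemma mem_carrier: "s \<in> D \<Longrightarrow> s \<in> carrier A"
  using sub by blast

lemma frac_rel_trans:
  assumes "((a, s), (b, t)) \<in> frac_rel A D" "((b, t), (c, r)) \<in> frac_rel A D"
  shows "((a, s), (c, r)) \<in> frac_rel A D"
proof -
  have car: "a \<in> carrier A" "b \<in> carrier A" "c \<in> carrier A" and D: "s \<in> D" "t \<in> D" "r \<in> D"
    using assms by (auto simp: frac_rel_def)
  obtain u where u: "u \<in> D" "u \<otimes> (t \<otimes> a) = u \<otimes> (s \<otimes> b)"
    using assms(1) by (auto simp: frac_rel_def)
  obtain v where v: "v \<in> D" "v \<otimes> (r \<otimes> b) = v \<otimes> (t \<otimes> c)"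
    using assms(2) by (auto simp: frac_rel_def)
  note [simp] = car D[THEN mem_carrier] u(1)[THEN mem_carrier] v(1)[THEN mem_carrier]
  \<comment> \<open>The middle denominator \<open>t\<close> cannot be cancelled, so it joins the
    multiplier \<open>u v\<close>.\<close>
  have "(u \<otimes> v \<otimes> t) \<otimes> (r \<otimes> a) = (v \<otimes> r) \<otimes> (u \<otimes> (t \<otimes> a))"
    by (simp add: m_ac)
  also have "\<dots> = (u \<otimes> s) \<otimes> (v \<otimes> (r \<otimes> b))"
    unfolding u(2) by (simp add: m_ac)
  also have "\<dots> = (u \<otimes> v \<otimes> t) \<otimes> (s \<otimes> c)"
    unfolding v(2) by (simp add: m_ac)
  finally show ?thesis
    using car D u v mult_mem by (auto simp: frac_rel_def)
qed

lemma equiv_frac_rel: "equiv (carrier A \<times> D) (frac_rel A D)"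
proof (rule equivI)
  show "frac_rel A D \<subseteq> (carrier A \<times> D) \<times> carrier A \<times> D"
    by (auto simp: frac_rel_def)
  show "refl_on (carrier A \<times> D) (frac_rel A D)"
    using one_mem by (auto simp: refl_on_def frac_rel_def)
  show "sym (frac_rel A D)"
    by (auto simp: sym_def frac_rel_def) metis
  show "trans (frac_rel A D)"
    unfolding trans_def using frac_rel_trans by (metis surj_pair)
qed

lemma fraction_eq_iff:
  assumes "a \<in> carrier A" "s \<in> D" "b \<in> carrier A" "t \<in> D"
  shows "fraction A D a s = fraction A D b t \<longleftrightarrow> (\<exists>u\<in>D. u \<otimes> (t \<otimes> a) = u \<otimes> (s \<otimes> b))"
proof -
  have "fraction A D a s = fraction A D b t \<longleftrightarrow> ((a, s), (b, t)) \<in> frac_rel A D"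
    unfolding fraction_def using eq_equiv_class_iff[OF equiv_frac_rel] assms by simp
  then show ?thesis
    using assms by (simp add: frac_rel_def)
qed

lemma fraction_eqI:
  assumes "a \<in> carrier A" "s \<in> D" "b \<in> carrier A" "t \<in> D" "t \<otimes> a = s \<otimes> b"
  shows "fraction A D a s = fraction A D b t"
  using assms one_mem fraction_eq_iff by auto

lemma mem_fraction_iff:
  assumes "a \<in> carrier A" "s \<in> D"
  shows "(b, t) \<in> fraction A D a s \<longleftrightarrow>
    b \<in> carrier A \<and> t \<in> D \<and> fraction A D b t = fraction A D a s"
proof -
  have "(b, t) \<in> fraction A D a s \<longleftrightarrow> ((a, s), (b, t)) \<in> frac_rel A D"
    by (simp add: fraction_def)
  then show ?thesis
    using assms fraction_eq_iff[of a s b t] by (auto simp: frac_rel_def)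
qed

lemma carrier_localization:
  "carrier (localization A D) = {fraction A D a s |a s. a \<in> carrier A \<and> s \<in> D}"
  by (auto simp: localization_def quotient_def fraction_def)

lemma fraction_mem:
  "\<lbrakk>a \<in> carrier A; s \<in> D\<rbrakk> \<Longrightarrow> fraction A D a s \<in> carrier (localization A D)"
  by (auto simp: carrier_localization)

lemma localizationE:
  assumes "x \<in> carrier (localization A D)"
  obtains a s where "a \<in> carrier A" "s \<in> D" "x = fraction A D a s"
  using assms by (auto simp: carrier_localization)

lemma fraction_mult_cong:
  assumes "a \<in> carrier A" "s \<in> D" "b \<in> carrier A" "t \<in> D"
    and "a' \<in> carrier A" "s' \<in> D" "b' \<in> carrier A" "t' \<in> D"
    and "fraction A D a' s' = fraction A D a s" "fraction A D b' t' = fraction A D b t"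
  shows "fraction A D (a' \<otimes> b') (s' \<otimes> t') = fraction A D (a \<otimes> b) (s \<otimes> t)"
proof -
  obtain u where u: "u \<in> D" "u \<otimes> (s \<otimes> a') = u \<otimes> (s' \<otimes> a)"
    using assms by (auto simp: fraction_eq_iff)
  obtain v where v: "v \<in> D" "v \<otimes> (t \<otimes> b') = v \<otimes> (t' \<otimes> b)"
    using assms by (auto simp: fraction_eq_iff)
  note [simp] = assms(1,3,5,7) assms(2,4,6,8)[THEN mem_carrier] u(1)[THEN mem_carrier]
    v(1)[THEN mem_carrier]
  have "(u \<otimes> v) \<otimes> ((s \<otimes> t) \<otimes> (a' \<otimes> b')) = (u \<otimes> (s \<otimes> a')) \<otimes> (v \<otimes> (t \<otimes> b'))"
    by (simp add: m_ac)
  also have "\<dots> = (u \<otimes> v) \<otimes> ((s' \<otimes> t') \<otimes> (a \<otimes> b))"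
    unfolding u(2) v(2) by (simp add: m_ac)
  finally show ?thesis
    using mult_mem[OF u(1) v(1)] mult_mem[OF assms(2,4)] mult_mem[OF assms(6,8)]
    by (intro fraction_eq_iff[THEN iffD2] bexI[of _ "u \<otimes> v"]) simp_all
qed

lemma fraction_add_cong:
  assumes "a \<in> carrier A" "s \<in> D" "b \<in> carrier A" "t \<in> D"
    and "a' \<in> carrier A" "s' \<in> D" "b' \<in> carrier A" "t' \<in> D"
    and "fraction A D a' s' = fraction A D a s" "fraction A D b' t' = fraction A D b t"
  shows "fraction A D (t' \<otimes> a' \<oplus> s' \<otimes> b') (s' \<otimes> t') = fraction A D (t \<otimes> a \<oplus> s \<otimes> b) (s \<otimes> t)"
proof -
  obtain u where u: "u \<in> D" "u \<otimes> (s \<otimes> a') = u \<otimes> (s' \<otimes> a)"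
    using assms by (auto simp: fraction_eq_iff)
  obtain v where v: "v \<in> D" "v \<otimes> (t \<otimes> b') = v \<otimes> (t' \<otimes> b)"
    using assms by (auto simp: fraction_eq_iff)
  note [simp] = assms(1,3,5,7) assms(2,4,6,8)[THEN mem_carrier] u(1)[THEN mem_carrier]
    v(1)[THEN mem_carrier]
  have "(u \<otimes> v) \<otimes> ((s \<otimes> t) \<otimes> (t' \<otimes> a' \<oplus> s' \<otimes> b'))
      = (v \<otimes> t \<otimes> t') \<otimes> (u \<otimes> (s \<otimes> a')) \<oplus> (u \<otimes> s \<otimes> s') \<otimes> (v \<otimes> (t \<otimes> b'))"
    by (simp add: m_ac r_distr)
  also have "\<dots> = (u \<otimes> v) \<otimes> ((s' \<otimes> t') \<otimes> (t \<otimes> a \<oplus> s \<otimes> b))"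
    unfolding u(2) v(2) by (simp add: m_ac r_distr)
  finally show ?thesis
    using mult_mem[OF u(1) v(1)] mult_mem[OF assms(2,4)] mult_mem[OF assms(6,8)]
    by (intro fraction_eq_iff[THEN iffD2] bexI[of _ "u \<otimes> v"]) simp_all
qed

text \<open>The operations of \<open>localization\<close> are unions over all representatives. A
  union of equal sets collapses to that set once the index classes are nonempty, so well-definedness
  of the operations is reduced to the two congruence lemmas.\<close>

lemma UN_fraction_const:
  assumes "a \<in> carrier A" "s \<in> D" "b \<in> carrier A" "t \<in> D"
    and "\<And>a' s' b' t'. \<lbrakk>a' \<in> carrier A; s' \<in> D; b' \<in> carrier A; t' \<in> D;
           fraction A D a' s' = fraction A D a s; fraction A D b' t' = fraction A D b t\<rbrakk>
         \<Longrightarrow> f a' s' b' t' = f a s b t"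
  shows "(\<Union>(a', s')\<in>fraction A D a s. \<Union>(b', t')\<in>fraction A D b t. f a' s' b' t') = f a s b t"
proof -
  let ?X = "fraction A D a s" and ?Y = "fraction A D b t"
  have "f (fst p) (snd p) (fst q) (snd q) = f a s b t" if "p \<in> ?X" "q \<in> ?Y" for p q
    using that
    by (intro assms(5))
      (simp_all add: mem_fraction_iff[OF assms(1,2), of "fst p" "snd p", simplified]
        mem_fraction_iff[OF assms(3,4), of "fst q" "snd q", simplified])
  then have "(\<Union>p\<in>?X. \<Union>q\<in>?Y. f (fst p) (snd p) (fst q) (snd q)) = (\<Union>p\<in>?X. \<Union>q\<in>?Y. f a s b t)"
    by (intro SUP_cong refl)
  moreover have "?X \<noteq> {}" "?Y \<noteq> {}"
    using mem_fraction_iff[OF assms(1,2)] mem_fraction_iff[OF assms(3,4)] assms(1-4) by blast+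
  ultimately show ?thesis
    by (simp add: case_prod_beta)
qed

lemma fraction_mult:
  assumes "a \<in> carrier A" "s \<in> D" "b \<in> carrier A" "t \<in> D"
  shows "fraction A D a s \<otimes>\<^bsub>localization A D\<^esub> fraction A D b t = fraction A D (a \<otimes> b) (s \<otimes> t)"
proof -
  let ?f = "\<lambda>a s b t. fraction A D (a \<otimes> b) (s \<otimes> t)"
  have "(\<Union>(a', s')\<in>fraction A D a s. \<Union>(b', t')\<in>fraction A D b t. ?f a' s' b' t') = ?f a s b t"
    by (rule UN_fraction_const[OF assms]) (rule fraction_mult_cong[OF assms])
  then show ?thesis
    by (simp add: localization_def)
qed

lemma fraction_add:
  assumes "a \<in> carrier A" "s \<in> D" "b \<in> carrier A" "t \<in> D"
  shows "fraction A D a s \<oplus>\<^bsub>localization A D\<^esub> fraction A D b t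
    = fraction A D (t \<otimes> a \<oplus> s \<otimes> b) (s \<otimes> t)"
proof -
  let ?f = "\<lambda>a s b t. fraction A D (t \<otimes> a \<oplus> s \<otimes> b) (s \<otimes> t)"
  have "(\<Union>(a', s')\<in>fraction A D a s. \<Union>(b', t')\<in>fraction A D b t. ?f a' s' b' t') = ?f a s b t"
    by (rule UN_fraction_const[OF assms]) (rule fraction_add_cong[OF assms])
  then show ?thesis
    by (simp add: localization_def)
qed

lemma localization_one: "\<one>\<^bsub>localization A D\<^esub> = fraction A D \<one> \<one>"
  and localization_zero: "\<zero>\<^bsub>localization A D\<^esub> = fraction A D \<zero> \<one>"
  by (simp_all add: localization_def)

lemmas localization_simps = fraction_mult fraction_add localization_one localization_zero
  fraction_mem mult_mem one_mem mem_carrier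

lemma cring_localization: "cring (localization A D)"
proof (rule cringI)
  show "abelian_group (localization A D)"
  proof (rule abelian_groupI)
    fix x y assume "x \<in> carrier (localization A D)" "y \<in> carrier (localization A D)"
    then obtain a s b t where "a \<in> carrier A" "s \<in> D" "x = fraction A D a s"
      "b \<in> carrier A" "t \<in> D" "y = fraction A D b t"
      by (auto elim!: localizationE)
    then show "x \<oplus>\<^bsub>localization A D\<^esub> y \<in> carrier (localization A D)"
      and "x \<oplus>\<^bsub>localization A D\<^esub> y = y \<oplus>\<^bsub>localization A D\<^esub> x"
      by (simp_all add: localization_simps m_comm a_comm)
  next
    fix x y z
    assume "x \<in> carrier (localization A D)" "y \<in> carrier (localization A D)"
      "z \<in> carrier (localization A D)"
    then obtain a s b t c r where "a \<in> carrier A" "s \<in> D" "x = fraction A D a s"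
      "b \<in> carrier A" "t \<in> D" "y = fraction A D b t" "c \<in> carrier A" "r \<in> D" "z = fraction A D c r"
      by (auto elim!: localizationE)
    then show "x \<oplus>\<^bsub>localization A D\<^esub> y \<oplus>\<^bsub>localization A D\<^esub> z
        = x \<oplus>\<^bsub>localization A D\<^esub> (y \<oplus>\<^bsub>localization A D\<^esub> z)"
      by (simp add: localization_simps m_ac r_distr a_ac)
  next
    fix x assume "x \<in> carrier (localization A D)"
    then obtain a s where as: "a \<in> carrier A" "s \<in> D" "x = fraction A D a s"
      by (auto elim!: localizationE)
    then show "\<zero>\<^bsub>localization A D\<^esub> \<oplus>\<^bsub>localization A D\<^esub> x = x"
      by (simp add: localization_simps)
    have "fraction A D (\<ominus> a) s \<oplus>\<^bsub>localization A D\<^esub> x = fraction A D \<zero> (s \<otimes> s)"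
      using as by (simp add: localization_simps r_minus l_neg)
    also have "\<dots> = fraction A D \<zero> \<one>"
      using as by (intro fraction_eqI) (simp_all add: localization_simps)
    finally have "fraction A D (\<ominus> a) s \<oplus>\<^bsub>localization A D\<^esub> x = \<zero>\<^bsub>localization A D\<^esub>"
      by (simp add: localization_zero)
    then show "\<exists>y\<in>carrier (localization A D). y \<oplus>\<^bsub>localization A D\<^esub> x = \<zero>\<^bsub>localization A D\<^esub>"
      using as fraction_mem by blast
  qed (simp add: localization_simps)
next
  show "comm_monoid (localization A D)"
  proof (rule comm_monoidI)
    fix x y assume "x \<in> carrier (localization A D)" "y \<in> carrier (localization A D)"
    then obtain a s b t where "a \<in> carrier A" "s \<in> D" "x = fraction A D a s"
      "b \<in> carrier A" "t \<in> D" "y = fraction A D b t"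
      by (auto elim!: localizationE)
    then show "x \<otimes>\<^bsub>localization A D\<^esub> y \<in> carrier (localization A D)"
      and "x \<otimes>\<^bsub>localization A D\<^esub> y = y \<otimes>\<^bsub>localization A D\<^esub> x"
      by (simp_all add: localization_simps m_comm)
  next
    fix x y z
    assume "x \<in> carrier (localization A D)" "y \<in> carrier (localization A D)"
      "z \<in> carrier (localization A D)"
    then obtain a s b t c r where "a \<in> carrier A" "s \<in> D" "x = fraction A D a s"
      "b \<in> carrier A" "t \<in> D" "y = fraction A D b t" "c \<in> carrier A" "r \<in> D" "z = fraction A D c r"
      by (auto elim!: localizationE)
    then show "x \<otimes>\<^bsub>localization A D\<^esub> y \<otimes>\<^bsub>localization A D\<^esub> z
        = x \<otimes>\<^bsub>localization A D\<^esub> (y \<otimes>\<^bsub>localization A D\<^esub> z)"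
      by (simp add: localization_simps m_assoc)
  next
    fix x assume "x \<in> carrier (localization A D)"
    then show "\<one>\<^bsub>localization A D\<^esub> \<otimes>\<^bsub>localization A D\<^esub> x = x"
      by (elim localizationE) (simp add: localization_simps)
  qed (simp add: localization_simps)
next
  fix x y z
  assume "x \<in> carrier (localization A D)" "y \<in> carrier (localization A D)"
    "z \<in> carrier (localization A D)"
  then obtain a s b t c r where *: "a \<in> carrier A" "s \<in> D" "x = fraction A D a s"
    "b \<in> carrier A" "t \<in> D" "y = fraction A D b t" "c \<in> carrier A" "r \<in> D" "z = fraction A D c r"
    by (auto elim!: localizationE)
  have "fraction A D ((t \<otimes> a \<oplus> s \<otimes> b) \<otimes> c) ((s \<otimes> t) \<otimes> r)
      = fraction A D ((t \<otimes> r) \<otimes> (a \<otimes> c) \<oplus> (s \<otimes> r) \<otimes> (b \<otimes> c)) ((s \<otimes> r) \<otimes> (t \<otimes> r))"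
    using * by (intro fraction_eqI) (simp_all add: localization_simps m_ac l_distr r_distr)
  then show "(x \<oplus>\<^bsub>localization A D\<^esub> y) \<otimes>\<^bsub>localization A D\<^esub> z
      = x \<otimes>\<^bsub>localization A D\<^esub> z \<oplus>\<^bsub>localization A D\<^esub> y \<otimes>\<^bsub>localization A D\<^esub> z"
    using * by (simp add: localization_simps)
qed

lemma fraction_uminus:
  assumes "b \<in> carrier A" "t \<in> D"
  shows "\<ominus>\<^bsub>localization A D\<^esub> fraction A D b t = fraction A D (\<ominus> b) t"
proof -
  interpret L: cring "localization A D"
    by (rule cring_localization)
  have "fraction A D (\<ominus> b) t \<oplus>\<^bsub>localization A D\<^esub> fraction A D b t = fraction A D \<zero> (t \<otimes> t)"
    using assms by (simp add: localization_simps r_minus l_neg)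
  also have "\<dots> = \<zero>\<^bsub>localization A D\<^esub>"
    unfolding localization_zero using assms
    by (intro fraction_eqI) (simp_all add: localization_simps)
  finally show ?thesis
    using assms by (intro L.minus_equality) (simp_all add: fraction_mem)
qed

lemma fraction_minus:
  assumes "a \<in> carrier A" "s \<in> D" "b \<in> carrier A" "t \<in> D"
  shows "fraction A D a s \<ominus>\<^bsub>localization A D\<^esub> fraction A D b t
    = fraction A D (t \<otimes> a \<ominus> s \<otimes> b) (s \<otimes> t)"
  using assms by (simp add: a_minus_def fraction_uminus localization_simps r_minus)

end

section \<open>Ideals and differences in restricted rings\<close>

lemma (in cring) ideal_closureI:
  assumes "J \<subseteq> carrier R" "\<zero> \<in> J"
    and "\<And>x y. \<lbrakk>x \<in> J; y \<in> J\<rbrakk> \<Longrightarrow> x \<oplus> y \<in> J"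
    and "\<And>r x. \<lbrakk>r \<in> carrier R; x \<in> J\<rbrakk> \<Longrightarrow> r \<otimes> x \<in> J"
  shows "ideal J R"
proof (rule idealI)
  show "subgroup J (add_monoid R)"
  proof (rule add.subgroupI)
    fix x assume x: "x \<in> J"
    then have "\<ominus> x = \<ominus> \<one> \<otimes> x"
      using assms(1) by (simp add: l_minus subsetD)
    then show "\<ominus> x \<in> J"
      using assms(4)[of "\<ominus> \<one>" x] x by simp
  qed (use assms in auto)
  fix a x assume "a \<in> J" "x \<in> carrier R"
  then show "x \<otimes> a \<in> J" "a \<otimes> x \<in> J"
    using assms(4)[of x a] assms(1) m_comm[of a x] by auto
qed (rule ring_axioms)

text \<open>Additive inverses are defined by a search through the carrier, so unlike sums and
  products they do not agree by definition in \<open>R\<close> and in \<open>restr R K\<close>;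
  uniqueness of inverses identifies them.\<close>

lemma (in ring) restr_minus:
  assumes "subring K R" "x \<in> K" "y \<in> K"
  shows "x \<ominus>\<^bsub>restr R K\<^esub> y = x \<ominus> y"
proof -
  interpret K: ring "restr R K"
    using subring_is_ring[OF assms(1)] .
  have "\<ominus>\<^bsub>restr R K\<^esub> y = \<ominus> y"
    using assms K.l_neg[of y] K.a_inv_closed[of y] subringE(1)[OF assms(1)]
    by (intro minus_equality[symmetric]) auto
  then show ?thesis
    by (simp add: a_minus_def)
qed

lemma (in cring) subring_cring: "subring K R \<Longrightarrow> cring (restr R K)"
  using subcring_iff subcringI' subringE(1) by blast

subsection \<open>Residue fields\<close>

definition residue_class :: "('a, 'b) ring_scheme \<Rightarrow> 'a set \<Rightarrow> 'a \<Rightarrow> 'a \<Rightarrow> ('a \<times> 'a) set set" where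
  "residue_class A P a s = local_ideal A P +>\<^bsub>local_at A P\<^esub> fraction A (carrier A - P) a s"

context primeideal
begin

sublocale compl: multiplicative_subset R "carrier R - I"
  using I_notcarr I_prime one_imp_carrier by unfold_locales auto

sublocale local: cring "local_at R I"
  by (rule compl.cring_localization)

lemma local_ideal_is_ideal: "ideal (local_ideal R I) (local_at R I)"
  unfolding local_ideal_def
  using compl.fraction_mem compl.one_mem Icarr by (intro local.genideal_ideal) auto

text \<open>The fractions having some representation with numerator in \<open>I\<close> form an
  ideal containing the generators, hence the whole extended ideal. Since the multiplier and the
  denominators lie outside \<open>I\<close>, primality then strips them off any other
  representation.\<close>

lemma fraction_mem_local_ideal_iff:
  assumes "a \<in> carrier R" "s \<in> carrier R - I"
  shows "fraction R (carrier R - I) a s \<in> local_ideal R I \<longleftrightarrow> a \<in> I"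
proof
  let ?f = "fraction R (carrier R - I)" and ?L = "local_at R I"
  define J where "J = {?f p t |p t. p \<in> I \<and> t \<in> carrier R - I}"
  have "ideal J ?L"
  proof (rule local.ideal_closureI)
    show "J \<subseteq> carrier ?L"
      unfolding J_def using compl.fraction_mem Icarr by blast
    show "\<zero>\<^bsub>?L\<^esub> \<in> J"
      unfolding J_def compl.localization_zero using compl.one_mem by force
  next
    fix x y assume "x \<in> J" "y \<in> J"
    then obtain p t q r where *: "x = ?f p t" "y = ?f q r" "p \<in> I" "q \<in> I"
      "t \<in> carrier R - I" "r \<in> carrier R - I"
      unfolding J_def by blast
    have "x \<oplus>\<^bsub>?L\<^esub> y = ?f (r \<otimes> p \<oplus> t \<otimes> q) (t \<otimes> r)"
      using * Icarr by (simp add: compl.fraction_add)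
    moreover have "r \<otimes> p \<oplus> t \<otimes> q \<in> I" "t \<otimes> r \<in> carrier R - I"
      using * I_l_closed compl.mult_mem by auto
    ultimately show "x \<oplus>\<^bsub>?L\<^esub> y \<in> J"
      unfolding J_def by blast
  next
    fix x y assume "x \<in> carrier ?L" "y \<in> J"
    from \<open>x \<in> carrier ?L\<close> obtain a s where as: "x = ?f a s" "a \<in> carrier R" "s \<in> carrier R - I"
      by (elim compl.localizationE)
    from \<open>y \<in> J\<close> obtain q r where qr: "y = ?f q r" "q \<in> I" "r \<in> carrier R - I"
      unfolding J_def by blast
    have "x \<otimes>\<^bsub>?L\<^esub> y = ?f (a \<otimes> q) (s \<otimes> r)"
      using as qr Icarr by (simp add: compl.fraction_mult)
    moreover have "a \<otimes> q \<in> I" "s \<otimes> r \<in> carrier R - I"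
      using as qr I_l_closed compl.mult_mem by auto
    ultimately show "x \<otimes>\<^bsub>?L\<^esub> y \<in> J"
      unfolding J_def by blast
  qed
  moreover have "(\<lambda>p. ?f p \<one>) ` I \<subseteq> J"
    unfolding J_def using compl.one_mem by blast
  ultimately have "local_ideal R I \<subseteq> J"
    unfolding local_ideal_def by (rule local.genideal_minimal)
  moreover assume "?f a s \<in> local_ideal R I"
  ultimately obtain p t where pt: "p \<in> I" "t \<in> carrier R - I" "?f a s = ?f p t"
    unfolding J_def by blast
  then obtain u where u: "u \<in> carrier R - I" "u \<otimes> (t \<otimes> a) = u \<otimes> (s \<otimes> p)"
    using assms compl.fraction_eq_iff[of a s p t] Icarr by auto
  have "u \<otimes> (s \<otimes> p) \<in> I"
    using u(1) assms pt(1) I_l_closed by auto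
  then have "t \<otimes> a \<in> I"
    using u assms pt I_prime[of u "t \<otimes> a"] by (metis DiffD1 DiffD2 m_closed)
  then show "a \<in> I"
    using assms pt I_prime by auto
next
  let ?f = "fraction R (carrier R - I)" and ?L = "local_at R I"
  assume a: "a \<in> I"
  have "(\<lambda>p. ?f p \<one>) ` I \<subseteq> carrier ?L"
    using compl.fraction_mem compl.one_mem Icarr by blast
  then have "?f a \<one> \<in> local_ideal R I"
    unfolding local_ideal_def using a local.genideal_self by blast
  then have "?f a \<one> \<otimes>\<^bsub>?L\<^esub> ?f \<one> s \<in> local_ideal R I"
    using assms compl.fraction_mem ideal.I_r_closed[OF local_ideal_is_ideal] by simp
  then show "?f a s \<in> local_ideal R I"
    using assms compl.one_mem by (simp add: compl.fraction_mult)
qed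

lemma residue_class_eq_iff:
  assumes "a \<in> carrier R" "s \<in> carrier R - I" "b \<in> carrier R" "t \<in> carrier R - I"
  shows "residue_class R I a s = residue_class R I b t \<longleftrightarrow> t \<otimes> a \<ominus> s \<otimes> b \<in> I"
proof -
  have "residue_class R I a s = residue_class R I b t \<longleftrightarrow>
      fraction R (carrier R - I) (t \<otimes> a \<ominus> s \<otimes> b) (s \<otimes> t) \<in> local_ideal R I"
    unfolding residue_class_def compl.fraction_minus[OF assms, symmetric]
    using assms local.quotient_eq_iff_same_a_r_cos[OF local_ideal_is_ideal] compl.fraction_mem
    by blast
  also have "\<dots> \<longleftrightarrow> t \<otimes> a \<ominus> s \<otimes> b \<in> I"
    using assms compl.mult_mem by (intro fraction_mem_local_ideal_iff) auto
  finally show ?thesis .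
qed

lemma carrier_residue_field:
  "carrier (residue_field R I) = {residue_class R I a s |a s. a \<in> carrier R \<and> s \<in> carrier R - I}"
  unfolding residue_field_def residue_class_def FactRing_simps
  using compl.carrier_localization by auto

lemma residue_class_mem:
  "\<lbrakk>a \<in> carrier R; s \<in> carrier R - I\<rbrakk> \<Longrightarrow> residue_class R I a s \<in> carrier (residue_field R I)"
  unfolding carrier_residue_field by blast

lemma residue_class_mult:
  assumes "a \<in> carrier R" "s \<in> carrier R - I" "b \<in> carrier R" "t \<in> carrier R - I"
  shows "residue_class R I a s \<otimes>\<^bsub>residue_field R I\<^esub> residue_class R I b t
    = residue_class R I (a \<otimes> b) (s \<otimes> t)"
  using assms compl.fraction_mem compl.fraction_mult
    ideal.rcoset_mult_add[OF local_ideal_is_ideal]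
  by (simp add: residue_field_def residue_class_def FactRing_def)

lemma residue_class_add:
  assumes "a \<in> carrier R" "s \<in> carrier R - I" "b \<in> carrier R" "t \<in> carrier R - I"
  shows "residue_class R I a s \<oplus>\<^bsub>residue_field R I\<^esub> residue_class R I b t
    = residue_class R I (t \<otimes> a \<oplus> s \<otimes> b) (s \<otimes> t)"
  using assms compl.fraction_mem compl.fraction_add ideal.a_rcos_sum[OF local_ideal_is_ideal]
  by (simp add: residue_field_def residue_class_def FactRing_def)

lemma residue_class_one: "\<one>\<^bsub>residue_field R I\<^esub> = residue_class R I \<one> \<one>"
  by (simp add: residue_field_def residue_class_def FactRing_def compl.localization_one)

lemma residue_class_self:
  assumes "a \<in> carrier R" "s \<in> carrier R - I"
  shows "fraction R (carrier R - I) a s \<in> residue_class R I a s"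
    and "(a, s) \<in> fraction R (carrier R - I) a s"
proof -
  interpret K: ideal "local_ideal R I" "local_at R I"
    by (rule local_ideal_is_ideal)
  show "fraction R (carrier R - I) a s \<in> residue_class R I a s"
    unfolding residue_class_def using assms by (intro K.a_rcos_self compl.fraction_mem)
  show "(a, s) \<in> fraction R (carrier R - I) a s"
    using assms by (simp add: compl.mem_fraction_iff)
qed

text \<open>Needed because \<open>residual_map\<close> is a union over every fraction in a coset and
  every pair in a fraction: all these choices describe one residue class.\<close>

lemma mem_residue_classD:
  assumes "a \<in> carrier R" "s \<in> carrier R - I" "\<phi> \<in> residue_class R I a s" "(b, t) \<in> \<phi>"
  shows "b \<in> carrier R" "t \<in> carrier R - I" "residue_class R I b t = residue_class R I a s"
proof -
  let ?K = "local_ideal R I" and ?L = "local_at R I"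
  interpret K: ideal ?K ?L
    by (rule local_ideal_is_ideal)
  have f: "fraction R (carrier R - I) a s \<in> carrier ?L"
    using assms by (simp add: compl.fraction_mem)
  have "\<phi> \<in> carrier ?L"
    using assms(3) local.a_r_coset_subset_G[OF K.a_subset f] unfolding residue_class_def by blast
  then obtain c r where c: "c \<in> carrier R" "r \<in> carrier R - I"
      "\<phi> = fraction R (carrier R - I) c r"
    by (rule compl.localizationE)
  then show bt: "b \<in> carrier R" "t \<in> carrier R - I"
    using assms(4) compl.mem_fraction_iff by auto
  have "\<phi> = fraction R (carrier R - I) b t"
    using c assms(4) compl.mem_fraction_iff by auto
  then show "residue_class R I b t = residue_class R I a s"
    using assms(3) K.a_repr_independence'[OF _ f] unfolding residue_class_def by simp
qed

end

lemma (in cring) restr_inter_primeideal: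
  assumes "subring K R" "primeideal Q R"
  shows "primeideal (Q \<inter> K) (restr R K)"
proof -
  interpret K: cring "restr R K"
    by (rule subring_cring[OF assms(1)])
  interpret Q: primeideal Q R
    by (rule assms(2))
  show ?thesis
  proof (intro primeidealI K.ideal_closureI)
    show "carrier (restr R K) \<noteq> Q \<inter> K"
      using subringE(3)[OF assms(1)] Q.compl.one_mem by auto
  next
    fix a b assume "a \<in> carrier (restr R K)" "b \<in> carrier (restr R K)" "a \<otimes>\<^bsub>restr R K\<^esub> b \<in> Q \<inter> K"
    then show "a \<in> Q \<inter> K \<or> b \<in> Q \<inter> K"
      using Q.I_prime[of a b] subringE(1)[OF assms(1)] by auto
  qed (use subringE[OF assms(1)] Q.I_l_closed in \<open>auto simp: K.cring_axioms\<close>)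
qed

text \<open>As \<open>Q \<inter> K\<close> is exactly the contraction of \<open>Q\<close>, the
  residual map is always an injective homomorphism, and only surjectivity is a condition. The
  right-hand side is surjectivity with denominators cleared, so that later arguments never see a
  residue field.\<close>

lemma (in cring) residual_map_iso_iff:
  assumes K: "subring K R" and Q: "primeideal Q R"
  shows "residual_map R Q \<in> ring_iso (residue_field (restr R K) (Q \<inter> K)) (residue_field R Q)
    \<longleftrightarrow> (\<forall>x\<in>carrier R. \<forall>s\<in>carrier R - Q. \<exists>a\<in>K. \<exists>t\<in>K - Q. t \<otimes> x \<ominus> s \<otimes> a \<in> Q)"
proof -
  let ?A = "restr R K" and ?P = "Q \<inter> K"
  interpret P: primeideal ?P ?A
    using restr_inter_primeideal[OF assms] .
  interpret Q: primeideal Q R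
    by (rule Q)
  note sub = subringE[OF K]
  \<comment> \<open>The difference \<open>t a - s b\<close> lies in \<open>K\<close>, where
    membership in \<open>Q\<close> and in \<open>Q \<inter> K\<close> is the same. One direction
    makes the map well defined, the other makes it injective.\<close>
  have eq_iff: "residue_class ?A ?P a s = residue_class ?A ?P b t \<longleftrightarrow>
      residue_class R Q a s = residue_class R Q b t"
    if "a \<in> K" "s \<in> K - Q" "b \<in> K" "t \<in> K - Q" for a s b t
  proof -
    have "t \<otimes> a \<in> K" "s \<otimes> b \<in> K"
      using that sub(6) by auto
    moreover from this have "t \<otimes> a \<ominus> s \<otimes> b \<in> K"
      unfolding a_minus_def using sub(5,7) by blast
    ultimately show ?thesis
      using that sub(1) P.residue_class_eq_iff[of a s b t] Q.residue_class_eq_iff[of a s b t]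
        restr_minus[OF K] by (auto simp: subsetD)
  qed
  have map: "residual_map R Q (residue_class ?A ?P a s) = residue_class R Q a s"
    if as: "a \<in> K" "s \<in> K - Q" for a s
  proof -
    let ?U = "residue_class ?A ?P a s"
    have "residue_class R Q b t = residue_class R Q a s" if "\<phi> \<in> ?U" "(b, t) \<in> \<phi>" for \<phi> b t
    proof -
      have "b \<in> K" "t \<in> K - Q" "residue_class ?A ?P b t = ?U"
        using P.mem_residue_classD[OF _ _ that] as by auto
      then show ?thesis
        using eq_iff as by blast
    qed
    moreover have "residual_map R Q ?U = (\<Union>\<phi>\<in>?U. \<Union>(b, t)\<in>\<phi>. residue_class R Q b t)"
      by (simp add: residual_map_def residue_class_def)
    moreover have "\<exists>\<phi>\<in>?U. (a, s) \<in> \<phi>"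
      using P.residue_class_self[of a s] as by auto
    ultimately show ?thesis
      by fast
  qed
  have carrier: "carrier (residue_field ?A ?P) = {residue_class ?A ?P a s |a s. a \<in> K \<and> s \<in> K - Q}"
    using P.carrier_residue_field by auto
  have hom: "residual_map R Q \<in> ring_hom (residue_field ?A ?P) (residue_field R Q)"
  proof (rule ring_hom_memI)
    fix U assume "U \<in> carrier (residue_field ?A ?P)"
    then obtain a s where "U = residue_class ?A ?P a s" "a \<in> K" "s \<in> K - Q"
      unfolding carrier by blast
    then show "residual_map R Q U \<in> carrier (residue_field R Q)"
      using map sub(1) Q.residue_class_mem[of a s] by auto
  next
    fix U W assume "U \<in> carrier (residue_field ?A ?P)" "W \<in> carrier (residue_field ?A ?P)"
    then obtain a s b t where *: "U = residue_class ?A ?P a s" "W = residue_class ?A ?P b t"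
      "a \<in> K" "s \<in> K - Q" "b \<in> K" "t \<in> K - Q"
      unfolding carrier by blast
    then have mem: "a \<otimes> b \<in> K" "t \<otimes> a \<oplus> s \<otimes> b \<in> K" "s \<otimes> t \<in> K - Q"
      using sub Q.compl.mult_mem[of s t] by auto
    have "U \<otimes>\<^bsub>residue_field ?A ?P\<^esub> W = residue_class ?A ?P (a \<otimes> b) (s \<otimes> t)"
      "U \<oplus>\<^bsub>residue_field ?A ?P\<^esub> W = residue_class ?A ?P (t \<otimes> a \<oplus> s \<otimes> b) (s \<otimes> t)"
      using P.residue_class_mult[of a s b t] P.residue_class_add[of a s b t] * by simp_all
    then show "residual_map R Q (U \<otimes>\<^bsub>residue_field ?A ?P\<^esub> W)
        = residual_map R Q U \<otimes>\<^bsub>residue_field R Q\<^esub> residual_map R Q W"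
      and "residual_map R Q (U \<oplus>\<^bsub>residue_field ?A ?P\<^esub> W)
        = residual_map R Q U \<oplus>\<^bsub>residue_field R Q\<^esub> residual_map R Q W"
      using * mem sub(1) Q.residue_class_mult[of a s b t] Q.residue_class_add[of a s b t] map
      by (simp_all add: subset_iff)
  next
    have "\<one> \<in> K - Q"
      using sub(3) Q.compl.one_mem by blast
    then show "residual_map R Q \<one>\<^bsub>residue_field ?A ?P\<^esub> = \<one>\<^bsub>residue_field R Q\<^esub>"
      using map P.residue_class_one Q.residue_class_one by simp
  qed
  have inj: "inj_on (residual_map R Q) (carrier (residue_field ?A ?P))"
  proof (rule inj_onI)
    fix U W assume "U \<in> carrier (residue_field ?A ?P)" "W \<in> carrier (residue_field ?A ?P)"
      and eq: "residual_map R Q U = residual_map R Q W"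
    then obtain a s b t where *: "U = residue_class ?A ?P a s" "W = residue_class ?A ?P b t"
      "a \<in> K" "s \<in> K - Q" "b \<in> K" "t \<in> K - Q"
      unfolding carrier by blast
    then show "U = W"
      using eq map eq_iff[of a s b t] by simp
  qed
  have "residual_map R Q ` carrier (residue_field ?A ?P)
      = (\<lambda>(a, s). residual_map R Q (residue_class ?A ?P a s)) ` (K \<times> (K - Q))"
    unfolding carrier by force
  also have "\<dots> = (\<lambda>(a, s). residue_class R Q a s) ` (K \<times> (K - Q))"
    using map by (intro image_cong) auto
  also have "\<dots> = {residue_class R Q a s |a s. a \<in> K \<and> s \<in> K - Q}"
    by (auto simp: image_iff Bex_def)
  finally have "residual_map R Q ` carrier (residue_field ?A ?P)
      = {residue_class R Q a s |a s. a \<in> K \<and> s \<in> K - Q}" .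
  moreover have "\<dots> = carrier (residue_field R Q) \<longleftrightarrow>
      (\<forall>x\<in>carrier R. \<forall>s\<in>carrier R - Q. \<exists>a\<in>K. \<exists>t\<in>K - Q.
        residue_class R Q x s = residue_class R Q a t)"
    (is "_ \<longleftrightarrow> ?surj")
  proof
    assume eq: "{residue_class R Q a s |a s. a \<in> K \<and> s \<in> K - Q} = carrier (residue_field R Q)"
    show ?surj
    proof (intro ballI)
      fix x s assume "x \<in> carrier R" "s \<in> carrier R - Q"
      then have "residue_class R Q x s \<in> {residue_class R Q a s |a s. a \<in> K \<and> s \<in> K - Q}"
        unfolding eq by (rule Q.residue_class_mem)
      then show "\<exists>a\<in>K. \<exists>t\<in>K - Q. residue_class R Q x s = residue_class R Q a t"
        by blast
    qed
  next
    assume surj: ?surj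
    show "{residue_class R Q a s |a s. a \<in> K \<and> s \<in> K - Q} = carrier (residue_field R Q)"
    proof (intro equalityI subsetI)
      fix y assume "y \<in> {residue_class R Q a s |a s. a \<in> K \<and> s \<in> K - Q}"
      then show "y \<in> carrier (residue_field R Q)"
        unfolding Q.carrier_residue_field using sub(1) by blast
    next
      fix y assume "y \<in> carrier (residue_field R Q)"
      then obtain x s where "x \<in> carrier R" "s \<in> carrier R - Q" "y = residue_class R Q x s"
        unfolding Q.carrier_residue_field by blast
      then show "y \<in> {residue_class R Q a s |a s. a \<in> K \<and> s \<in> K - Q}"
        using surj by blast
    qed
  qed
  moreover have "residue_class R Q x s = residue_class R Q a t \<longleftrightarrow> t \<otimes> x \<ominus> s \<otimes> a \<in> Q"
    if "x \<in> carrier R" "s \<in> carrier R - Q" "a \<in> K" "t \<in> K - Q" for x s a t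
    using that sub(1) by (intro Q.residue_class_eq_iff) auto
  ultimately have "residual_map R Q ` carrier (residue_field ?A ?P) = carrier (residue_field R Q)
      \<longleftrightarrow> (\<forall>x\<in>carrier R. \<forall>s\<in>carrier R - Q. \<exists>a\<in>K. \<exists>t\<in>K - Q. t \<otimes> x \<ominus> s \<otimes> a \<in> Q)"
    by simp
  then show ?thesis
    using hom inj unfolding ring_iso_def bij_betw_def by simp
qed

subsection \<open>Support and residue fields with two elements\<close>

lemma (in cring) subring_abelian_subgroup: "subring K R \<Longrightarrow> abelian_subgroup K R"
  using subring.axioms(1) additive_subgroup.intro abelian_group_axioms abelian_subgroupI3 by blast

lemma (in cring) quot_module_smult:
  assumes "subring K R" "r \<in> K" "x \<in> carrier R"
  shows "r \<odot>\<^bsub>quot_module R K\<^esub> (K +> x) = K +> (r \<otimes> x)"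
proof -
  interpret K: abelian_subgroup K R
    by (rule subring_abelian_subgroup[OF assms(1)])
  note sub = subringE[OF assms(1)]
  have "K +> (r \<otimes> y) = K +> (r \<otimes> x)" if "y \<in> K +> x" for y
  proof -
    obtain k where k: "k \<in> K" "y = k \<oplus> x"
      using \<open>y \<in> K +> x\<close> unfolding a_r_coset_def' by blast
    then have "r \<otimes> y = r \<otimes> k \<oplus> r \<otimes> x" "r \<otimes> k \<in> K"
      using assms sub by (auto simp: r_distr subsetD)
    then have "r \<otimes> y \<in> K +> (r \<otimes> x)"
      unfolding a_r_coset_def' by blast
    then show ?thesis
      using K.a_repr_independence' assms sub(1) by (metis m_closed subsetD)
  qed
  then have "(\<Union>y\<in>K +> x. K +> (r \<otimes> y)) = K +> (r \<otimes> x)"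
    using K.a_rcos_self[OF assms(3)] by (intro UN_constant_eq ballI)
  then show ?thesis
    by (simp add: quot_module_def)
qed

text \<open>A fraction \<open>(K +> x)/1\<close> is zero precisely when some \<open>u\<close>
  outside \<open>M\<close> kills the coset, that is, moves \<open>x\<close> into \<open>K\<close>.
  The localization is therefore nonzero when some \<open>x\<close> resists every such
  \<open>u\<close>.\<close>

lemma (in cring) MSupp_quot_module:
  assumes K: "subring K R"
  shows "MSupp (restr R K) (quot_module R K) =
    {M. maximalideal M (restr R K) \<and> (\<exists>x\<in>carrier R. \<forall>u\<in>K - M. u \<otimes> x \<notin> K)}"
proof -
  let ?A = "restr R K" and ?N = "quot_module R K"
  interpret A: cring ?A
    by (rule subring_cring[OF K])
  interpret K: abelian_subgroup K R
    by (rule subring_abelian_subgroup[OF K])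
  note sub = subringE[OF K]
  have smult: "r \<odot>\<^bsub>?N\<^esub> (K +> x) = K +> (r \<otimes> x)" if "r \<in> K" "x \<in> carrier R" for r x
    by (rule quot_module_smult[OF K that])
  have carrier: "carrier ?N = {K +> x |x. x \<in> carrier R}"
    by (auto simp: quot_module_def A_RCOSETS_def')
  have coset_eq: "K +> x = K \<longleftrightarrow> x \<in> K" if "x \<in> carrier R" for x
    using that K.a_rcos_const K.a_rcos_self by blast
  have zero: "\<zero>\<^bsub>?N\<^esub> = K +> \<zero>"
    using coset_eq[OF zero_closed] sub(2) by (simp add: quot_module_def)
  have "carrier (mod_localization ?A (K - M) ?N) = {\<zero>\<^bsub>mod_localization ?A (K - M) ?N\<^esub>}
      \<longleftrightarrow> (\<forall>x\<in>carrier R. \<exists>u\<in>K - M. u \<otimes> x \<in> K)" (is "?triv \<longleftrightarrow> ?kill")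
    if M: "maximalideal M ?A" for M
  proof
    interpret M: primeideal M ?A
      by (rule A.maximalideal_prime[OF M])
    have one: "\<one> \<in> K - M"
      using M.compl.one_mem by simp
    assume triv: ?triv
    show ?kill
    proof
      fix x assume x: "x \<in> carrier R"
      let ?U = "mod_frac (K - M) ?N (K +> x) \<one>"
      have "((K +> x, \<one>), (K +> x, \<one>)) \<in> mod_frac_rel (K - M) ?N"
        using x one unfolding mod_frac_rel_def carrier by blast
      then have mem: "(K +> x, \<one>) \<in> ?U"
        unfolding mod_frac_def by blast
      have "?U \<in> carrier (mod_localization ?A (K - M) ?N)"
        using x one unfolding mod_localization_def mod_frac_def quotient_def carrier by auto
      then have "?U = mod_frac (K - M) ?N (K +> \<zero>) \<one>"
        unfolding triv zero[symmetric] by (simp add: mod_localization_def)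
      then have "((K +> \<zero>, \<one>), (K +> x, \<one>)) \<in> mod_frac_rel (K - M) ?N"
        using mem unfolding mod_frac_def by blast
      then obtain u where "u \<in> K - M"
        "u \<odot>\<^bsub>?N\<^esub> (\<one> \<odot>\<^bsub>?N\<^esub> (K +> \<zero>)) = u \<odot>\<^bsub>?N\<^esub> (\<one> \<odot>\<^bsub>?N\<^esub> (K +> x))"
        unfolding mod_frac_rel_def by blast
      moreover from this(1) have "u \<in> K" "u \<in> carrier R"
        using sub(1) by auto
      ultimately have "u \<in> K - M" "K +> (u \<otimes> x) = K +> \<zero>"
        using x sub(3) smult[of \<one> \<zero>] smult[of \<one> x] smult[of u \<zero>] smult[of u x] by simp_all
      moreover have "K +> \<zero> = K"
        using coset_eq sub(2) by simp
      ultimately show "\<exists>u\<in>K - M. u \<otimes> x \<in> K"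
        using coset_eq x sub(1) by (metis DiffD1 m_closed subsetD)
    qed
  next
    interpret M: primeideal M ?A
      by (rule A.maximalideal_prime[OF M])
    have one: "\<one> \<in> K - M"
      using M.compl.one_mem by simp
    assume kill: ?kill
    have "mod_frac (K - M) ?N U s = carrier ?N \<times> (K - M)"
      if "U \<in> carrier ?N" and s: "s \<in> K - M" for U s
    proof -
      have "((U, s), (W, t)) \<in> mod_frac_rel (K - M) ?N"
        if "W \<in> carrier ?N" and t: "t \<in> K - M" for W t
      proof -
        obtain x y where xy: "x \<in> carrier R" "U = K +> x" "y \<in> carrier R" "W = K +> y"
          using \<open>U \<in> carrier ?N\<close> \<open>W \<in> carrier ?N\<close> unfolding carrier by blast
        obtain u v where uv: "u \<in> K - M" "u \<otimes> x \<in> K" "v \<in> K - M" "v \<otimes> y \<in> K"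
          using kill xy by meson
        note car [simp] = subsetD[OF sub(1)]
        \<comment> \<open>With \<open>u\<close> killing the coset of \<open>x\<close> and
          \<open>v\<close> that of \<open>y\<close>, the product \<open>u v\<close> makes both sides
          of the fraction relation zero; hence all pairs fall into a single class.\<close>
        have "u \<otimes> v \<in> K - M"
          using M.compl.mult_mem[of u v] uv by simp
        moreover have "(u \<otimes> v) \<otimes> (t \<otimes> x) = (v \<otimes> t) \<otimes> (u \<otimes> x)"
          "(u \<otimes> v) \<otimes> (s \<otimes> y) = (u \<otimes> s) \<otimes> (v \<otimes> y)"
          using xy uv s t by (simp_all add: m_ac)
        then have "(u \<otimes> v) \<otimes> (t \<otimes> x) \<in> K" "(u \<otimes> v) \<otimes> (s \<otimes> y) \<in> K"
          using uv s t sub(6) by auto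
        then have "K +> (u \<otimes> v \<otimes> (t \<otimes> x)) = K +> (u \<otimes> v \<otimes> (s \<otimes> y))"
          using coset_eq sub(1) by (metis subsetD)
        then have "(u \<otimes> v) \<odot>\<^bsub>?N\<^esub> (t \<odot>\<^bsub>?N\<^esub> U) = (u \<otimes> v) \<odot>\<^bsub>?N\<^esub> (s \<odot>\<^bsub>?N\<^esub> W)"
          using xy uv s t sub(6) by (simp add: smult)
        ultimately show ?thesis
          unfolding mod_frac_rel_def using that \<open>U \<in> carrier ?N\<close> s by blast
      qed
      then show ?thesis
        unfolding mod_frac_def by (auto simp: mod_frac_rel_def)
    qed
    moreover have "K +> \<zero> \<in> carrier ?N"
      unfolding carrier by blast
    ultimately show ?triv
      using one zero unfolding mod_localization_def quotient_def mod_frac_def by auto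
  qed
  then show ?thesis
    unfolding MSupp_def by (intro Collect_cong conj_cong refl) simp
qed

text \<open>In a domain the only idempotents are 0 and 1, so idempotence of all residues leaves just
  these two, which are distinct. The right-hand side turns the abstract isomorphism into the
  identity used in every Boolean computation.\<close>

lemma (in cring) Quot_iso_ZFact_2_iff:
  assumes "maximalideal M R"
  shows "R Quot M \<simeq> ZFact 2 \<longleftrightarrow> (\<forall>r\<in>carrier R. r \<otimes> r \<ominus> r \<in> M)"
proof
  interpret M: maximalideal M R
    by (rule assms)
  let ?q = "\<lambda>x. M +> x"
  have eq_iff: "?q x = ?q y \<longleftrightarrow> x \<ominus> y \<in> M" if "x \<in> carrier R" "y \<in> carrier R" for x y
    using quotient_eq_iff_same_a_r_cos[OF M.is_ideal] that by blast
  have q_ops: "?q x \<oplus>\<^bsub>R Quot M\<^esub> ?q y = ?q (x \<oplus> y)" "?q x \<otimes>\<^bsub>R Quot M\<^esub> ?q y = ?q (x \<otimes> y)"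
    if "x \<in> carrier R" "y \<in> carrier R" for x y
    using that M.a_rcos_sum[of x y] M.rcoset_mult_add[of x y] by (simp_all add: FactRing_def)
  have q_mem: "?q x \<in> carrier (R Quot M)" if "x \<in> carrier R" for x
    using that ring_hom_closed[OF M.rcos_ring_hom] by blast
  {
    assume "R Quot M \<simeq> ZFact 2"
    then obtain h where h: "h \<in> ring_iso (R Quot M) (ZFact 2)"
      unfolding is_ring_iso_def by blast
    have sq: "z \<otimes>\<^bsub>ZFact 2\<^esub> z = z" if z: "z \<in> carrier (ZFact 2)" for z
    proof -
      interpret Z: ideal "Idl\<^bsub>\<Z>\<^esub> {2}" \<Z>
        by (rule int.genideal_ideal) simp
      obtain n where n: "z = Idl\<^bsub>\<Z>\<^esub> {2} +>\<^bsub>\<Z>\<^esub> n"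
        using z by (auto simp: ZFact_defs A_RCOSETS_def')
      have "n * n - n \<in> Idl\<^bsub>\<Z>\<^esub> {2}"
        unfolding int_Idl by (auto intro!: exI[of _ "(n * n - n) div 2"])
      then have "Idl\<^bsub>\<Z>\<^esub> {2} +>\<^bsub>\<Z>\<^esub> (n * n) = Idl\<^bsub>\<Z>\<^esub> {2} +>\<^bsub>\<Z>\<^esub> n"
        using int.quotient_eq_iff_same_a_r_cos[OF Z.is_ideal, of "n * n" n] by simp
      then show ?thesis
        unfolding n using Z.rcoset_mult_add[of n n] by (simp add: ZFact_defs)
    qed
    show "\<forall>r\<in>carrier R. r \<otimes> r \<ominus> r \<in> M"
    proof
      fix r assume r: "r \<in> carrier R"
      have "h (?q (r \<otimes> r)) = h (?q r) \<otimes>\<^bsub>ZFact 2\<^esub> h (?q r)"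
        using ring_iso_memE(2)[OF h q_mem[OF r] q_mem[OF r]] q_ops(2)[OF r r] by simp
      also have "\<dots> = h (?q r)"
        by (rule sq[OF ring_iso_memE(1)[OF h q_mem[OF r]]])
      finally have "?q (r \<otimes> r) = ?q r"
        using h q_mem r unfolding ring_iso_def bij_betw_def by (auto dest: inj_onD)
      then show "r \<otimes> r \<ominus> r \<in> M"
        using eq_iff r by simp
    qed
  }
  assume idem: "\<forall>r\<in>carrier R. r \<otimes> r \<ominus> r \<in> M"
  interpret Q: cring "R Quot M"
    by (rule M.quotient_is_cring[OF cring_axioms])
  interpret P: primeideal M R
    by (rule maximalideal_prime[OF assms])
  have two: "\<one> \<oplus> \<one> \<in> M"
  proof -
    \<comment> \<open>Since \<open>4 - 2 = 2\<close>, idempotence of the residue of 2 is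
      characteristic two.\<close>
    have "(\<one> \<oplus> \<one>) \<otimes> (\<one> \<oplus> \<one>) \<ominus> (\<one> \<oplus> \<one>) = \<one> \<oplus> \<one>"
      by algebra
    then show ?thesis
      using bspec[OF idem, of "\<one> \<oplus> \<one>"] by simp
  qed
  have cases: "r \<in> M \<or> r \<ominus> \<one> \<in> M" if "r \<in> carrier R" for r
  proof -
    have "r \<otimes> r \<ominus> r = r \<otimes> (r \<ominus> \<one>)"
      using that by algebra
    then show ?thesis
      using bspec[OF idem that] P.I_prime[of r "r \<ominus> \<one>"] that by auto
  qed
  have q_two: "?q \<one> \<oplus>\<^bsub>R Quot M\<^esub> ?q \<one> = ?q \<zero>"
    using M.a_rcos_sum[of \<one> \<one>] two eq_iff[of "\<one> \<oplus> \<one>" \<zero>] by (simp add: FactRing_def a_minus_def)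
  \<comment> \<open>The canonical map from the integers, written by parity; its kernel is the ideal
    of even numbers, so the first isomorphism theorem produces \<open>ZFact 2\<close>.\<close>
  define h where "h n = (if even n then ?q \<zero> else ?q \<one>)" for n :: int
  have "ring_hom_ring \<Z> (R Quot M) h"
    using q_two q_ops q_mem
    by (intro ring_hom_ringI int.ring_axioms Q.ring_axioms)
      (auto simp: h_def FactRing_def)
  moreover have "h ` carrier \<Z> = carrier (R Quot M)"
  proof
    show "h ` carrier \<Z> \<subseteq> carrier (R Quot M)"
      using q_mem by (auto simp: h_def)
    show "carrier (R Quot M) \<subseteq> h ` carrier \<Z>"
    proof
      fix U assume "U \<in> carrier (R Quot M)"
      then obtain r where r: "r \<in> carrier R" "U = ?q r"
        by (auto simp: FactRing_def A_RCOSETS_def')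
      have "U = h 0 \<or> U = h 1"
        using cases[OF r(1)] r eq_iff[of r \<zero>] eq_iff[of r \<one>] by (auto simp: h_def a_minus_def)
      then show "U \<in> h ` carrier \<Z>"
        by auto
    qed
  qed
  ultimately have "\<Z> Quot a_kernel \<Z> (R Quot M) h \<simeq> R Quot M"
    using ring_hom_ring.FactRing_iso by blast
  moreover have "a_kernel \<Z> (R Quot M) h = Idl\<^bsub>\<Z>\<^esub> {2}"
  proof -
    have "?q \<zero> = M"
      using a_rcos_zero[OF M.is_ideal M.zero_closed] .
    moreover have "?q \<one> \<noteq> M"
      using M.rcos_const_imp_mem[OF one_closed] P.compl.one_mem by blast
    ultimately have "h n = M \<longleftrightarrow> even n" for n
      by (simp add: h_def)
    then show ?thesis
      unfolding int_Idl a_kernel_def' by (auto simp: FactRing_def elim!: evenE)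
  qed
  ultimately have "ZFact 2 \<simeq> R Quot M"
    by (simp add: ZFact_def)
  then show "R Quot M \<simeq> ZFact 2"
    by (rule ring_iso_sym[OF cring.axioms(1)[OF ZFact_is_cring]])
qed

subsection \<open>Primes and maximal ideals\<close>

lemma (in cring) adjoin_ideal:
  assumes "ideal Q R" "a \<in> carrier R"
  shows "ideal {q \<oplus> r \<otimes> a |q r. q \<in> Q \<and> r \<in> carrier R} R"
proof -
  interpret Q: ideal Q R by fact
  show ?thesis
  proof (rule ideal_closureI)
    show "{q \<oplus> r \<otimes> a |q r. q \<in> Q \<and> r \<in> carrier R} \<subseteq> carrier R"
      using assms(2) Q.Icarr by auto
    show "\<zero> \<in> {q \<oplus> r \<otimes> a |q r. q \<in> Q \<and> r \<in> carrier R}"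
      using assms(2) additive_subgroup.zero_closed[OF ideal.axioms(1)[OF assms(1)]]
      by (intro CollectI exI[of _ \<zero>]) simp
  next
    fix x y assume "x \<in> {q \<oplus> r \<otimes> a |q r. q \<in> Q \<and> r \<in> carrier R}"
      "y \<in> {q \<oplus> r \<otimes> a |q r. q \<in> Q \<and> r \<in> carrier R}"
    then obtain q r q' r' where *: "x = q \<oplus> r \<otimes> a" "y = q' \<oplus> r' \<otimes> a" "q \<in> Q" "q' \<in> Q"
      "r \<in> carrier R" "r' \<in> carrier R"
      by blast
    have "x \<oplus> y = (q \<oplus> q') \<oplus> (r \<oplus> r') \<otimes> a"
      unfolding *(1,2) using *(3,4)[THEN Q.Icarr] *(5,6) assms(2) by algebra
    moreover have "q \<oplus> q' \<in> Q"
      using * additive_subgroup.a_closed[OF ideal.axioms(1)[OF assms(1)]] by blast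
    ultimately show "x \<oplus> y \<in> {q \<oplus> r \<otimes> a |q r. q \<in> Q \<and> r \<in> carrier R}"
      using *(5,6) by blast
  next
    fix s x assume s: "s \<in> carrier R" "x \<in> {q \<oplus> r \<otimes> a |q r. q \<in> Q \<and> r \<in> carrier R}"
    then obtain q r where *: "x = q \<oplus> r \<otimes> a" "q \<in> Q" "r \<in> carrier R"
      by blast
    have "s \<otimes> x = s \<otimes> q \<oplus> (s \<otimes> r) \<otimes> a"
      unfolding *(1) using s * assms(2) Q.Icarr by (simp add: r_distr m_assoc)
    moreover have "s \<otimes> q \<in> Q" "s \<otimes> r \<in> carrier R"
      using * s Q.I_l_closed by auto
    ultimately show "s \<otimes> x \<in> {q \<oplus> r \<otimes> a |q r. q \<in> Q \<and> r \<in> carrier R}"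
      by blast
  qed
qed

text \<open>Zorn's lemma. Maximality is kept among the conclusions, because the lying-over argument
  below needs it: for \<open>m\<close> outside \<open>Q\<close> it yields an element of
  \<open>D\<close> of the form \<open>q + b m\<close>.\<close>

lemma (in cring) exists_prime_disjoint:
  assumes J: "ideal J R" and one: "\<one> \<in> D" and disj: "J \<inter> D = {}"
    and mult: "\<And>d e. \<lbrakk>d \<in> D; e \<in> D\<rbrakk> \<Longrightarrow> d \<otimes> e \<in> D"
  obtains Q where "primeideal Q R" "J \<subseteq> Q" "Q \<inter> D = {}"
    "\<And>I. \<lbrakk>ideal I R; Q \<subset> I\<rbrakk> \<Longrightarrow> I \<inter> D \<noteq> {}"
proof -
  let ?A = "{I. ideal I R \<and> J \<subseteq> I \<and> I \<inter> D = {}}"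
  have "\<exists>Q\<in>?A. \<forall>I\<in>?A. Q \<subseteq> I \<longrightarrow> I = Q"
  proof (rule subset_Zorn_nonempty)
    show "?A \<noteq> {}"
      using J disj by blast
    fix C assume C: "C \<noteq> {}" "subset.chain ?A C"
    then have id: "\<And>I. I \<in> C \<Longrightarrow> ideal I R"
      by (auto simp: subset_chain_def)
    have total: "\<And>I J. \<lbrakk>I \<in> C; J \<in> C\<rbrakk> \<Longrightarrow> I \<subseteq> J \<or> J \<subseteq> I"
      using C(2) by (simp add: subset_chain_def)
    have between: "\<And>I. I \<in> C \<Longrightarrow> J \<subseteq> I" "\<And>I. I \<in> C \<Longrightarrow> I \<inter> D = {}"
      using C(2) by (auto simp: subset_chain_def)
    have "ideal (\<Union>C) R"
    proof (rule ideal_closureI)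
      show "\<Union>C \<subseteq> carrier R"
        using ideal.Icarr[OF id] by (intro Union_least subsetI)
      obtain I where "I \<in> C"
        using C(1) by blast
      then show "\<zero> \<in> \<Union>C"
        using additive_subgroup.zero_closed[OF ideal.axioms(1)[OF id]] by blast
    next
      fix x y assume "x \<in> \<Union>C" "y \<in> \<Union>C"
      then obtain I where "I \<in> C" "x \<in> I" "y \<in> I"
        using total by (metis UnionE subsetD)
      then show "x \<oplus> y \<in> \<Union>C"
        using additive_subgroup.a_closed[OF ideal.axioms(1)[OF id]] by blast
    next
      fix r x assume "r \<in> carrier R" "x \<in> \<Union>C"
      then obtain I where "I \<in> C" "x \<in> I"
        by blast
      then show "r \<otimes> x \<in> \<Union>C"
        using ideal.I_l_closed[OF id] \<open>r \<in> carrier R\<close> by blast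
    qed
    moreover have "J \<subseteq> \<Union>C" "\<Union>C \<inter> D = {}"
      using between C(1) by fast+
    ultimately show "\<Union>C \<in> ?A"
      by blast
  qed
  then obtain Q where "Q \<in> ?A" and Q_max: "\<forall>I\<in>?A. Q \<subseteq> I \<longrightarrow> I = Q"
    by (rule bexE)
  then have Q: "ideal Q R" "J \<subseteq> Q" "Q \<inter> D = {}"
    by simp_all
  have max: "I = Q" if "ideal I R" "J \<subseteq> I" "I \<inter> D = {}" "Q \<subseteq> I" for I
    using Q_max that by simp
  interpret Q: ideal Q R by (rule Q(1))
  have meet: "I \<inter> D \<noteq> {}" if "ideal I R" "Q \<subset> I" for I
    using max[OF that(1)] that(2) Q(2) by blast
  have "primeideal Q R"
  proof (rule primeidealI[OF Q(1) cring_axioms])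
    show "carrier R \<noteq> Q"
      using one Q(3) one_closed by blast
    fix a b assume ab: "a \<in> carrier R" "b \<in> carrier R" "a \<otimes> b \<in> Q"
    show "a \<in> Q \<or> b \<in> Q"
    proof (rule ccontr)
      assume neither: "\<not> (a \<in> Q \<or> b \<in> Q)"
      have *: "\<exists>q\<in>Q. \<exists>r\<in>carrier R. q \<oplus> r \<otimes> c \<in> D" if c: "c \<in> carrier R" "c \<notin> Q" for c
      proof -
        let ?I = "{q \<oplus> r \<otimes> c |q r. q \<in> Q \<and> r \<in> carrier R}"
        have "c \<in> ?I"
          using c additive_subgroup.zero_closed[OF ideal.axioms(1)[OF Q(1)]]
          by (intro CollectI exI[of _ \<zero>] exI[of _ \<one>]) simp
        moreover have "Q \<subseteq> ?I"
        proof
          fix q assume "q \<in> Q"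
          then show "q \<in> ?I"
            using c Q.Icarr by (intro CollectI exI[of _ q] exI[of _ \<zero>]) simp
        qed
        ultimately have "Q \<subset> ?I"
          using c by blast
        then show ?thesis
          using meet[OF adjoin_ideal[OF Q(1) c(1)]] by blast
      qed
      obtain q r where d: "q \<in> Q" "r \<in> carrier R" "q \<oplus> r \<otimes> a \<in> D"
        using *[of a] ab neither by blast
      obtain p s where e: "p \<in> Q" "s \<in> carrier R" "p \<oplus> s \<otimes> b \<in> D"
        using *[of b] ab neither by blast
      note car = ab(1,2) d(2) e(2) Q.Icarr[OF d(1)] Q.Icarr[OF e(1)]
      have "(q \<oplus> r \<otimes> a) \<otimes> (p \<oplus> s \<otimes> b)
          = (p \<oplus> s \<otimes> b) \<otimes> q \<oplus> ((r \<otimes> a) \<otimes> p \<oplus> (r \<otimes> s) \<otimes> (a \<otimes> b))"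
        using car by algebra
      also have "\<dots> \<in> Q"
        using Q.I_l_closed[OF d(1), of "p \<oplus> s \<otimes> b"] Q.I_l_closed[OF e(1), of "r \<otimes> a"]
          Q.I_l_closed[OF ab(3), of "r \<otimes> s"] car
        by (intro additive_subgroup.a_closed[OF ideal.axioms(1)[OF Q(1)]]) simp_all
      finally show False
        using mult[OF d(3) e(3)] Q(3) by blast
    qed
  qed
  then show thesis
    using that Q meet by blast
qed

lemma (in cring) exists_maximalideal:
  assumes "ideal J R" "\<one> \<notin> J"
  obtains M where "maximalideal M R" "J \<subseteq> M"
proof -
  obtain Q where Q: "primeideal Q R" "J \<subseteq> Q" "Q \<inter> {\<one>} = {}"
    and meet: "\<And>I. \<lbrakk>ideal I R; Q \<subset> I\<rbrakk> \<Longrightarrow> I \<inter> {\<one>} \<noteq> {}"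
    using exists_prime_disjoint[of J "{\<one>}"] assms by auto
  have "maximalideal Q R"
  proof (rule maximalidealI)
    show "ideal Q R"
      using Q(1) primeideal.axioms(1) by blast
    show "carrier R \<noteq> Q"
      using Q(3) one_closed by blast
    show "I = Q \<or> I = carrier R" if "ideal I R" "Q \<subseteq> I" "I \<subseteq> carrier R" for I
      using meet[OF that(1)] that ideal.one_imp_carrier[OF that(1)] by blast
  qed
  then show thesis
    using that Q(2) by blast
qed

lemma (in cring) avoids_maximal_imp_Unit:
  assumes "a \<in> carrier R" "\<And>N. maximalideal N R \<Longrightarrow> a \<notin> N"
  shows "a \<in> Units R"
proof (rule ccontr)
  assume "a \<notin> Units R"
  then have "\<one> \<notin> PIdl a"
    using assms(1) m_comm unfolding cgenideal_def Units_def by fastforce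
  then obtain N where "maximalideal N R" "PIdl a \<subseteq> N"
    using exists_maximalideal[OF cgenideal_ideal[OF assms(1)]] by blast
  then show False
    using assms cgenideal_self by blast
qed

text \<open>The denominators \<open>u\<close> with \<open>u t\<close> in \<open>K\<close> form an
  ideal of \<open>K\<close>. By hypothesis no maximal ideal contains it, so it contains 1.\<close>

lemma (in cring) mem_subring_local:
  assumes K: "subring K R" and t: "t \<in> carrier R"
    and loc: "\<And>M. maximalideal M (restr R K) \<Longrightarrow> \<exists>u\<in>K - M. u \<otimes> t \<in> K"
  shows "t \<in> K"
proof (rule ccontr)
  interpret K: cring "restr R K"
    by (rule subring_cring[OF K])
  note sub = subringE[OF K]
  let ?J = "{u \<in> K. u \<otimes> t \<in> K}"
  assume "t \<notin> K"
  have "ideal ?J (restr R K)"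
  proof (rule K.ideal_closureI)
    fix x y assume "x \<in> ?J" "y \<in> ?J"
    moreover have "(x \<oplus> y) \<otimes> t = x \<otimes> t \<oplus> y \<otimes> t" if "x \<in> K" "y \<in> K"
      using that t sub(1) by (auto intro: l_distr)
    ultimately show "x \<oplus>\<^bsub>restr R K\<^esub> y \<in> ?J"
      using sub(7) by auto
  next
    fix r x assume "r \<in> carrier (restr R K)" "x \<in> ?J"
    moreover have "(r \<otimes> x) \<otimes> t = r \<otimes> (x \<otimes> t)" if "r \<in> K" "x \<in> K"
      using that t sub(1) by (auto intro: m_assoc)
    ultimately show "r \<otimes>\<^bsub>restr R K\<^esub> x \<in> ?J"
      using sub(6) by auto
  qed (use sub t in auto)
  moreover have "\<one>\<^bsub>restr R K\<^esub> \<notin> ?J"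
    using t \<open>t \<notin> K\<close> by simp
  ultimately obtain M where "maximalideal M (restr R K)" "?J \<subseteq> M"
    by (rule K.exists_maximalideal)
  then show False
    using loc by blast
qed

subsection \<open>Finitely generated modules over a subring\<close>

text \<open>The coefficient set is a parameter because spans are needed both over an ideal of the
  subring and over the whole subring. The family \<open>w\<close> is total so that powers can be
  plugged in directly; only the indices below the bound count.\<close>

primrec lin_span :: "('a, 'b) ring_scheme \<Rightarrow> 'a set \<Rightarrow> (nat \<Rightarrow> 'a) \<Rightarrow> nat \<Rightarrow> 'a set" where
  "lin_span A M w 0 = {\<zero>\<^bsub>A\<^esub>}"
| "lin_span A M w (Suc n) = {s \<oplus>\<^bsub>A\<^esub> m \<otimes>\<^bsub>A\<^esub> w n |s m. s \<in> lin_span A M w n \<and> m \<in> M}"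

locale subring_ideal = cring R for R (structure) and K M +
  assumes subring: "subring K R" and ideal_below: "ideal M (restr R K)"
begin

lemma M_sub: "M \<subseteq> K"
  using ideal.Icarr[OF ideal_below] by auto

lemma K_carrier: "k \<in> K \<Longrightarrow> k \<in> carrier R"
  using subringE(1)[OF subring] by blast

lemma M_carrier: "m \<in> M \<Longrightarrow> m \<in> carrier R"
  using M_sub K_carrier by blast

lemmas K_closed = subringE(2,3,5-7)[OF subring]

lemma M_zero: "\<zero> \<in> M"
  and M_add: "\<lbrakk>m \<in> M; m' \<in> M\<rbrakk> \<Longrightarrow> m \<oplus> m' \<in> M"
  and M_mult: "\<lbrakk>k \<in> K; m \<in> M\<rbrakk> \<Longrightarrow> k \<otimes> m \<in> M"
  using additive_subgroup.zero_closed[OF ideal.axioms(1)[OF ideal_below]]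
    additive_subgroup.a_closed[OF ideal.axioms(1)[OF ideal_below]]
    ideal.I_l_closed[OF ideal_below] by auto

lemma M_uminus: "m \<in> M \<Longrightarrow> \<ominus> m \<in> M"
  using M_mult[of "\<ominus> \<one>" m] K_closed(2,3) M_carrier by (simp add: l_minus)

abbreviation "mspan \<equiv> lin_span R M"

lemma span_SucI: "\<lbrakk>s \<in> mspan w n; m \<in> M\<rbrakk> \<Longrightarrow> s \<oplus> m \<otimes> w n \<in> mspan w (Suc n)"
  by auto

lemma span_SucE:
  assumes "t \<in> mspan w (Suc n)"
  obtains s m where "s \<in> mspan w n" "m \<in> M" "t = s \<oplus> m \<otimes> w n"
  using assms by auto

declare lin_span.simps(2) [simp del]

lemma span_carrier:
  assumes "\<And>i. w i \<in> carrier R"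
  shows "s \<in> mspan w n \<Longrightarrow> s \<in> carrier R"
  by (induction n arbitrary: s) (use assms M_carrier in \<open>auto elim!: span_SucE\<close>)

lemma span_zero: "\<zero> \<in> mspan w n" if "\<And>i. w i \<in> carrier R"
proof (induction n)
  case (Suc n)
  show ?case
    using span_SucI[OF Suc M_zero] that by simp
qed simp

lemma span_Suc: "s \<in> mspan w n \<Longrightarrow> s \<in> mspan w (Suc n)" if "\<And>i. w i \<in> carrier R"
  using span_SucI[of s w n \<zero>] M_zero that span_carrier[of w s n] by simp

lemma span_mono:
  assumes "\<And>i. w i \<in> carrier R" "n \<le> m"
  shows "s \<in> mspan w n \<Longrightarrow> s \<in> mspan w m"
  using assms(2) by (induction m rule: dec_induct) (simp_all add: span_Suc assms(1))

lemma span_base: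
  assumes w: "\<And>i. w i \<in> carrier R" and "i < n" "m \<in> M"
  shows "m \<otimes> w i \<in> mspan w n"
proof -
  have "m \<otimes> w i \<in> mspan w (Suc i)"
    using span_SucI[OF span_zero[OF w, where n = i] assms(3)] w M_carrier[OF assms(3)] by simp
  then show ?thesis
    by (rule span_mono[OF w, rotated]) (use assms(2) in simp)
qed

lemma span_add:
  assumes w: "\<And>i. w i \<in> carrier R"
  shows "\<lbrakk>s \<in> mspan w n; t \<in> mspan w n\<rbrakk> \<Longrightarrow> s \<oplus> t \<in> mspan w n"
proof (induction n arbitrary: s t)
  case (Suc n)
  obtain s' m where s: "s' \<in> mspan w n" "m \<in> M" "s = s' \<oplus> m \<otimes> w n"
    using Suc.prems(1) by (rule span_SucE)
  obtain t' m' where t: "t' \<in> mspan w n" "m' \<in> M" "t = t' \<oplus> m' \<otimes> w n"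
    using Suc.prems(2) by (rule span_SucE)
  have "s \<oplus> t = (s' \<oplus> t') \<oplus> (m \<oplus> m') \<otimes> w n"
    unfolding s(3) t(3)
    using span_carrier[OF w s(1)] span_carrier[OF w t(1)] M_carrier[OF s(2)] M_carrier[OF t(2)] w[of n]
    by algebra
  then show ?case
    using span_SucI[OF Suc.IH[OF s(1) t(1)] M_add[OF s(2) t(2)]] by simp
qed simp

text \<open>Multiplication by \<open>y\<close> is additive, so the generators decide. The target
  \<open>N\<close> is any additively closed set with zero, which lets one lemma serve for scalars,
  for products of spans and for localized modules.\<close>

lemma span_mult_into:
  assumes w: "\<And>i. w i \<in> carrier R" and y: "y \<in> carrier R"
    and zero: "\<zero> \<in> N" and add: "\<And>a b. \<lbrakk>a \<in> N; b \<in> N\<rbrakk> \<Longrightarrow> a \<oplus> b \<in> N"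
    and base: "\<And>i m. \<lbrakk>i < n; m \<in> M\<rbrakk> \<Longrightarrow> m \<otimes> (y \<otimes> w i) \<in> N"
  shows "s \<in> mspan w n \<Longrightarrow> y \<otimes> s \<in> N"
  using base
proof (induction n arbitrary: s)
  case 0
  then show ?case
    using y zero by simp
next
  case (Suc n)
  obtain s' m where s: "s' \<in> mspan w n" "m \<in> M" "s = s' \<oplus> m \<otimes> w n"
    using Suc.prems(1) by (rule span_SucE)
  have "y \<otimes> s = y \<otimes> s' \<oplus> m \<otimes> (y \<otimes> w n)"
    unfolding s(3) using span_carrier[OF w s(1)] M_carrier[OF s(2)] w[of n] y by algebra
  moreover have "y \<otimes> s' \<in> N"
    using s(1) Suc.prems(2) by (intro Suc.IH) simp_all
  ultimately show ?case
    using add Suc.prems(2)[of n m] s(2) by simp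
qed

lemma span_mult:
  assumes w: "\<And>i. w i \<in> carrier R" and k: "k \<in> K"
  shows "s \<in> mspan w n \<Longrightarrow> k \<otimes> s \<in> mspan w n"
proof (rule span_mult_into[OF w K_carrier[OF k] span_zero[OF w] span_add[OF w]])
  fix i m assume im: "i < n" "m \<in> M"
  then have "m \<otimes> (k \<otimes> w i) = (k \<otimes> m) \<otimes> w i"
    using M_carrier K_carrier k w[of i] by (simp add: m_ac)
  then show "m \<otimes> (k \<otimes> w i) \<in> mspan w n"
    using span_base[OF w im(1) M_mult[OF k im(2)]] by simp
qed

end

section \<open>Localizing at a prime of the subring, and Nakayama's lemma\<close>

locale subring_prime = cring R for R (structure) and K M +
  assumes subring: "subring K R" and prime_below: "primeideal M (restr R K)"
begin

text \<open>The same span calculus with coefficients in all of \<open>K\<close>; the modules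
  \<open>z^n K[z]\<close> need it, whereas the relations for \<open>z\<close> have coefficients in
  \<open>M\<close>.\<close>

sublocale self: subring_ideal R K K
  by (rule subring_ideal.intro[OF cring_axioms subring_ideal_axioms.intro[OF subring]])
    (use ring.oneideal[OF subring_is_ring[OF subring]] in simp)

sublocale subring_ideal R K M
  by (rule subring_ideal.intro[OF cring_axioms subring_ideal_axioms.intro[OF subring]])
    (rule primeideal.axioms(1)[OF prime_below])

lemma compl_one: "\<one> \<in> K - M"
  and compl_mult: "\<lbrakk>c \<in> K - M; d \<in> K - M\<rbrakk> \<Longrightarrow> c \<otimes> d \<in> K - M"
  and compl_add: "\<lbrakk>c \<in> K - M; m \<in> M\<rbrakk> \<Longrightarrow> c \<oplus> m \<in> K - M"
proof -
  interpret P: primeideal M "restr R K"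
    by (rule prime_below)
  show "\<one> \<in> K - M"
    using P.compl.one_mem by simp
  show "c \<otimes> d \<in> K - M" if "c \<in> K - M" "d \<in> K - M"
    using that P.compl.mult_mem[of c d] by simp
  show "c \<oplus> m \<in> K - M" if "c \<in> K - M" "m \<in> M"
  proof -
    have "c = (c \<oplus> m) \<oplus> \<ominus> m"
      using that M_carrier K_carrier by (simp add: a_assoc r_neg)
    then have "c \<oplus> m \<notin> M"
      using that M_add[of "c \<oplus> m" "\<ominus> m"] M_uminus by auto
    then show ?thesis
      using that K_closed(5) M_sub by blast
  qed
qed

text \<open>For a submodule \<open>N\<close> this is the preimage in \<open>R\<close> of the
  localization of \<open>N\<close> at \<open>M\<close>. Arguments over the local ring of
  \<open>K\<close> at \<open>M\<close> are carried out with it inside \<open>R\<close>, without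
  forming fractions.\<close>

definition locally :: "'a set \<Rightarrow> 'a set" where
  "locally N = {s \<in> carrier R. \<exists>c\<in>K - M. c \<otimes> s \<in> N}"

lemma locallyI: "\<lbrakk>s \<in> carrier R; c \<in> K - M; c \<otimes> s \<in> N\<rbrakk> \<Longrightarrow> s \<in> locally N"
  by (auto simp: locally_def)

lemma locally_carrier: "s \<in> locally N \<Longrightarrow> s \<in> carrier R"
  by (simp add: locally_def)

lemma locally_self: "\<lbrakk>N \<subseteq> carrier R; s \<in> N\<rbrakk> \<Longrightarrow> s \<in> locally N"
  using compl_one by (intro locallyI[of s \<one>]) auto

lemma locally_idem:
  assumes "s \<in> carrier R" "c \<in> K - M" "c \<otimes> s \<in> locally N"
  shows "s \<in> locally N"
proof -
  obtain d where d: "d \<in> K - M" "d \<otimes> (c \<otimes> s) \<in> N"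
    using assms(3) by (auto simp: locally_def)
  then have "(d \<otimes> c) \<otimes> s \<in> N"
    using assms K_carrier by (simp add: m_assoc)
  then show ?thesis
    using locallyI assms(1) compl_mult[OF d(1) assms(2)] by blast
qed

lemma locally_mono:
  assumes "s \<in> locally N" "N \<subseteq> locally N'"
  shows "s \<in> locally N'"
proof -
  obtain c where "s \<in> carrier R" "c \<in> K - M" "c \<otimes> s \<in> N"
    using assms(1) by (auto simp: locally_def)
  then show ?thesis
    using locally_idem assms(2) by blast
qed

definition submod :: "'a set \<Rightarrow> bool" where
  "submod N \<longleftrightarrow> N \<subseteq> carrier R \<and> \<zero> \<in> N \<and> (\<forall>a\<in>N. \<forall>b\<in>N. a \<oplus> b \<in> N) \<and> (\<forall>k\<in>K. \<forall>a\<in>N. k \<otimes> a \<in> N)"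

lemma submodD:
  assumes "submod N"
  shows "\<And>a. a \<in> N \<Longrightarrow> a \<in> carrier R" "\<zero> \<in> N" "\<And>a b. \<lbrakk>a \<in> N; b \<in> N\<rbrakk> \<Longrightarrow> a \<oplus> b \<in> N"
    "\<And>k a. \<lbrakk>k \<in> K; a \<in> N\<rbrakk> \<Longrightarrow> k \<otimes> a \<in> N"
  using assms by (auto simp: submod_def)

lemma submod_locally:
  assumes N: "submod N"
  shows "submod (locally N)"
  unfolding submod_def
proof (intro conjI ballI)
  show "locally N \<subseteq> carrier R"
    using locally_carrier by blast
  show "\<zero> \<in> locally N"
    using locally_self submodD[OF N] by blast
next
  fix a b assume "a \<in> locally N" "b \<in> locally N"
  then obtain c d where *: "a \<in> carrier R" "c \<in> K - M" "c \<otimes> a \<in> N"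
    "b \<in> carrier R" "d \<in> K - M" "d \<otimes> b \<in> N"
    by (auto simp: locally_def)
  have "(c \<otimes> d) \<otimes> (a \<oplus> b) = d \<otimes> (c \<otimes> a) \<oplus> c \<otimes> (d \<otimes> b)"
    using * K_carrier by (simp add: r_distr m_ac)
  also have "\<dots> \<in> N"
    using * submodD[OF N] by auto
  finally show "a \<oplus> b \<in> locally N"
    using locallyI[OF _ compl_mult[OF *(2,5)]] * by simp
next
  fix k a assume "k \<in> K" "a \<in> locally N"
  then obtain c where *: "a \<in> carrier R" "c \<in> K - M" "c \<otimes> a \<in> N" "k \<in> K"
    by (auto simp: locally_def)
  have "c \<otimes> (k \<otimes> a) = k \<otimes> (c \<otimes> a)"
    using * K_carrier by (simp add: m_ac)
  then have "c \<otimes> (k \<otimes> a) \<in> N"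
    using * submodD(4)[OF N] by simp
  then show "k \<otimes> a \<in> locally N"
    using locallyI[of "k \<otimes> a" c] * K_carrier by simp
qed

lemma submod_K: "submod K"
  using K_carrier K_closed by (auto simp: submod_def)

lemma submod_span: "(\<And>i. w i \<in> carrier R) \<Longrightarrow> submod (mspan w n)"
  unfolding submod_def by (auto intro: span_carrier span_zero span_add span_mult)

definition K_plus :: "'a set \<Rightarrow> 'a set" where
  "K_plus N = {a \<oplus> s |a s. a \<in> K \<and> s \<in> N}"

lemma submod_K_plus:
  assumes N: "submod N"
  shows "submod (K_plus N)"
  unfolding submod_def
proof (intro conjI ballI)
  show "K_plus N \<subseteq> carrier R"
    using K_carrier submodD(1)[OF N] by (auto simp: K_plus_def)
  show "\<zero> \<in> K_plus N"
    using K_closed(1) submodD(2)[OF N] unfolding K_plus_def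
    by (intro CollectI exI[of _ \<zero>]) simp
next
  fix x y assume "x \<in> K_plus N" "y \<in> K_plus N"
  then obtain a s b t where *: "a \<in> K" "s \<in> N" "x = a \<oplus> s" "b \<in> K" "t \<in> N" "y = b \<oplus> t"
    by (auto simp: K_plus_def)
  have "x \<oplus> y = (a \<oplus> b) \<oplus> (s \<oplus> t)"
    unfolding *(3,6) using K_carrier[OF *(1)] K_carrier[OF *(4)] submodD(1)[OF N] *(2,5)
    by (simp add: a_ac)
  then show "x \<oplus> y \<in> K_plus N"
    using K_closed(5)[OF *(1,4)] submodD(3)[OF N *(2,5)] unfolding K_plus_def by blast
next
  fix k x assume "k \<in> K" "x \<in> K_plus N"
  then obtain a s where *: "k \<in> K" "a \<in> K" "s \<in> N" "x = a \<oplus> s"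
    by (auto simp: K_plus_def)
  have "k \<otimes> x = k \<otimes> a \<oplus> k \<otimes> s"
    unfolding *(4) using K_carrier *(1,2) submodD(1)[OF N *(3)] by (simp add: r_distr)
  then show "k \<otimes> x \<in> K_plus N"
    using K_closed(4)[OF *(1,2)] submodD(4)[OF N *(1,3)] unfolding K_plus_def by blast
qed

lemma K_sub_K_plus: "submod N \<Longrightarrow> K \<subseteq> K_plus N"
  and N_sub_K_plus: "submod N \<Longrightarrow> N \<subseteq> K_plus N"
proof -
  assume N: "submod N"
  show "K \<subseteq> K_plus N"
  proof
    fix a assume "a \<in> K"
    then show "a \<in> K_plus N"
      using K_carrier submodD(2)[OF N] unfolding K_plus_def
      by (intro CollectI exI[of _ a] exI[of _ \<zero>]) simp
  qed
  show "N \<subseteq> K_plus N"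
  proof
    fix s assume "s \<in> N"
    then show "s \<in> K_plus N"
      using K_closed(1) submodD(1)[OF N] unfolding K_plus_def
      by (intro CollectI exI[of _ \<zero>] exI[of _ s]) simp
  qed
qed

lemma K_plus_sub:
  assumes "K \<subseteq> N'" "N \<subseteq> N'" "submod N'"
  shows "K_plus N \<subseteq> N'"
  using assms submodD(3)[OF assms(3)] by (auto simp: K_plus_def)

text \<open>Generators are eliminated one at a time. From \<open>c w_k = x + m w_k\<close> with
  \<open>c\<close> outside and \<open>m\<close> inside \<open>M\<close> follows
  \<open>(c - m) w_k = x\<close>, and \<open>c - m\<close> is still outside \<open>M\<close>; so
  \<open>w_k\<close> lies locally in \<open>K\<close> plus the span of the earlier generators and
  can be substituted away. When \<open>k\<close> has come down to 0, only \<open>K\<close> is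
  left.\<close>

lemma nakayama:
  assumes w: "\<And>i. w i \<in> carrier R"
    and gen: "\<And>j. j < n \<Longrightarrow> w j \<in> locally (K_plus (mspan w n))"
  shows "j < n \<Longrightarrow> w j \<in> locally K"
proof -
  have "\<forall>j<n. w j \<in> locally (K_plus (mspan w k))" if "k \<le> n" for k
    using that
  proof (induction k rule: inc_induct)
    case base
    then show ?case
      using gen by blast
  next
    case (step k)
    let ?N = "K_plus (mspan w k)"
    have N: "submod ?N" and L: "submod (locally ?N)"
      using submod_K_plus submod_span w submod_locally by blast+
    have split: "\<exists>c\<in>K - M. \<exists>x\<in>?N. \<exists>m\<in>M. c \<otimes> w j = x \<oplus> m \<otimes> w k" if "j < n" for j
    proof -
      obtain c where c: "c \<in> K - M" "c \<otimes> w j \<in> K_plus (mspan w (Suc k))"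
        using step.IH \<open>j < n\<close> by (auto simp: locally_def)
      then obtain a s where as: "a \<in> K" "s \<in> mspan w (Suc k)" "c \<otimes> w j = a \<oplus> s"
        by (auto simp: K_plus_def)
      obtain s' m where s: "s' \<in> mspan w k" "m \<in> M" "s = s' \<oplus> m \<otimes> w k"
        using as(2) by (rule span_SucE)
      have "c \<otimes> w j = (a \<oplus> s') \<oplus> m \<otimes> w k"
        unfolding as(3) s(3) using K_carrier[OF as(1)] span_carrier[OF w s(1)] M_carrier[OF s(2)] w
        by (simp add: a_assoc)
      moreover have "a \<oplus> s' \<in> ?N"
        using as(1) s(1) by (auto simp: K_plus_def)
      ultimately show ?thesis
        using c s by blast
    qed
    have wk: "w k \<in> locally ?N"
    proof -
      obtain c x m where *: "c \<in> K - M" "x \<in> ?N" "m \<in> M" "c \<otimes> w k = x \<oplus> m \<otimes> w k"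
        using split[of k] step.hyps by auto
      have "(c \<oplus> \<ominus> m) \<otimes> w k = c \<otimes> w k \<oplus> \<ominus> (m \<otimes> w k)"
        using K_carrier *(1) M_carrier[OF *(3)] w[of k] by (simp add: l_distr l_minus)
      also have "\<dots> = x"
        unfolding *(4) using submodD(1)[OF N *(2)] M_carrier[OF *(3)] w[of k]
        by (simp add: a_assoc r_neg)
      finally show ?thesis
        using locallyI[OF w compl_add[OF *(1) M_uminus[OF *(3)]]] *(2) by simp
    qed
    show ?case
    proof (intro allI impI)
      fix j assume "j < n"
      then obtain c x m where *: "c \<in> K - M" "x \<in> ?N" "m \<in> M" "c \<otimes> w j = x \<oplus> m \<otimes> w k"
        using split by blast
      have "x \<oplus> m \<otimes> w k \<in> locally ?N"
        using submodD(3)[OF L locally_self[OF _ *(2)] submodD(4)[OF L _ wk]] M_sub *(3)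
          submodD(1)[OF N] by blast
      then show "w j \<in> locally ?N"
        using locally_idem[OF w *(1)] *(4) by simp
    qed
  qed
  then have "w j \<in> locally (K_plus (mspan w 0))" if "j < n"
    using that by blast
  moreover have "K_plus (mspan w 0) \<subseteq> K"
    using K_carrier by (auto simp: K_plus_def)
  then have "K_plus (mspan w 0) = K"
    using K_sub_K_plus[OF submod_span] w by blast
  ultimately show "j < n \<Longrightarrow> w j \<in> locally K"
    by simp
qed

end

subsection \<open>Elements lying in every prime above a given one\<close>

context subring_prime
begin

text \<open>The bound \<open>Suc n\<close> makes \<open>n\<close> a degree: \<open>z^n\<close>
  itself is included, and degrees add under multiplication.\<close>

abbreviation pspan :: "'a \<Rightarrow> nat \<Rightarrow> 'a set" where
  "pspan z n \<equiv> mspan (\<lambda>i. z [^] i) (Suc n)"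

lemma pspan_shift:
  assumes z: "z \<in> carrier R" and c: "c \<in> K" and s: "s \<in> pspan z n"
  shows "(c \<otimes> z [^] k) \<otimes> s \<in> pspan z (k + n)"
proof -
  have w: "z [^] i \<in> carrier R" for i :: nat
    using z by simp
  have car: "c \<in> carrier R"
    using K_carrier[OF c] .
  show ?thesis
  proof (rule span_mult_into[OF w _ span_zero[OF w] span_add[OF w] _ s])
    show "c \<otimes> z [^] k \<in> carrier R"
      using car z by simp
    fix i m assume im: "i < Suc n" "m \<in> M"
    have "m \<otimes> ((c \<otimes> z [^] k) \<otimes> z [^] i) = (c \<otimes> m) \<otimes> z [^] (k + i)"
      using car z M_carrier[OF im(2)] by (simp add: nat_pow_mult[symmetric] m_ac)
    moreover have "(c \<otimes> m) \<otimes> z [^] (k + i) \<in> pspan z (k + n)"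
      using im by (intro span_base[OF w]) (simp_all add: M_mult[OF c])
    ultimately show "m \<otimes> ((c \<otimes> z [^] k) \<otimes> z [^] i) \<in> pspan z (k + n)"
      by simp
  qed
qed

lemma pspan_mult:
  assumes z: "z \<in> carrier R" and s: "s \<in> pspan z n" and t: "t \<in> pspan z k"
  shows "t \<otimes> s \<in> pspan z (n + k)"
proof -
  have w: "z [^] i \<in> carrier R" for i :: nat
    using z by simp
  have tc: "t \<in> carrier R"
    using span_carrier[OF w t] .
  show ?thesis
  proof (rule span_mult_into[OF w tc span_zero[OF w] span_add[OF w] _ s])
    fix i m assume im: "i < Suc n" "m \<in> M"
    have "m \<otimes> (t \<otimes> z [^] i) = (m \<otimes> z [^] i) \<otimes> t"
      using tc z M_carrier[OF im(2)] by (simp add: m_ac)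
    moreover have "(m \<otimes> z [^] i) \<otimes> t \<in> pspan z (i + k)"
      using pspan_shift[OF z _ t] M_sub im(2) by blast
    ultimately show "m \<otimes> (t \<otimes> z [^] i) \<in> pspan z (n + k)"
      using span_mono[OF w, of "Suc (i + k)" "Suc (n + k)"] im(1) by simp
  qed
qed

text \<open>The values at \<open>z\<close> of the polynomials of degree \<open>n\<close> that are nonzero and constant times
  \<open>X\<^sup>n\<close> modulo \<open>M\<close>.\<close>

definition quasi_monic :: "'a \<Rightarrow> nat \<Rightarrow> 'a set" where
  "quasi_monic z n = {c \<otimes> z [^] n \<oplus> s |c s. c \<in> K - M \<and> s \<in> pspan z n}"

lemma quasi_monicI:
  "\<lbrakk>c \<in> K - M; s \<in> pspan z n; d = c \<otimes> z [^] n \<oplus> s\<rbrakk> \<Longrightarrow> d \<in> quasi_monic z n"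
  by (auto simp: quasi_monic_def)

lemma quasi_monicE:
  assumes "d \<in> quasi_monic z n" and z: "z \<in> carrier R"
  obtains c s where "c \<in> K - M" "s \<in> pspan z n" "d = c \<otimes> z [^] n \<oplus> s" "c \<in> carrier R"
    "s \<in> carrier R"
proof -
  obtain c s where "c \<in> K - M" "s \<in> pspan z n" "d = c \<otimes> z [^] n \<oplus> s"
    using assms(1) by (auto simp: quasi_monic_def)
  moreover from this have "c \<in> carrier R" "s \<in> carrier R"
    using K_carrier span_carrier[of "\<lambda>i. z [^] i" s "Suc n"] z by auto
  ultimately show thesis
    using that by simp
qed

lemma quasi_monic_mult:
  assumes z: "z \<in> carrier R" and d: "d \<in> quasi_monic z n" and e: "e \<in> quasi_monic z k"
  shows "d \<otimes> e \<in> quasi_monic z (n + k)"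
proof -
  have w: "z [^] i \<in> carrier R" for i :: nat
    using z by simp
  obtain c s where d: "c \<in> K - M" "s \<in> pspan z n" "d = c \<otimes> z [^] n \<oplus> s" "c \<in> carrier R"
    "s \<in> carrier R"
    using d z by (rule quasi_monicE)
  obtain b t where e: "b \<in> K - M" "t \<in> pspan z k" "e = b \<otimes> z [^] k \<oplus> t" "b \<in> carrier R"
    "t \<in> carrier R"
    using e z by (rule quasi_monicE)
  have "d \<otimes> e = (c \<otimes> b) \<otimes> (z [^] n \<otimes> z [^] k)
      \<oplus> ((c \<otimes> z [^] n) \<otimes> t \<oplus> ((b \<otimes> z [^] k) \<otimes> s \<oplus> t \<otimes> s))"
    unfolding d(3) e(3) using d(4,5) e(4,5) w[of n] w[of k] by algebra
  moreover have "(c \<otimes> z [^] n) \<otimes> t \<in> pspan z (n + k)" "(b \<otimes> z [^] k) \<otimes> s \<in> pspan z (n + k)"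
    "t \<otimes> s \<in> pspan z (n + k)"
    using pspan_shift[OF z, of c t k n] pspan_shift[OF z, of b s n k] pspan_mult[OF z d(2) e(2)]
      d e by (simp_all add: add.commute)
  ultimately show ?thesis
    using z by (intro quasi_monicI[OF compl_mult[OF d(1) e(1)]])
      (auto intro!: span_add[OF w] simp: nat_pow_mult)
qed

lemma quasi_monic_0: "c \<in> K - M \<Longrightarrow> c \<in> quasi_monic z 0" if "z \<in> carrier R"
  using span_zero[of "\<lambda>i. z [^] i" "Suc 0"] that K_carrier
  by (intro quasi_monicI[of c \<zero>]) simp_all

lemma quasi_monic_pow:
  fixes k :: nat
  assumes "z \<in> carrier R" "d \<in> quasi_monic z n"
  shows "d [^] k \<in> quasi_monic z (n * k)"
proof (induction k)
  case 0
  then show ?case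
    using quasi_monic_0[OF assms(1) compl_one] by simp
next
  case (Suc k)
  then show ?case
    using quasi_monic_mult[OF assms(1) Suc assms(2)] by (simp add: add.commute)
qed

lemma quasi_monic_smult:
  assumes z: "z \<in> carrier R" and d: "d \<in> quasi_monic z n" and m: "m \<in> M"
  shows "m \<otimes> d \<in> pspan z n"
proof -
  have w: "z [^] i \<in> carrier R" for i :: nat
    using z by simp
  obtain c s where d: "c \<in> K - M" "s \<in> pspan z n" "d = c \<otimes> z [^] n \<oplus> s" "c \<in> carrier R"
    "s \<in> carrier R"
    using d z by (rule quasi_monicE)
  have "m \<otimes> d = (c \<otimes> m) \<otimes> z [^] n \<oplus> m \<otimes> s"
    unfolding d(3) using d(4,5) w[of n] M_carrier[OF m] by algebra
  moreover have "(c \<otimes> m) \<otimes> z [^] n \<in> pspan z n"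
    using d(1) m M_mult by (intro span_base[OF w]) auto
  moreover have "m \<otimes> s \<in> pspan z n"
    using span_mult[OF w _ d(2)] m M_sub by blast
  ultimately show ?thesis
    using span_add[OF w] by simp
qed

lemma quasi_monic_add:
  assumes z: "z \<in> carrier R" and d: "d \<in> quasi_monic z n" and t: "t \<in> pspan z n"
  shows "d \<oplus> t \<in> quasi_monic z n"
proof -
  have w: "z [^] i \<in> carrier R" for i :: nat
    using z by simp
  obtain c s where d: "c \<in> K - M" "s \<in> pspan z n" "d = c \<otimes> z [^] n \<oplus> s" "c \<in> carrier R"
    "s \<in> carrier R"
    using d z by (rule quasi_monicE)
  show ?thesis
    using d span_carrier[OF w t] w[of n]
    by (intro quasi_monicI[OF d(1) span_add[OF w d(2) t]]) (simp add: a_assoc)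
qed

text \<open>Put \<open>d = q + b m\<close>, so that \<open>m b\<close> and \<open>d\<close> agree
  modulo \<open>Q\<close>. Multiplying a polynomial in \<open>b\<close> by a power of
  \<open>m\<close> turns the powers of \<open>b\<close> into powers of \<open>d\<close>. The
  exponent \<open>length p\<close> exceeds the degree by one, so each term keeps a spare factor from
  \<open>M\<close>, which sends the quasi-monic powers of \<open>d\<close> into
  \<open>pspan\<close>.\<close>

lemma homogenized_eval:
  fixes k :: nat
  assumes Q: "ideal Q R" and q: "q \<in> Q" and m: "m \<in> M" and b: "b \<in> carrier R"
    and z: "z \<in> carrier R" and d: "q \<oplus> b \<otimes> m \<in> quasi_monic z n"
  shows "set p \<subseteq> K \<Longrightarrow> \<exists>q'\<in>Q. \<exists>s\<in>pspan z (n * length p). m [^] length p \<otimes> eval p b = q' \<oplus> s"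
    and "\<exists>q'\<in>Q. (m \<otimes> b) [^] k = q' \<oplus> (q \<oplus> b \<otimes> m) [^] k"
proof -
  have w: "z [^] i \<in> carrier R" for i :: nat
    using z by simp
  interpret Q: ideal Q R by (rule Q)
  let ?d = "q \<oplus> b \<otimes> m"
  have Q_add: "\<And>x y. \<lbrakk>x \<in> Q; y \<in> Q\<rbrakk> \<Longrightarrow> x \<oplus> y \<in> Q" and Q_zero: "\<zero> \<in> Q"
    and Q_uminus: "\<And>x. x \<in> Q \<Longrightarrow> \<ominus> x \<in> Q"
    using additive_subgroup.a_closed[OF ideal.axioms(1)[OF Q]]
      additive_subgroup.zero_closed[OF ideal.axioms(1)[OF Q]]
      additive_subgroup.a_inv_closed[OF ideal.axioms(1)[OF Q]] by simp_all
  have qc: "q \<in> carrier R" and mc: "m \<in> carrier R"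
    using Q.Icarr[OF q] M_carrier[OF m] .
  have dc: "?d \<in> carrier R"
    using qc mc b by simp
  have pow: "\<exists>q'\<in>Q. (m \<otimes> b) [^] k = q' \<oplus> ?d [^] k" for k :: nat
  proof (induction k)
    case 0
    then show ?case
      using Q_zero by (intro bexI[of _ \<zero>]) simp_all
  next
    case (Suc k)
    then obtain q' where q': "q' \<in> Q" "(m \<otimes> b) [^] k = q' \<oplus> ?d [^] k"
      by blast
    define e where "e = ?d [^] k"
    have ec: "e \<in> carrier R"
      using dc by (simp add: e_def)
    have "(m \<otimes> b) [^] Suc k = (q' \<oplus> e) \<otimes> (m \<otimes> b)"
      using q' by (simp add: e_def)
    also have "\<dots> = ((m \<otimes> b) \<otimes> q' \<oplus> \<ominus> e \<otimes> q) \<oplus> e \<otimes> ?d"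
      using ec Q.Icarr[OF q'(1)] qc mc b by algebra
    also have "e \<otimes> ?d = ?d [^] Suc k"
      by (simp add: e_def)
    finally have "(m \<otimes> b) [^] Suc k = ((m \<otimes> b) \<otimes> q' \<oplus> \<ominus> e \<otimes> q) \<oplus> ?d [^] Suc k" .
    moreover have "(m \<otimes> b) \<otimes> q' \<oplus> \<ominus> e \<otimes> q \<in> Q"
      using Q.I_l_closed q'(1) q ec mc b by (intro Q_add) simp_all
    ultimately show ?case
      by blast
  qed
  then show "\<exists>q'\<in>Q. (m \<otimes> b) [^] k = q' \<oplus> ?d [^] k" .
  show "\<exists>q'\<in>Q. \<exists>s\<in>pspan z (n * length p). m [^] length p \<otimes> eval p b = q' \<oplus> s"
    if "set p \<subseteq> K"
    using that
  proof (induction p)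
    case Nil
    then show ?case
      using Q_zero span_zero[OF w] by (intro bexI[of _ \<zero>]) simp_all
  next
    case (Cons r p)
    then obtain q1 s where q1: "q1 \<in> Q" "s \<in> pspan z (n * length p)"
      "m [^] length p \<otimes> eval p b = q1 \<oplus> s"
      by auto
    obtain q2 where q2: "q2 \<in> Q" "(m \<otimes> b) [^] length p = q2 \<oplus> ?d [^] length p"
      using pow by blast
    define e x y where "e = ?d [^] length p" and "x = m [^] length p" and "y = b [^] length p"
    have r: "r \<in> K" "r \<in> carrier R"
      using Cons.prems K_carrier by auto
    have car: "e \<in> carrier R" "x \<in> carrier R" "y \<in> carrier R" "q1 \<in> carrier R" "q2 \<in> carrier R"
      "s \<in> carrier R" "eval p b \<in> carrier R"
      using dc mc b Q.Icarr q1 q2 span_carrier[OF w q1(2)] Cons.prems K_carrier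
        eval_in_carrier[of p b] by (auto simp: e_def x_def y_def)
    have xy: "x \<otimes> y = q2 \<oplus> e"
      using q2(2) mc b by (simp add: x_def y_def e_def nat_pow_distrib)
    have "m [^] length (r # p) \<otimes> eval (r # p) b = (x \<otimes> m) \<otimes> (r \<otimes> y \<oplus> eval p b)"
      by (simp add: x_def y_def)
    also have "\<dots> = (m \<otimes> r) \<otimes> (x \<otimes> y) \<oplus> m \<otimes> (x \<otimes> eval p b)"
      using car r mc by algebra
    also have "\<dots> = (m \<otimes> r) \<otimes> (q2 \<oplus> e) \<oplus> m \<otimes> (q1 \<oplus> s)"
      using q1(3) xy by (simp add: x_def)
    also have "\<dots> = ((m \<otimes> r) \<otimes> q2 \<oplus> m \<otimes> q1) \<oplus> ((r \<otimes> m) \<otimes> e \<oplus> m \<otimes> s)"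
      using car r mc by algebra
    finally have eq: "m [^] length (r # p) \<otimes> eval (r # p) b
        = ((m \<otimes> r) \<otimes> q2 \<oplus> m \<otimes> q1) \<oplus> ((r \<otimes> m) \<otimes> e \<oplus> m \<otimes> s)" .
    have "(m \<otimes> r) \<otimes> q2 \<oplus> m \<otimes> q1 \<in> Q"
      using Q.I_l_closed q1(1) q2(1) r mc by (intro Q_add) simp_all
    moreover have "(r \<otimes> m) \<otimes> e \<in> pspan z (n * length p)"
      unfolding e_def using quasi_monic_smult[OF z quasi_monic_pow[OF z d] M_mult[OF r(1) m]] .
    then have "(r \<otimes> m) \<otimes> e \<oplus> m \<otimes> s \<in> pspan z (n * length p)"
      using span_mult[OF w _ q1(2)] m M_sub by (intro span_add[OF w]) auto
    then have "(r \<otimes> m) \<otimes> e \<oplus> m \<otimes> s \<in> pspan z (n * length (r # p))"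
      by (rule span_mono[OF w, rotated]) simp
    ultimately show ?case
      using eq by blast
  qed
qed

text \<open>Localized at \<open>M\<close>, this makes \<open>z\<close> integral over the maximal
  ideal. Were 0 not in the multiplicative set \<open>D\<close> of quasi-monic values, a prime
  \<open>Q\<close> maximal away from \<open>D\<close> would lie above \<open>M\<close>:
  \<open>K - M\<close> is contained in \<open>D\<close>, and integrality forces \<open>M\<close>
  into \<open>Q\<close>. But \<open>z\<close> is itself quasi-monic of degree 1, hence outside
  \<open>Q\<close>.\<close>

lemma pow_mem_span:
  assumes int: "integral_ext R K" and z: "z \<in> carrier R"
    and above: "\<And>Q. \<lbrakk>primeideal Q R; Q \<inter> K = M\<rbrakk> \<Longrightarrow> z \<in> Q"
  obtains c n where "c \<in> K - M" "c \<otimes> z [^] n \<in> mspan (\<lambda>i. z [^] i) n"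
proof -
  have w: "z [^] i \<in> carrier R" for i :: nat
    using z by simp
  define D where "D = (\<Union>n. quasi_monic z n)"
  have "\<zero> \<in> D"
  proof (rule ccontr)
    assume "\<zero> \<notin> D"
    then have "{\<zero>} \<inter> D = {}"
      by blast
    moreover have "\<one> \<in> D"
      using quasi_monic_0[OF z compl_one] by (auto simp: D_def)
    moreover have "d \<otimes> e \<in> D" if "d \<in> D" "e \<in> D" for d e
      using that quasi_monic_mult[OF z] by (fastforce simp: D_def)
    ultimately obtain Q where Q: "primeideal Q R" "Q \<inter> D = {}"
      and meet: "\<And>I. \<lbrakk>ideal I R; Q \<subset> I\<rbrakk> \<Longrightarrow> I \<inter> D \<noteq> {}"
      using exists_prime_disjoint[OF zeroideal] by metis
    interpret Q: primeideal Q R by (rule Q(1))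
    have "M \<subseteq> Q"
    proof (rule ccontr)
      assume "\<not> M \<subseteq> Q"
      then obtain m where m: "m \<in> M" "m \<notin> Q"
        by blast
      let ?I = "{q \<oplus> r \<otimes> m |q r. q \<in> Q \<and> r \<in> carrier R}"
      have "m \<in> ?I"
        using M_carrier[OF m(1)] Q.additive_subgroup_axioms
        by (intro CollectI exI[of _ \<zero>] exI[of _ \<one>]) (simp add: additive_subgroup.zero_closed)
      moreover have "Q \<subseteq> ?I"
      proof
        fix q assume "q \<in> Q"
        then show "q \<in> ?I"
          using M_carrier[OF m(1)] Q.Icarr by (intro CollectI exI[of _ q] exI[of _ \<zero>]) simp
      qed
      ultimately have "Q \<subset> ?I"
        using m(2) by blast
      then obtain q b n where qb: "q \<in> Q" "b \<in> carrier R" "q \<oplus> b \<otimes> m \<in> quasi_monic z n"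
        using meet[OF adjoin_ideal[OF Q.is_ideal M_carrier[OF m(1)]]] by (auto simp: D_def)
      let ?d = "q \<oplus> b \<otimes> m"
      obtain p where p: "polynomial K p" "p \<noteq> []" "lead_coeff p = \<one>" "eval p b = \<zero>"
        using int qb(2) unfolding integral_ext_def by blast
      then obtain p' where p': "p = \<one> # p'"
        by (cases p) auto
      have set: "set p' \<subseteq> K"
        using p(1) unfolding p' polynomial_def by auto
      obtain q1 s where q1: "q1 \<in> Q" "s \<in> pspan z (n * length p')"
        "m [^] length p' \<otimes> eval p' b = q1 \<oplus> s"
        using homogenized_eval(1)[OF Q.is_ideal qb(1) m(1) qb(2) z qb(3) set] by blast
      obtain q2 where q2: "q2 \<in> Q" "(m \<otimes> b) [^] length p' = q2 \<oplus> ?d [^] length p'"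
        using homogenized_eval(2)[OF Q.is_ideal qb(1) m(1) qb(2) z qb(3)] by blast
      have mc: "m \<in> carrier R" "m [^] length p' \<in> carrier R"
        using M_carrier[OF m(1)] by simp_all
      have ev: "eval p' b \<in> carrier R"
        using set K_carrier qb(2) by (intro eval_in_carrier) auto
      \<comment> \<open>The monic equation of \<open>b\<close>, multiplied by \<open>m\<close> to
        the degree, says modulo \<open>Q\<close> that this quasi-monic element vanishes, so
        \<open>Q\<close> would meet \<open>D\<close>.\<close>
      have e: "?d [^] length p' \<oplus> s \<in> quasi_monic z (n * length p')"
        using quasi_monic_add[OF z quasi_monic_pow[OF z qb(3)] q1(2)] .
      have car: "q1 \<in> carrier R" "q2 \<in> carrier R" "s \<in> carrier R" "?d [^] length p' \<in> carrier R"
        using Q.Icarr q1(1) q2(1) span_carrier[OF w q1(2)] qb mc by simp_all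
      have "\<zero> = m [^] length p' \<otimes> eval p b"
        using p(4) mc by simp
      also have "\<dots> = (m \<otimes> b) [^] length p' \<oplus> m [^] length p' \<otimes> eval p' b"
        unfolding p' using mc qb(2) ev by (simp add: r_distr nat_pow_distrib)
      also have "\<dots> = (q2 \<oplus> q1) \<oplus> (?d [^] length p' \<oplus> s)"
        unfolding q1(3) q2(2) using car by algebra
      finally have "?d [^] length p' \<oplus> s = \<ominus> (q2 \<oplus> q1)"
        using car by (metis a_closed add.inv_equality add.m_comm)
      moreover have "\<ominus> (q2 \<oplus> q1) \<in> Q"
        using q1(1) q2(1) Q.additive_subgroup_axioms
        by (simp add: additive_subgroup.a_closed additive_subgroup.a_inv_closed)
      ultimately show False
        using e Q(2) by (auto simp: D_def)
    qed
    moreover have "K - M \<subseteq> D"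
      using quasi_monic_0[OF z] by (auto simp: D_def)
    ultimately have "Q \<inter> K = M"
      using Q(2) M_sub by blast
    then have "z \<in> Q"
      using above Q(1) by blast
    moreover have "\<one> \<otimes> z [^] (1::nat) \<oplus> \<zero> = z"
      using z by simp
    then have "z \<in> quasi_monic z 1"
      using quasi_monicI[OF compl_one span_zero[OF w], of z 1] by simp
    ultimately show False
      using Q(2) by (auto simp: D_def)
  qed
  then obtain n where "\<zero> \<in> quasi_monic z n"
    by (auto simp: D_def)
  then obtain c s where c: "c \<in> K - M" "s \<in> pspan z n" "\<zero> = c \<otimes> z [^] n \<oplus> s" "c \<in> carrier R"
    "s \<in> carrier R"
    using z by (rule quasi_monicE)
  obtain t m where t: "t \<in> mspan (\<lambda>i. z [^] i) n" "m \<in> M" "s = t \<oplus> m \<otimes> z [^] n"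
    using c(2) by (rule span_SucE)
  have car: "t \<in> carrier R" "m \<in> carrier R" "z [^] n \<in> carrier R"
    using span_carrier[OF w t(1)] M_carrier[OF t(2)] w by simp_all
  \<comment> \<open>The span \<open>pspan z n\<close> still allows a term \<open>m z^n\<close>. It
    is moved into the leading coefficient, which stays outside \<open>M\<close>, and only powers
    below \<open>n\<close> remain.\<close>
  have "(c \<oplus> m) \<otimes> z [^] n \<oplus> t = c \<otimes> z [^] n \<oplus> s"
    unfolding t(3) using car c(4) by algebra
  then have "(c \<oplus> m) \<otimes> z [^] n = \<ominus> t"
    using c(3) car c(4) by (metis a_closed add.inv_equality add.m_comm m_closed)
  moreover have "\<ominus> t = \<ominus> \<one> \<otimes> t"
    using car by (simp add: l_minus)
  then have "\<ominus> t \<in> mspan (\<lambda>i. z [^] i) n"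
    using span_mult[OF w _ t(1), of "\<ominus> \<one>"] K_closed(2,3) by simp
  ultimately show thesis
    using that[OF compl_add[OF c(1) t(2)], of n] by simp
qed

end

section \<open>The descending rings \<open>K + z^n K[z]\<close> and the use of seminormality\<close>

context subring_prime
begin

text \<open>This is \<open>z^n K[z]\<close>. It is closed under multiplication, and therefore
  \<open>K_plus (tail z n)\<close> is a ring to which FCP applies.\<close>

definition tail :: "'a \<Rightarrow> nat \<Rightarrow> 'a set" where
  "tail z n = (\<Union>k. self.mspan (\<lambda>i. z [^] (n + i)) k)"

lemma tail_base:
  assumes "z \<in> carrier R" "k \<in> K" "n \<le> j"
  shows "k \<otimes> z [^] j \<in> tail z n"
proof -
  have "k \<otimes> z [^] (n + (j - n)) \<in> self.mspan (\<lambda>i. z [^] (n + i)) (Suc (j - n))"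
    by (rule self.span_base[of "\<lambda>i. z [^] (n + i)"]) (use assms in auto)
  then show ?thesis
    using assms(3) by (auto simp: tail_def)
qed

lemma tail_mult_into:
  assumes z: "z \<in> carrier R" and y: "y \<in> carrier R" and N: "submod N"
    and base: "\<And>j k. \<lbrakk>n \<le> j; k \<in> K\<rbrakk> \<Longrightarrow> k \<otimes> (y \<otimes> z [^] j) \<in> N"
    and s: "s \<in> tail z n"
  shows "y \<otimes> s \<in> N"
proof -
  let ?w = "\<lambda>i. z [^] (n + i)"
  have w: "\<And>i. ?w i \<in> carrier R"
    using z by simp
  obtain k where k: "s \<in> self.mspan ?w k"
    using s by (auto simp: tail_def)
  show ?thesis
    by (rule self.span_mult_into[where w = ?w, OF w y submodD(2)[OF N] submodD(3)[OF N] _ k])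
      (simp_all add: base)
qed

lemma submod_tail:
  assumes z: "z \<in> carrier R"
  shows "submod (tail z n)"
proof -
  let ?w = "\<lambda>i. z [^] (n + i)"
  have w: "\<And>i. ?w i \<in> carrier R"
    using z by simp
  show ?thesis
    unfolding submod_def
  proof (intro conjI ballI)
    show "tail z n \<subseteq> carrier R"
      using self.span_carrier[where w = ?w, OF w] by (auto simp: tail_def)
    show "\<zero> \<in> tail z n"
      using self.span_zero[where w = ?w, OF w] by (auto simp: tail_def)
  next
    fix a b assume "a \<in> tail z n" "b \<in> tail z n"
    then obtain k l where kl: "a \<in> self.mspan ?w k" "b \<in> self.mspan ?w l"
      by (auto simp: tail_def)
    have "a \<in> self.mspan ?w (max k l)" "b \<in> self.mspan ?w (max k l)"
      using self.span_mono[where w = ?w, OF w max.cobounded1 kl(1)]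
        self.span_mono[where w = ?w, OF w max.cobounded2 kl(2)] .
    then show "a \<oplus> b \<in> tail z n"
      using self.span_add[where w = ?w, OF w] by (auto simp: tail_def)
  next
    fix k a assume "k \<in> K" "a \<in> tail z n"
    then show "k \<otimes> a \<in> tail z n"
      using self.span_mult[where w = ?w, OF w] by (auto simp: tail_def)
  qed
qed

lemma tail_mult:
  assumes z: "z \<in> carrier R" and s: "s \<in> tail z n" and t: "t \<in> tail z n"
  shows "s \<otimes> t \<in> tail z n"
proof (rule tail_mult_into[OF z submodD(1)[OF submod_tail[OF z] s] submod_tail[OF z] _ t])
  fix j k assume j: "n \<le> j" "k \<in> K"
  have sc: "s \<in> carrier R"
    using submodD(1)[OF submod_tail[OF z] s] .
  have "(k \<otimes> z [^] j) \<otimes> s \<in> tail z n"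
  proof (rule tail_mult_into[OF z _ submod_tail[OF z] _ s])
    show "k \<otimes> z [^] j \<in> carrier R"
      using K_carrier[OF j(2)] z by simp
    fix i l assume il: "n \<le> i" "l \<in> K"
    have "l \<otimes> ((k \<otimes> z [^] j) \<otimes> z [^] i) = (l \<otimes> k) \<otimes> z [^] (j + i)"
      using K_carrier[OF j(2)] K_carrier[OF il(2)] z by (simp add: nat_pow_mult[symmetric] m_ac)
    moreover have "(l \<otimes> k) \<otimes> z [^] (j + i) \<in> tail z n"
      using il j K_closed(4) by (intro tail_base[OF z]) auto
    ultimately show "l \<otimes> ((k \<otimes> z [^] j) \<otimes> z [^] i) \<in> tail z n"
      by simp
  qed
  moreover have "(k \<otimes> z [^] j) \<otimes> s = k \<otimes> (s \<otimes> z [^] j)"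
    using K_carrier[OF j(2)] z sc by (simp add: m_ac)
  ultimately show "k \<otimes> (s \<otimes> z [^] j) \<in> tail z n"
    by simp
qed

lemma tail_antimono:
  assumes z: "z \<in> carrier R" and "n \<le> m"
  shows "tail z m \<subseteq> tail z n"
proof
  fix s assume s: "s \<in> tail z m"
  have "\<one> \<otimes> s \<in> tail z n"
    by (rule tail_mult_into[OF z one_closed submod_tail[OF z] _ s])
      (use z assms(2) in \<open>simp add: tail_base\<close>)
  then show "s \<in> tail z n"
    using submodD(1)[OF submod_tail[OF z] s] by simp
qed

lemma K_plus_tail_intermediate:
  assumes z: "z \<in> carrier R"
  shows "K_plus (tail z n) \<in> intermediate R K"
proof -
  let ?T = "tail z n"
  have T: "submod ?T" and N: "submod (K_plus ?T)"
    using submod_tail[OF z] submod_K_plus by auto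
  have "subring (K_plus ?T) R"
  proof (rule subringI)
    show "K_plus ?T \<subseteq> carrier R"
      using submodD(1)[OF N] by blast
    show "\<one> \<in> K_plus ?T"
      using K_sub_K_plus[OF T] K_closed(2) by blast
    fix x assume x: "x \<in> K_plus ?T"
    then have "\<ominus> x = \<ominus> \<one> \<otimes> x"
      using submodD(1)[OF N] by (simp add: l_minus)
    then show "\<ominus> x \<in> K_plus ?T"
      using submodD(4)[OF N _ x] K_closed(2,3) by simp
    fix y assume y: "y \<in> K_plus ?T"
    show "x \<oplus> y \<in> K_plus ?T"
      using submodD(3)[OF N x y] .
    obtain a s where as: "a \<in> K" "s \<in> ?T" "x = a \<oplus> s"
      using x by (auto simp: K_plus_def)
    obtain b t where bt: "b \<in> K" "t \<in> ?T" "y = b \<oplus> t"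
      using y by (auto simp: K_plus_def)
    have "x \<otimes> y = a \<otimes> b \<oplus> (a \<otimes> t \<oplus> (b \<otimes> s \<oplus> s \<otimes> t))"
      unfolding as(3) bt(3)
      using K_carrier[OF as(1)] K_carrier[OF bt(1)] submodD(1)[OF T as(2)] submodD(1)[OF T bt(2)]
      by algebra
    moreover have "a \<otimes> t \<oplus> (b \<otimes> s \<oplus> s \<otimes> t) \<in> ?T"
      using submodD(4)[OF T as(1) bt(2)] submodD(4)[OF T bt(1) as(2)] tail_mult[OF z as(2) bt(2)]
      by (intro submodD(3)[OF T])
    ultimately show "x \<otimes> y \<in> K_plus ?T"
      using K_closed(4)[OF as(1) bt(1)] unfolding K_plus_def by blast
  qed
  then show ?thesis
    using K_sub_K_plus[OF T] by (simp add: intermediate_def)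
qed

lemma K_plus_tail_stable:
  assumes z: "z \<in> carrier R" and FCP: "FCP R K"
  shows "\<exists>n. \<forall>m\<ge>n. K_plus (tail z n) = K_plus (tail z m)"
proof -
  let ?F = "\<lambda>n. K_plus (tail z n)"
  have anti: "?F m \<subseteq> ?F n" if "n \<le> m" for n m
    using tail_antimono[OF z that] by (auto simp: K_plus_def)
  have "subset.chain (intermediate R K) (range ?F)"
    unfolding subset_chain_def
  proof (intro conjI ballI)
    show "range ?F \<subseteq> intermediate R K"
      using K_plus_tail_intermediate[OF z] by (rule image_subsetI)
    fix A B assume "A \<in> range ?F" "B \<in> range ?F"
    then obtain n m where "A = ?F n" "B = ?F m"
      by (elim rangeE)
    then show "A \<subseteq> B \<or> B \<subseteq> A"
      using anti[of n m] anti[of m n] by (cases n m rule: le_cases) simp_all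
  qed
  then have "finite (range ?F)"
    using FCP by (simp add: FCP_def)
  then have "\<exists>A\<in>range ?F. \<forall>B\<in>range ?F. B \<subseteq> A \<longrightarrow> A = B"
    by (rule finite_has_minimal) simp
  then obtain n where n: "\<forall>B\<in>range ?F. B \<subseteq> ?F n \<longrightarrow> ?F n = B"
    by (elim bexE rangeE) simp
  have "?F n = ?F m" if "n \<le> m" for m
    using n anti[OF that] by simp
  then show ?thesis
    by blast
qed

text \<open>Nakayama's lemma applies to the module generated by \<open>z\<^sup>n, z\<^sup>n\<^sup>+\<^sup>1, \<dots>\<close>, because its image in
  \<open>R/K\<close> no longer depends on \<open>n\<close>; seminormality then brings down the exponent.\<close>

lemma locally_mem_of_pow_mem_span:
  assumes sn: "seminormal R K" and FCP: "FCP R K" and z: "z \<in> carrier R"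
    and c: "c \<in> K - M" "c \<otimes> z [^] N \<in> mspan (\<lambda>i. z [^] i) N"
  shows "z \<in> locally K"
proof -
  obtain n where stable: "\<forall>m\<ge>n. K_plus (tail z n) = K_plus (tail z m)"
    using K_plus_tail_stable[OF z FCP] by blast
  let ?w = "\<lambda>i. z [^] (n + i)"
  have w: "\<And>i. ?w i \<in> carrier R" and pw: "\<And>i::nat. z [^] i \<in> carrier R"
    using z by simp_all
  let ?S = "mspan ?w N"
  have S: "submod ?S" and L: "submod (locally ?S)" and LK: "submod (locally K)"
    and LN: "submod (locally (K_plus ?S))"
    using submod_span[where w = ?w, OF w] submod_locally submod_K submod_K_plus by simp_all
  \<comment> \<open>The relation for \<open>c z^N\<close>, multiplied by \<open>z^(n + e)\<close>,
    expresses \<open>z^(n + N + e)\<close> up to \<open>c\<close> by the powers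
    \<open>z^(n + e + i)\<close> with \<open>i < N\<close> and coefficients in \<open>M\<close>.
    Each such term lies in \<open>?S\<close> or belongs to the smaller index
    \<open>e + i - N\<close>.\<close>
  have high: "?w (N + e) \<in> locally ?S" for e
  proof (induction e rule: less_induct)
    case (less e)
    have "z [^] (n + e) \<otimes> (c \<otimes> z [^] N) \<in> locally ?S"
    proof (rule span_mult_into[OF pw _ submodD(2)[OF L] submodD(3)[OF L] _ c(2)])
      fix i m assume im: "i < N" "m \<in> M"
      have eq: "m \<otimes> (z [^] (n + e) \<otimes> z [^] i) = m \<otimes> ?w (e + i)"
        using z by (simp add: nat_pow_mult add.assoc)
      show "m \<otimes> (z [^] (n + e) \<otimes> z [^] i) \<in> locally ?S"
      proof (cases "e + i < N")
        case True
        then have "m \<otimes> ?w (e + i) \<in> ?S"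
          using im(2) by (rule span_base[where w = ?w, OF w])
        then show ?thesis
          unfolding eq using submodD(1)[OF S] by (intro locally_self) auto
      next
        case False
        then have "?w (N + (e + i - N)) \<in> locally ?S"
          using im(1) by (intro less) linarith
        then have "?w (e + i) \<in> locally ?S"
          using False by simp
        then show ?thesis
          unfolding eq using submodD(4)[OF L] M_sub im(2) by blast
      qed
    qed (use z in simp)
    moreover have "z [^] (n + e) \<otimes> (c \<otimes> z [^] N) = c \<otimes> ?w (N + e)"
      using z K_carrier c(1) by (simp add: nat_pow_mult[symmetric] m_ac)
    ultimately show ?case
      using locally_idem[OF w c(1)] by simp
  qed
  have S_le: "locally ?S \<subseteq> locally (K_plus ?S)"
    using N_sub_K_plus[OF S] by (auto simp: locally_def)
  \<comment> \<open>Stability rewrites \<open>z^(n + j)\<close> as an element of \<open>K\<close>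
    plus powers from \<open>z^(n + N)\<close> on, and \<open>high\<close> absorbs the latter into
    the span over \<open>M\<close>. This is exactly the hypothesis of
    \<open>nakayama\<close>.\<close>
  have gen: "?w j \<in> locally (K_plus ?S)" for j
  proof -
    have "\<one> \<otimes> z [^] (n + j) \<in> tail z n"
      using K_closed(2) by (intro tail_base[OF z]) simp_all
    then have "?w j \<in> K_plus (tail z (n + N))"
      using N_sub_K_plus[OF submod_tail[OF z]] stable z by (metis l_one le_add1 nat_pow_closed subsetD)
    then obtain a s where as: "a \<in> K" "s \<in> tail z (n + N)" "?w j = a \<oplus> s"
      by (auto simp: K_plus_def)
    have sc: "s \<in> carrier R"
      using submodD(1)[OF submod_tail[OF z] as(2)] .
    have "\<one> \<otimes> s \<in> locally ?S"
    proof (rule tail_mult_into[OF z one_closed L _ as(2)])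
      fix i k assume "n + N \<le> i" "k \<in> K"
      then show "k \<otimes> (\<one> \<otimes> z [^] i) \<in> locally ?S"
        using high[of "i - (n + N)"] submodD(4)[OF L] z by (simp add: add.assoc[symmetric])
    qed
    then have "s \<in> locally (K_plus ?S)"
      using S_le sc by auto
    moreover have "a \<in> locally (K_plus ?S)"
      using K_sub_K_plus[OF S] as(1) submodD(1)[OF submod_K_plus[OF S]]
      by (intro locally_self) auto
    ultimately show ?thesis
      using as(3) submodD(3)[OF LN] by simp
  qed
  have low: "?w j \<in> locally K" if "j < N" for j
    using nakayama[where w = ?w, OF w gen that] .
  have S_locally: "?S \<subseteq> locally K"
  proof
    fix s assume s: "s \<in> ?S"
    have "\<one> \<otimes> s \<in> locally K"
    proof (rule span_mult_into[where w = ?w, OF w one_closed submodD(2)[OF LK] submodD(3)[OF LK] _ s])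
      fix i m assume "i < N" "m \<in> M"
      then show "m \<otimes> (\<one> \<otimes> ?w i) \<in> locally K"
        using low submodD(4)[OF LK] M_sub w by auto
    qed
    then show "s \<in> locally K"
      using submodD(1)[OF S s] by simp
  qed
  have "K_plus ?S \<subseteq> locally K"
    using K_plus_sub[OF _ S_locally LK] locally_self K_carrier by blast
  then have all: "?w j \<in> locally K" for j
    using locally_mono[OF gen] by blast
  have descend: "z [^] k \<in> locally K"
    if k: "1 \<le> k" and above: "\<And>m. k < m \<Longrightarrow> z [^] m \<in> locally K" for k :: nat
  proof -
    obtain d where d: "d \<in> K - M" "d \<otimes> z [^] (2 * k) \<in> K"
      using above[of "2 * k"] k by (auto simp: locally_def)
    obtain e where e: "e \<in> K - M" "e \<otimes> z [^] (3 * k) \<in> K"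
      using above[of "3 * k"] k by (auto simp: locally_def)
    have car: "d \<in> carrier R" "e \<in> carrier R" "d \<in> K" "e \<in> K"
      using d e K_carrier by auto
    \<comment> \<open>Both denominators are cleared at once, so that the square and the cube of one
      element lie in \<open>K\<close> itself and not only locally.\<close>
    define b where "b = (d \<otimes> e) \<otimes> z [^] k"
    have bc: "b \<in> carrier R"
      using car z by (simp add: b_def)
    have "b [^] (2::nat) = (d \<otimes> (e \<otimes> e)) \<otimes> (d \<otimes> z [^] (2 * k))"
      using car z unfolding b_def
      by (simp add: numeral_2_eq_2 nat_pow_mult[symmetric] m_ac)
    then have b2: "b [^] (2::nat) \<in> K"
      using K_closed(4) car d(2) by simp
    have "b [^] (3::nat) = ((d \<otimes> d) \<otimes> (d \<otimes> (e \<otimes> e))) \<otimes> (e \<otimes> z [^] (3 * k))"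
      using car z unfolding b_def
      by (simp add: numeral_3_eq_3 nat_pow_mult[symmetric] m_ac)
    then have b3: "b [^] (3::nat) \<in> K"
      using K_closed(4) car e(2) by simp
    have "b \<in> K"
      using sn[unfolded seminormal_def, rule_format, OF bc conjI[OF b2 b3]] .
    then show ?thesis
      using locallyI[OF pw compl_mult[OF d(1) e(1)]] by (simp add: b_def)
  qed
  \<comment> \<open>Downward induction from \<open>Suc n\<close> to 1. It starts at
    \<open>Suc n\<close> because \<open>n\<close> may be 0, while \<open>descend\<close> needs
    \<open>k\<close> positive for \<open>2 k\<close> and \<open>3 k\<close> to exceed
    \<open>k\<close>.\<close>
  have "\<forall>m\<ge>k. z [^] m \<in> locally K" if "1 \<le> k" "k \<le> Suc n" for k
    using that(2,1)
  proof (induction k rule: inc_induct)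
    case base
    show ?case
    proof (intro allI impI)
      fix m assume "Suc n \<le> m"
      then show "z [^] m \<in> locally K"
        using all[of "m - n"] by simp
    qed
  next
    case (step k)
    then show ?case
      using descend[of k] by (metis Suc_leI le_Suc_eq le_neq_implies_less not_less_eq_eq)
  qed
  from this[of 1] have "\<forall>m\<ge>1::nat. z [^] m \<in> locally K"
    by simp
  then have "z [^] (1::nat) \<in> locally K"
    by blast
  then show ?thesis
    using z by simp
qed

end

subsection \<open>Extensions that are Boolean over a common ideal\<close>

definition boolean_over :: "('a, 'b) ring_scheme \<Rightarrow> 'a set \<Rightarrow> 'a set \<Rightarrow> bool" where
  "boolean_over A K V \<longleftrightarrow> (\<forall>x\<in>V. \<forall>y\<in>V. (x \<otimes>\<^bsub>A\<^esub> x \<ominus>\<^bsub>A\<^esub> x) \<otimes>\<^bsub>A\<^esub> y \<in> K)"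

lemma boolean_overD:
  "\<lbrakk>boolean_over A K V; x \<in> V; y \<in> V\<rbrakk> \<Longrightarrow> (x \<otimes>\<^bsub>A\<^esub> x \<ominus>\<^bsub>A\<^esub> x) \<otimes>\<^bsub>A\<^esub> y \<in> K"
  by (simp add: boolean_over_def)

lemma (in cring) boolean_over_restr:
  assumes "subring V R"
  shows "boolean_over (restr R V) K V \<longleftrightarrow> boolean_over R K V"
  unfolding boolean_over_def
  by (intro ball_cong refl) (simp add: restr_minus[OF assms] subringE(6)[OF assms])

lemma (in cring) infra_integral_imp_boolean_over:
  assumes K: "subring K R" and FCP: "FCP R K" and sn: "seminormal R K" and inf: "infra_integral R K"
    and two: "\<And>M. M \<in> MSupp (restr R K) (quot_module R K) \<Longrightarrow> restr R K Quot M \<simeq> ZFact 2"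
  shows "boolean_over R K (carrier R)"
  unfolding boolean_over_def
proof (intro ballI)
  fix x y assume xy: "x \<in> carrier R" "y \<in> carrier R"
  let ?A = "restr R K" and ?t = "(x \<otimes> x \<ominus> x) \<otimes> y"
  interpret A: cring ?A
    by (rule subring_cring[OF K])
  note sub = subringE[OF K]
  show "?t \<in> K"
  proof (rule mem_subring_local[OF K])
    show t: "?t \<in> carrier R"
      using xy by simp
    fix M assume M: "maximalideal M ?A"
    show "\<exists>u\<in>K - M. u \<otimes> ?t \<in> K"
    proof (cases "M \<in> MSupp ?A (quot_module R K)")
      case False
      then show ?thesis
        using M t unfolding MSupp_quot_module[OF K] by blast
    next
      case True
      have M_prime: "primeideal M ?A"
        by (rule A.maximalideal_prime[OF M])
      interpret subring_prime R K M
        by (rule subring_prime.intro[OF cring_axioms subring_prime_axioms.intro[OF K M_prime]])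
      have idem: "r \<otimes> r \<ominus> r \<in> M" if "r \<in> K" for r
        using two[OF True] that restr_minus[OF K, of "r \<otimes> r" r] sub(6)
        unfolding A.Quot_iso_ZFact_2_iff[OF M] by (auto dest: bspec[of _ _ r])
      have above: "?t \<in> Q" if Q: "primeideal Q R" and QM: "Q \<inter> K = M" for Q
      proof -
        interpret Q: primeideal Q R by (rule Q)
        have Q_add: "\<And>a b. \<lbrakk>a \<in> Q; b \<in> Q\<rbrakk> \<Longrightarrow> a \<oplus> b \<in> Q"
          using additive_subgroup.a_closed[OF Q.additive_subgroup_axioms] .
        have M_Q: "m \<in> Q" if "m \<in> M" for m
          using that QM by blast
        have "residual_map R Q \<in> ring_iso (residue_field ?A (Q \<inter> K)) (residue_field R Q)"
          using inf Q unfolding infra_integral_def by blast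
        \<comment> \<open>Surjectivity at the class of \<open>x/1\<close> writes \<open>x\<close> as
          \<open>a/s\<close> modulo \<open>Q\<close>. Residues of \<open>K\<close> modulo
          \<open>M\<close> are idempotent, so \<open>s\<close> is congruent to 1 and
          \<open>x\<close> to the idempotent residue of \<open>a\<close>.\<close>
        then obtain a s where as: "a \<in> K" "s \<in> K - Q" "s \<otimes> x \<ominus> \<one> \<otimes> a \<in> Q"
          unfolding residual_map_iso_iff[OF K Q] using xy(1) Q.compl.one_mem by blast
        have car: "a \<in> carrier R" "s \<in> carrier R"
          using as sub(1) by auto
        have "s \<otimes> s \<ominus> s = s \<otimes> (s \<ominus> \<one>)"
          using car by algebra
        then have "s \<otimes> (s \<ominus> \<one>) \<in> Q"
          using M_Q[OF idem[of s]] as(2) by simp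
        then have s1: "s \<ominus> \<one> \<in> Q"
          using Q.I_prime[of s "s \<ominus> \<one>"] as(2) car by auto
        have a2: "a \<otimes> a \<ominus> a \<in> Q"
          using M_Q[OF idem[OF as(1)]] .
        have sxa: "s \<otimes> x \<ominus> a \<in> Q"
          using as(3) car by simp
        have "x \<ominus> a = (s \<otimes> x \<ominus> a) \<oplus> \<ominus> x \<otimes> (s \<ominus> \<one>)"
          using car xy(1) by algebra
        then have xa: "x \<ominus> a \<in> Q"
          using Q_add[OF sxa Q.I_l_closed[OF s1, of "\<ominus> x"]] xy(1) by simp
        have "x \<otimes> x \<ominus> x = (x \<oplus> (a \<ominus> \<one>)) \<otimes> (x \<ominus> a) \<oplus> (a \<otimes> a \<ominus> a)"
          using car(1) xy(1) by algebra
        also have "\<dots> \<in> Q"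
          using Q_add[OF Q.I_l_closed[OF xa, of "x \<oplus> (a \<ominus> \<one>)"] a2] car(1) xy(1) by simp
        finally show ?thesis
          by (rule Q.I_r_closed[OF _ xy(2)])
      qed
      have "integral_ext R K"
        using inf by (simp add: infra_integral_def)
      then obtain c n where "c \<in> K - M" "c \<otimes> ?t [^] n \<in> mspan (\<lambda>i. ?t [^] i) n"
        using pow_mem_span[OF _ t above] by blast
      then have "?t \<in> locally K"
        using locally_mem_of_pow_mem_span[OF sn FCP t] by blast
      then show ?thesis
        by (simp add: locally_def)
    qed
  qed
qed

section \<open>Boolean extensions satisfy both conditions\<close>

context cring
begin

context
  fixes K
  assumes K: "subring K R" and bool: "boolean_over R K (carrier R)"
begin

lemma idem_diff_mem: "x \<in> carrier R \<Longrightarrow> x \<otimes> x \<ominus> x \<in> K"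
  using boolean_overD[OF bool, of x \<one>] by simp

lemma boolean_over_imp_seminormal: "seminormal R K"
  unfolding seminormal_def
proof (intro ballI impI)
  fix b assume b: "b \<in> carrier R" "b [^] (2::nat) \<in> K \<and> b [^] (3::nat) \<in> K"
  then have "b \<otimes> b \<in> K"
    by (simp add: numeral_2_eq_2)
  moreover have "b = b \<otimes> b \<oplus> \<ominus> (b \<otimes> b \<ominus> b)"
    using b(1) by algebra
  ultimately show "b \<in> K"
    using subringE(5,7)[OF K] idem_diff_mem[OF b(1)] by metis
qed

lemma boolean_over_imp_integral:
  assumes "\<one> \<noteq> \<zero>"
  shows "integral_ext R K"
  unfolding integral_ext_def
proof
  fix b assume b: "b \<in> carrier R"
  let ?c = "\<ominus> (b \<otimes> b \<ominus> b)"
  \<comment> \<open>The polynomial \<open>X^2 - X - (b^2 - b)\<close>. The hypothesis that 1 differs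
    from 0 enters because a leading coefficient must be nonzero.\<close>
  let ?p = "[\<one>, \<ominus> \<one>, ?c]"
  have "polynomial K ?p"
    using subringE(3,5)[OF K] idem_diff_mem[OF b] assms by (simp add: polynomial_def)
  moreover have "b \<otimes> b \<oplus> (\<ominus> b \<oplus> ?c) = \<zero>"
    using b by algebra
  then have "eval ?p b = \<zero>"
    using b by (simp add: l_minus numeral_2_eq_2)
  ultimately show "\<exists>p. polynomial K p \<and> p \<noteq> [] \<and> lead_coeff p = \<one> \<and> eval p b = \<zero>"
    by (intro exI[of _ ?p]) simp
qed

lemma boolean_over_imp_infra_integral:
  assumes "\<one> \<noteq> \<zero>"
  shows "infra_integral R K"
  unfolding infra_integral_def
proof (intro conjI allI impI)
  show "integral_ext R K"
    by (rule boolean_over_imp_integral[OF assms])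
  fix Q assume Q: "primeideal Q R"
  interpret Q: primeideal Q R by (rule Q)
  note sub = subringE[OF K]
  let ?I = "{i \<in> K. \<forall>v\<in>carrier R. i \<otimes> v \<in> K}"
  show "residual_map R Q \<in> ring_iso (residue_field (restr R K) (Q \<inter> K)) (residue_field R Q)"
    unfolding residual_map_iso_iff[OF K Q]
  proof (intro ballI)
    fix x s assume xs: "x \<in> carrier R" "s \<in> carrier R - Q"
    show "\<exists>a\<in>K. \<exists>t\<in>K - Q. t \<otimes> x \<ominus> s \<otimes> a \<in> Q"
    \<comment> \<open>Here \<open>?I\<close> is the conductor. An element \<open>i\<close> of it
      outside \<open>Q\<close> gives \<open>x/s = (i x)/(i s)\<close>, a fraction over
      \<open>K\<close>. If it lies inside \<open>Q\<close>, then all \<open>r^2 - r\<close> do,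
      every residue modulo \<open>Q\<close> is 0 or 1, and both come from \<open>K\<close>.\<close>
    proof (cases "?I \<subseteq> Q")
      case False
      then obtain i where i: "i \<in> K" "\<And>v. v \<in> carrier R \<Longrightarrow> i \<otimes> v \<in> K" "i \<notin> Q"
        by blast
      have ic: "i \<in> carrier R"
        using i(1) sub(1) by blast
      have "i \<otimes> s \<in> K - Q"
        using i xs Q.compl.mult_mem[of i s] ic by blast
      moreover have "(i \<otimes> s) \<otimes> x \<ominus> s \<otimes> (i \<otimes> x) = \<zero>"
        using ic xs by (simp add: m_ac a_minus_def r_neg)
      then have "(i \<otimes> s) \<otimes> x \<ominus> s \<otimes> (i \<otimes> x) \<in> Q"
        using additive_subgroup.zero_closed[OF Q.additive_subgroup_axioms] by simp
      ultimately show ?thesis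
        using i(2)[OF xs(1)] by blast
    next
      case True
      have cases: "r \<in> Q \<or> r \<ominus> \<one> \<in> Q" if r: "r \<in> carrier R" for r
      proof -
        have "r \<otimes> r \<ominus> r \<in> ?I"
          using idem_diff_mem[OF r] boolean_overD[OF bool r] by blast
        moreover have "r \<otimes> r \<ominus> r = r \<otimes> (r \<ominus> \<one>)"
          using r by algebra
        ultimately show ?thesis
          using True Q.I_prime[of r "r \<ominus> \<one>"] r by auto
      qed
      have one: "\<one> \<in> K - Q"
        using sub(3) Q.compl.one_mem by blast
      from cases[OF xs(1)] show ?thesis
      proof
        assume "x \<in> Q"
        then have "\<one> \<otimes> x \<ominus> s \<otimes> \<zero> \<in> Q"
          using xs by (simp add: a_minus_def)
        then show ?thesis
          using one sub(2) by blast
      next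
        assume x1: "x \<ominus> \<one> \<in> Q"
        have sc: "s \<in> carrier R"
          using xs(2) by simp
        have s1: "s \<ominus> \<one> \<in> Q"
          using cases[OF sc] xs(2) by blast
        have "\<one> \<otimes> x \<ominus> s \<otimes> \<one> = (x \<ominus> \<one>) \<oplus> \<ominus> (s \<ominus> \<one>)"
          using xs(1) sc by algebra
        also have "\<dots> \<in> Q"
          using x1 s1 additive_subgroup.a_closed[OF Q.additive_subgroup_axioms]
            additive_subgroup.a_inv_closed[OF Q.additive_subgroup_axioms] by simp
        finally show ?thesis
          using one by blast
      qed
    qed
  qed
qed

text \<open>The element \<open>x\<close> witnessing the support is moved into \<open>K\<close> by
  nothing outside \<open>M\<close>, yet \<open>r^2 - r\<close> moves it there; so
  \<open>r^2 - r\<close> lies in \<open>M\<close>.\<close>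

lemma boolean_over_imp_Quot_iso:
  assumes "M \<in> MSupp (restr R K) (quot_module R K)"
  shows "restr R K Quot M \<simeq> ZFact 2"
proof -
  interpret A: cring "restr R K"
    by (rule subring_cring[OF K])
  note sub = subringE[OF K]
  obtain x where M: "maximalideal M (restr R K)"
    and x: "x \<in> carrier R" "\<And>u. u \<in> K - M \<Longrightarrow> u \<otimes> x \<notin> K"
    using assms unfolding MSupp_quot_module[OF K] by blast
  have "r \<otimes> r \<ominus> r \<in> M" if "r \<in> K" for r
    using that x(2)[of "r \<otimes> r \<ominus> r"] boolean_overD[OF bool _ x(1), of r]
      idem_diff_mem[of r] sub(1) by blast
  then show ?thesis
    unfolding A.Quot_iso_ZFact_2_iff[OF M]
    using restr_minus[OF K] sub(6) by simp
qed

lemma boolean_over_imp_strongly_local: "strongly_local R K"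
proof -
  note sub = subringE[OF K]
  have mem: "u \<in> K" if u: "u \<in> Units R" for u
  proof -
    have uc: "u \<in> carrier R" "inv u \<in> carrier R" "u \<otimes> inv u = \<one>"
      using u Units_closed by simp_all
    have "(u \<otimes> u \<ominus> u) \<otimes> inv u = u \<otimes> (u \<otimes> inv u) \<ominus> u \<otimes> inv u"
      using uc(1,2) by algebra
    also have "\<dots> = u \<ominus> \<one>"
      using uc by simp
    finally have "u \<ominus> \<one> \<in> K"
      using boolean_overD[OF bool uc(1,2)] by simp
    moreover have "u = (u \<ominus> \<one>) \<oplus> \<one>"
      using uc(1) by algebra
    ultimately show ?thesis
      using sub(3,7) by metis
  qed
  have "Units (restr R K) = Units R"
  proof
    show "Units (restr R K) \<subseteq> Units R"
      using sub(1) by (auto simp: Units_def)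
    show "Units R \<subseteq> Units (restr R K)"
    proof
      fix u assume u: "u \<in> Units R"
      then have "u \<in> K" "inv u \<in> K"
        using mem Units_inv_Units by auto
      then show "u \<in> Units (restr R K)"
        using Units_l_inv[OF u] Units_r_inv[OF u] unfolding Units_def by auto
    qed
  qed
  then show ?thesis
    by (simp add: strongly_local_def)
qed

end

end

subsection \<open>Finitely many primes detect the units\<close>

text \<open>A strictly descending sequence would have an infinite chain as its range, so inclusion
  is well-founded; the family \<open>F\<close> itself need not be a chain.\<close>

lemma FCP_minimal:
  assumes FCP: "FCP S R" and F: "F \<subseteq> intermediate S R" "A0 \<in> F"
  shows "\<exists>A\<in>F. \<forall>B\<in>F. B \<subseteq> A \<longrightarrow> B = A"
proof -
  let ?r = "{(A, B). A \<in> intermediate S R \<and> B \<in> intermediate S R \<and> A \<subset> B}"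
  have "wf ?r"
    unfolding wf_iff_no_infinite_down_chain
  proof
    assume "\<exists>f. \<forall>i. (f (Suc i), f i) \<in> ?r"
    then obtain f :: "nat \<Rightarrow> 'a set" where "\<forall>i. (f (Suc i), f i) \<in> ?r"
      by (rule exE)
    then have f: "f i \<in> intermediate S R" "f (Suc i) \<subset> f i" for i
      by simp_all
    have less: "f j \<subset> f i" if "i < j" for i j
      using that
    proof (induction j)
      case (Suc j)
      then show ?case
        using f(2)[of j] by (cases "i = j") auto
    qed simp
    have "subset.chain (intermediate S R) (range f)"
      unfolding subset_chain_def
    proof (intro conjI ballI)
      show "range f \<subseteq> intermediate S R"
        using f(1) by (rule image_subsetI)
      fix A B assume "A \<in> range f" "B \<in> range f"
      then obtain i j where "A = f i" "B = f j"
        by (elim rangeE)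
      then show "A \<subseteq> B \<or> B \<subseteq> A"
        using less[of i j] less[of j i] by (cases i j rule: linorder_cases) auto
    qed
    then have "finite (range f)"
      using FCP by (simp add: FCP_def)
    moreover have "inj f"
    proof (rule injI)
      fix i j assume "f i = f j"
      then show "i = j"
        using less[of i j] less[of j i] by (cases i j rule: linorder_cases) auto
    qed
    ultimately show False
      using finite_imageD infinite_UNIV_nat by blast
  qed
  then have "\<exists>A\<in>F. \<forall>B. (B, A) \<in> ?r \<longrightarrow> B \<notin> F"
    using F(2) unfolding wf_eq_minimal by blast
  then obtain A where A: "A \<in> F" "\<forall>B. (B, A) \<in> ?r \<longrightarrow> B \<notin> F"
    by blast
  then have "B = A" if "B \<in> F" "B \<subseteq> A" for B
    using that F(1) by auto
  then show ?thesis
    using A(1) by blast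
qed

text \<open>The elements lying in the localization of \<open>V\<close> at each \<open>M\<close> in
  \<open>F\<close>. These rings shrink as \<open>F\<close> grows; over all maximal ideals of
  \<open>V\<close> they come down to \<open>V\<close>.\<close>

definition regular_at :: "('a, 'b) ring_scheme \<Rightarrow> 'a set \<Rightarrow> 'a set set \<Rightarrow> 'a set" where
  "regular_at A V F = {s \<in> carrier A. \<forall>M\<in>F. \<exists>u\<in>V - M. u \<otimes>\<^bsub>A\<^esub> s \<in> V}"

lemma (in cring) regular_at_intermediate:
  assumes V: "subring V R" and F: "\<And>M. M \<in> F \<Longrightarrow> primeideal M (restr R V)"
  shows "regular_at R V F \<in> intermediate R V"
proof -
  note sub = subringE[OF V]
  have mult: "u \<otimes> v \<in> V - M" if "M \<in> F" "u \<in> V - M" "v \<in> V - M" for u v M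
  proof -
    interpret M: primeideal M "restr R V"
      by (rule F[OF that(1)])
    show ?thesis
      using M.compl.mult_mem[of u v] that by simp
  qed
  have V_sub: "V \<subseteq> regular_at R V F"
  proof
    fix s assume s: "s \<in> V"
    have "\<exists>u\<in>V - M. u \<otimes> s \<in> V" if "M \<in> F" for M
    proof -
      interpret M: primeideal M "restr R V"
        by (rule F[OF that])
      show ?thesis
        using M.compl.one_mem s sub(1) by (intro bexI[of _ \<one>]) auto
    qed
    then show "s \<in> regular_at R V F"
      using s sub(1) by (auto simp: regular_at_def)
  qed
  have "subring (regular_at R V F) R"
  proof (rule subringI)
    show "regular_at R V F \<subseteq> carrier R"
      by (auto simp: regular_at_def)
    show "\<one> \<in> regular_at R V F"
      using V_sub sub(3) by blast
  next
    fix s assume s: "s \<in> regular_at R V F"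
    have "\<exists>u\<in>V - M. u \<otimes> (\<ominus> s) \<in> V" if M: "M \<in> F" for M
    proof -
      obtain u where "u \<in> V - M" "u \<otimes> s \<in> V"
        using s M by (auto simp: regular_at_def)
      then show ?thesis
        using s sub(1,5) by (intro bexI[of _ u]) (auto simp: regular_at_def r_minus)
    qed
    then show "\<ominus> s \<in> regular_at R V F"
      using s by (simp add: regular_at_def)
  next
    fix s t assume st: "s \<in> regular_at R V F" "t \<in> regular_at R V F"
    have car: "s \<in> carrier R" "t \<in> carrier R"
      using st by (auto simp: regular_at_def)
    have "\<exists>u\<in>V - M. u \<otimes> (s \<otimes> t) \<in> V \<and> u \<otimes> (s \<oplus> t) \<in> V" if M: "M \<in> F" for M
    proof -
      obtain u where u: "u \<in> V - M" "u \<otimes> s \<in> V"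
        using st(1) M by (auto simp: regular_at_def)
      obtain v where v: "v \<in> V - M" "v \<otimes> t \<in> V"
        using st(2) M by (auto simp: regular_at_def)
      have uv: "u \<in> carrier R" "v \<in> carrier R" "u \<in> V" "v \<in> V"
        using u v sub(1) by auto
      have "(u \<otimes> v) \<otimes> (s \<otimes> t) = (u \<otimes> s) \<otimes> (v \<otimes> t)"
        "(u \<otimes> v) \<otimes> (s \<oplus> t) = v \<otimes> (u \<otimes> s) \<oplus> u \<otimes> (v \<otimes> t)"
        using uv car by (simp_all add: m_ac r_distr)
      then show ?thesis
        using mult[OF M u(1) v(1)] sub(6,7) uv u(2) v(2) by (intro bexI[of _ "u \<otimes> v"]) simp_all
    qed
    then show "s \<otimes> t \<in> regular_at R V F" "s \<oplus> t \<in> regular_at R V F"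
      using car unfolding regular_at_def by blast+
  qed
  then show ?thesis
    using V_sub by (simp add: intermediate_def)
qed

text \<open>Avoiding the contractions of the finitely many maximal ideals of \<open>R\<close> gives
  an inverse in \<open>R\<close>. A finite set \<open>F\<close> of maximal ideals of
  \<open>V\<close> whose \<open>regular_at\<close> ring is minimal, and hence equal to
  \<open>V\<close>, decides whether this inverse lies in \<open>V\<close>. The primes are
  \<open>F\<close> together with the contractions.\<close>

lemma (in cring) Units_subring_finite_primes:
  assumes V: "subring V R" and FCP: "FCP R V" and semi: "semilocal R"
  obtains P where "finite P" "\<And>p. p \<in> P \<Longrightarrow> primeideal p (restr R V)"
    "\<And>a. \<lbrakk>a \<in> V; \<And>p. p \<in> P \<Longrightarrow> a \<notin> p\<rbrakk> \<Longrightarrow> a \<in> Units (restr R V)"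
proof -
  let ?A = "restr R V"
  interpret A: cring ?A
    by (rule subring_cring[OF V])
  note sub = subringE[OF V]
  let ?W = "regular_at R V" and ?max = "{M. maximalideal M ?A}"
  have prime: "primeideal M ?A" if "M \<in> ?max" for M
    using that A.maximalideal_prime by blast
  let ?fam = "?W ` {F. finite F \<and> F \<subseteq> ?max}"
  have "?fam \<subseteq> intermediate R V"
    using regular_at_intermediate[OF V] prime by blast
  moreover have "?W {} \<in> ?fam"
    by blast
  ultimately have "\<exists>B\<in>?fam. \<forall>C\<in>?fam. C \<subseteq> B \<longrightarrow> C = B"
    by (rule FCP_minimal[OF FCP])
  then obtain B where B: "B \<in> ?fam" "\<forall>C\<in>?fam. C \<subseteq> B \<longrightarrow> C = B"
    by (rule bexE)
  then obtain F where F: "finite F" "F \<subseteq> ?max" "B = ?W F"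
    by blast
  \<comment> \<open>Enlarging the finite set can only shrink the ring, so minimality forces
    equality: regularity at \<open>F\<close> is regularity at every maximal ideal.\<close>
  have W_eq: "?W (insert M F) = ?W F" if "M \<in> ?max" for M
  proof -
    have "?W (insert M F) \<in> ?fam"
      using F that by (intro imageI) simp
    moreover have "?W (insert M F) \<subseteq> B"
      using F(3) by (auto simp: regular_at_def)
    ultimately show ?thesis
      using B(2) F(3) by blast
  qed
  have W_V: "?W F \<subseteq> V"
  proof
    fix s assume s: "s \<in> ?W F"
    show "s \<in> V"
    proof (rule mem_subring_local[OF V])
      show "s \<in> carrier R"
        using s by (simp add: regular_at_def)
      show "\<exists>u\<in>V - M. u \<otimes> s \<in> V" if "maximalideal M ?A" for M
        using s W_eq[of M] that by (auto simp: regular_at_def)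
    qed
  qed
  let ?N = "(\<lambda>N. N \<inter> V) ` {N. maximalideal N R}"
  show thesis
  proof (rule that)
    show "finite (F \<union> ?N)"
      using F(1) semi by (simp add: semilocal_def)
    show "primeideal p ?A" if "p \<in> F \<union> ?N" for p
      using that prime F(2) restr_inter_primeideal[OF V] maximalideal_prime by blast
    fix a assume a: "a \<in> V" "\<And>p. p \<in> F \<union> ?N \<Longrightarrow> a \<notin> p"
    have ac: "a \<in> carrier R"
      using a(1) sub(1) by blast
    have "a \<in> Units R"
    proof (rule avoids_maximal_imp_Unit[OF ac])
      fix N assume "maximalideal N R"
      then have "N \<inter> V \<in> F \<union> ?N"
        by blast
      then show "a \<notin> N"
        using a by blast
    qed
    then have inv: "inv a \<in> carrier R" "a \<otimes> inv a = \<one>" "inv a \<otimes> a = \<one>"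
      by simp_all
    \<comment> \<open>The element \<open>a\<close> itself is the denominator at each
      \<open>M\<close> in \<open>F\<close>: it lies outside \<open>M\<close>, and its product with
      \<open>inv a\<close> is 1.\<close>
    have "inv a \<in> ?W F"
      unfolding regular_at_def using a inv sub(3) by (auto intro!: bexI[of _ a])
    then have "inv a \<in> V"
      using W_V by blast
    then show "a \<in> Units ?A"
      using a(1) inv unfolding Units_def by auto
  qed
qed

section \<open>Prime avoidance for two elements with a prescribed difference\<close>

lemma (in cring) primes_not_below:
  assumes "finite P" "primeideal p R" "\<And>q. q \<in> P \<Longrightarrow> ideal q R" "\<And>q. q \<in> P \<Longrightarrow> \<not> q \<subseteq> p"
  shows "\<exists>e\<in>carrier R - p. \<forall>q\<in>P. e \<in> q"
  using assms(1,3,4)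
proof (induction P rule: finite_induct)
  case empty
  interpret p: primeideal p R by (rule assms(2))
  show ?case
    using p.compl.one_mem by blast
next
  case (insert q P)
  interpret p: primeideal p R by (rule assms(2))
  interpret q: ideal q R
    by (rule insert.prems(1)) simp
  obtain e where e: "e \<in> carrier R - p" "\<forall>q\<in>P. e \<in> q"
    using insert by auto
  obtain f where f: "f \<in> q" "f \<notin> p"
    using insert.prems(2)[of q] by blast
  have "e \<otimes> f \<in> carrier R - p"
    using p.compl.mult_mem[of e f] e f q.Icarr by blast
  moreover have "e \<otimes> f \<in> r" if "r \<in> P" for r
    using ideal.I_r_closed[of r R e f] insert.prems(1)[of r] e f q.Icarr that by simp
  moreover have "e \<otimes> f \<in> q"
    using q.I_l_closed[OF f(1)] e(1) by blast
  ultimately show ?case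
    by (intro bexI[of _ "e \<otimes> f"]) auto
qed

text \<open>Modulo \<open>p\<close> the residues of 0, 1 and \<open>d\<close> are distinct and
  \<open>e\<close> is nonzero, so each of the two conditions fails for at most one \<open>c\<close>
  among the three, and one candidate survives. If \<open>z\<close> lies in \<open>p\<close>, the
  conditions coincide and 0 and 1 suffice.\<close>

lemma (in cring) avoid_prime:
  assumes p: "primeideal p R" and e: "e \<in> carrier R - p" and a: "a \<in> carrier R" and z: "z \<in> carrier R"
    and large: "z \<in> p \<or> (\<exists>d\<in>carrier R. d \<notin> p \<and> d \<ominus> \<one> \<notin> p)"
  shows "\<exists>c\<in>carrier R. a \<oplus> e \<otimes> c \<notin> p \<and> a \<oplus> e \<otimes> c \<oplus> z \<notin> p"
proof -
  interpret p: primeideal p R by (rule p)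
  have p_add: "\<And>x y. \<lbrakk>x \<in> p; y \<in> p\<rbrakk> \<Longrightarrow> x \<oplus> y \<in> p"
    and p_uminus: "\<And>x. x \<in> p \<Longrightarrow> \<ominus> x \<in> p"
    using additive_subgroup.a_closed[OF p.additive_subgroup_axioms]
      additive_subgroup.a_inv_closed[OF p.additive_subgroup_axioms] by simp_all
  have ec: "e \<in> carrier R"
    using e by simp
  have pair: "\<not> (x \<oplus> e \<otimes> c \<in> p \<and> x \<oplus> e \<otimes> c' \<in> p)"
    if "x \<in> carrier R" "c \<in> carrier R" "c' \<in> carrier R" "c \<ominus> c' \<notin> p" for x c c'
  proof
    assume *: "x \<oplus> e \<otimes> c \<in> p \<and> x \<oplus> e \<otimes> c' \<in> p"
    have "e \<otimes> (c \<ominus> c') = (x \<oplus> e \<otimes> c) \<oplus> \<ominus> (x \<oplus> e \<otimes> c')"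
      using that(1-3) ec by algebra
    then have "e \<otimes> (c \<ominus> c') \<in> p"
      using * p_add p_uminus by simp
    then show False
      using p.I_prime[of e "c \<ominus> c'"] e that by auto
  qed
  have one: "\<one> \<notin> p"
    using p.compl.one_mem by blast
  have swap: "a \<oplus> e \<otimes> c \<oplus> z = (a \<oplus> z) \<oplus> e \<otimes> c" if "c \<in> carrier R" for c
    using that a z ec by algebra
  have az: "a \<oplus> z \<in> carrier R"
    using a z by simp
  show ?thesis
  proof (cases "z \<in> p")
    case True
    have iff: "x \<oplus> z \<in> p \<longleftrightarrow> x \<in> p" if "x \<in> carrier R" for x
    proof
      assume "x \<oplus> z \<in> p"
      moreover have "x = (x \<oplus> z) \<oplus> \<ominus> z"
        using that z by algebra
      ultimately show "x \<in> p"
        using p_add p_uminus True by metis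
    qed (use p_add True in simp)
    have "\<one> \<ominus> \<zero> \<notin> p"
      using one by (simp add: a_minus_def)
    then have "a \<oplus> e \<otimes> \<one> \<notin> p \<or> a \<oplus> e \<otimes> \<zero> \<notin> p"
      using pair[OF a one_closed zero_closed] by blast
    then show ?thesis
      using iff a ec by (metis a_closed m_closed one_closed zero_closed)
  next
    case False
    then obtain d where d: "d \<in> carrier R" "d \<notin> p" "d \<ominus> \<one> \<notin> p"
      using large by blast
    have diff: "\<one> \<ominus> \<zero> \<notin> p" "d \<ominus> \<zero> \<notin> p"
      using one d by (simp_all add: a_minus_def)
    note p1 = pair[OF _ one_closed zero_closed diff(1)] pair[OF _ d(1) zero_closed diff(2)]
      pair[OF _ d(1) one_closed d(3)]
    have "\<exists>c\<in>{\<zero>, \<one>, d}. a \<oplus> e \<otimes> c \<notin> p \<and> (a \<oplus> z) \<oplus> e \<otimes> c \<notin> p"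
      using p1[OF a] p1[OF az] by blast
    then obtain c where c: "c \<in> {\<zero>, \<one>, d}" "a \<oplus> e \<otimes> c \<notin> p" "(a \<oplus> z) \<oplus> e \<otimes> c \<notin> p"
      by blast
    have "c \<in> carrier R"
      using c(1) d(1) by auto
    then show ?thesis
      using c swap by auto
  qed
qed

text \<open>When a prime \<open>p\<close> is added, \<open>a\<close> is corrected by a multiple of
  an \<open>e\<close> that lies in all the other primes but not in \<open>p\<close>, so nothing
  changes at the others. Such an \<open>e\<close> requires that none of them is contained in
  \<open>p\<close>, hence the antichain.\<close>

lemma (in cring) avoid_antichain:
  assumes "finite P" and z: "z \<in> carrier R" and "\<And>p. p \<in> P \<Longrightarrow> primeideal p R"
    and "\<And>p q. \<lbrakk>p \<in> P; q \<in> P; p \<subseteq> q\<rbrakk> \<Longrightarrow> p = q"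
    and "\<And>p. p \<in> P \<Longrightarrow> z \<in> p \<or> (\<exists>d\<in>carrier R. d \<notin> p \<and> d \<ominus> \<one> \<notin> p)"
  shows "\<exists>a\<in>carrier R. \<forall>p\<in>P. a \<notin> p \<and> a \<oplus> z \<notin> p"
  using assms(1,3-5)
proof (induction P rule: finite_induct)
  case (insert p P)
  have p: "primeideal p R" and P: "\<And>q. q \<in> P \<Longrightarrow> primeideal q R"
    using insert.prems(1) by simp_all
  have "\<exists>a\<in>carrier R. \<forall>q\<in>P. a \<notin> q \<and> a \<oplus> z \<notin> q"
    by (rule insert.IH) (use insert.prems in auto)
  then obtain a where a: "a \<in> carrier R" "\<And>q. q \<in> P \<Longrightarrow> a \<notin> q \<and> a \<oplus> z \<notin> q"
    by blast
  have "\<exists>e\<in>carrier R - p. \<forall>q\<in>P. e \<in> q"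
  proof (rule primes_not_below[OF insert.hyps(1) p])
    show "ideal q R" if "q \<in> P" for q
      using P[OF that] primeideal.axioms(1) by blast
    show "\<not> q \<subseteq> p" if "q \<in> P" for q
      using insert.prems(2)[of q p] insert.hyps(2) that by auto
  qed
  then obtain e where e: "e \<in> carrier R - p" "\<And>q. q \<in> P \<Longrightarrow> e \<in> q"
    by blast
  obtain c where c: "c \<in> carrier R" "a \<oplus> e \<otimes> c \<notin> p" "a \<oplus> e \<otimes> c \<oplus> z \<notin> p"
    using avoid_prime[OF p e(1) a(1) z insert.prems(3)[of p]] by auto
  have ec: "e \<in> carrier R"
    using e(1) by simp
  have "a \<oplus> e \<otimes> c \<notin> q \<and> a \<oplus> e \<otimes> c \<oplus> z \<notin> q" if q: "q \<in> P" for q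
  proof -
    interpret q: primeideal q R by (rule P[OF q])
    have ecq: "\<ominus> (e \<otimes> c) \<in> q"
      using additive_subgroup.a_inv_closed[OF q.additive_subgroup_axioms] q.I_r_closed[OF e(2)[OF q] c(1)] .
    have q_add: "\<And>x y. \<lbrakk>x \<in> q; y \<in> q\<rbrakk> \<Longrightarrow> x \<oplus> y \<in> q"
      using additive_subgroup.a_closed[OF q.additive_subgroup_axioms] .
    have "a = (a \<oplus> e \<otimes> c) \<oplus> \<ominus> (e \<otimes> c)" "a \<oplus> z = (a \<oplus> e \<otimes> c \<oplus> z) \<oplus> \<ominus> (e \<otimes> c)"
      using a(1) ec c(1) z by algebra+
    then show ?thesis
      using a(2)[OF q] q_add ecq by metis
  qed
  then show ?case
    using a(1) ec c by (intro bexI[of _ "a \<oplus> e \<otimes> c"]) auto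
qed auto

text \<open>An element outside \<open>q\<close> is outside every prime contained in
  \<open>q\<close>, so it is enough to treat the maximal members of \<open>P\<close>, which form an
  antichain.\<close>

lemma (in cring) avoid_primes:
  assumes P: "finite P" "\<And>p. p \<in> P \<Longrightarrow> primeideal p R" and z: "z \<in> carrier R"
    and large: "\<And>p. p \<in> P \<Longrightarrow> z \<in> p \<or> (\<exists>d\<in>carrier R. d \<notin> p \<and> d \<ominus> \<one> \<notin> p)"
  obtains a where "a \<in> carrier R" "\<And>p. p \<in> P \<Longrightarrow> a \<notin> p \<and> a \<oplus> z \<notin> p"
proof -
  let ?max = "{p \<in> P. \<forall>q\<in>P. p \<subseteq> q \<longrightarrow> p = q}"
  have "\<exists>a\<in>carrier R. \<forall>p\<in>?max. a \<notin> p \<and> a \<oplus> z \<notin> p"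
    by (rule avoid_antichain[OF _ z]) (use P large in auto)
  then obtain a where a: "a \<in> carrier R" "\<forall>p\<in>?max. a \<notin> p \<and> a \<oplus> z \<notin> p"
    by blast
  have "a \<notin> p \<and> a \<oplus> z \<notin> p" if p: "p \<in> P" for p
  proof -
    obtain q where "q \<in> P" "p \<subseteq> q" "\<forall>r\<in>P. q \<subseteq> r \<longrightarrow> q = r"
      using finite_has_maximal2[OF P(1) p] by blast
    then show ?thesis
      using a(2) by blast
  qed
  then show thesis
    using that a(1) by blast
qed

lemma (in cring) Units_subset_imp_idem_diff_mem:
  assumes K: "subring K R" and units: "Units R \<subseteq> K"
    and P: "finite P" "\<And>p. p \<in> P \<Longrightarrow> primeideal p R"
    and unit: "\<And>a. \<lbrakk>a \<in> carrier R; \<And>p. p \<in> P \<Longrightarrow> a \<notin> p\<rbrakk> \<Longrightarrow> a \<in> Units R"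
    and xy: "x \<in> carrier R" "y \<in> carrier R"
  shows "(x \<otimes> x \<ominus> x) \<otimes> y \<in> K"
proof -
  let ?z = "(x \<otimes> x \<ominus> x) \<otimes> y"
  have z: "?z \<in> carrier R"
    using xy by simp
  have "?z \<in> p \<or> (\<exists>d\<in>carrier R. d \<notin> p \<and> d \<ominus> \<one> \<notin> p)" if "p \<in> P" for p
  proof -
    interpret p: primeideal p R by (rule P(2)[OF that])
    \<comment> \<open>Both \<open>x\<close> and \<open>x - 1\<close> divide \<open>?z\<close>. A
      prime missing \<open>?z\<close> misses both, so \<open>x\<close> itself is the third residue
      \<open>d\<close>.\<close>
    have eq: "?z = ((x \<ominus> \<one>) \<otimes> y) \<otimes> x" "?z = (x \<otimes> y) \<otimes> (x \<ominus> \<one>)"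
      using xy by algebra+
    show ?thesis
      using p.I_l_closed[of x "(x \<ominus> \<one>) \<otimes> y"] p.I_l_closed[of "x \<ominus> \<one>" "x \<otimes> y"] xy eq
      by (metis m_closed minus_closed one_closed)
  qed
  then obtain a where a: "a \<in> carrier R" "\<And>p. p \<in> P \<Longrightarrow> a \<notin> p \<and> a \<oplus> ?z \<notin> p"
    using avoid_primes[OF P z] by blast
  have "a \<in> K" "a \<oplus> ?z \<in> K"
    using unit[of a] unit[of "a \<oplus> ?z"] a z units by auto
  moreover have "?z = (a \<oplus> ?z) \<oplus> \<ominus> a"
    using a(1) z by (metis a_ac(1) a_comm a_inv_closed r_neg2 l_neg r_zero add.m_lcomm)
  ultimately show ?thesis
    using subringE(5,7)[OF K] by metis
qed

subsection \<open>The greatest Boolean extension\<close>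

definition conductor :: "('a, 'b) ring_scheme \<Rightarrow> 'a set \<Rightarrow> 'a set \<Rightarrow> 'a set" where
  "conductor A K V = {i \<in> K. \<forall>v\<in>V. i \<otimes>\<^bsub>A\<^esub> v \<in> K}"

lemma (in cring) ideal_conductor:
  assumes K: "subring K R" and V: "V \<subseteq> carrier R"
  shows "ideal (conductor R K V) (restr R K)"
proof -
  interpret K: cring "restr R K"
    by (rule subring_cring[OF K])
  note sub = subringE[OF K]
  show ?thesis
  proof (rule K.ideal_closureI)
    fix x y assume "x \<in> conductor R K V" "y \<in> conductor R K V"
    moreover from this have "(x \<oplus> y) \<otimes> v = x \<otimes> v \<oplus> y \<otimes> v" if "v \<in> V" for v
      using that sub(1) V by (intro l_distr) (auto simp: conductor_def)
    ultimately show "x \<oplus>\<^bsub>restr R K\<^esub> y \<in> conductor R K V"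
      using sub(7) by (simp add: conductor_def)
  next
    fix r x assume "r \<in> carrier (restr R K)" "x \<in> conductor R K V"
    moreover from this have "(r \<otimes> x) \<otimes> v = r \<otimes> (x \<otimes> v)" if "v \<in> V" for v
      using that sub(1) V by (intro m_assoc) (auto simp: conductor_def)
    ultimately show "r \<otimes>\<^bsub>restr R K\<^esub> x \<in> conductor R K V"
      using sub(6) by (simp add: conductor_def)
  next
    show "\<zero>\<^bsub>restr R K\<^esub> \<in> conductor R K V"
      using V sub(2) by (auto simp: conductor_def subset_iff)
  qed (auto simp: conductor_def)
qed

text \<open>For an ideal \<open>I\<close> of \<open>K\<close> with \<open>K/I\<close> Boolean, the largest extension \<open>B\<close> of \<open>K\<close> in \<open>R\<close> of which
  \<open>I\<close> is still an ideal, and such that \<open>B/I\<close> is Boolean.\<close>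

definition boolean_hull :: "('a, 'b) ring_scheme \<Rightarrow> 'a set \<Rightarrow> 'a set" where
  "boolean_hull A I = {z \<in> carrier A. (\<forall>i\<in>I. i \<otimes>\<^bsub>A\<^esub> z \<in> I) \<and> z \<otimes>\<^bsub>A\<^esub> z \<ominus>\<^bsub>A\<^esub> z \<in> I}"

locale boolean_ideal = subring_ideal R K I for R (structure) and K I +
  assumes idem: "r \<in> K \<Longrightarrow> r \<otimes> r \<ominus> r \<in> I"
begin

lemma hullD:
  assumes "z \<in> boolean_hull R I"
  shows "z \<in> carrier R" "\<And>i. i \<in> I \<Longrightarrow> i \<otimes> z \<in> I" "z \<otimes> z \<ominus> z \<in> I"
  using assms by (auto simp: boolean_hull_def)

lemma hullI:
  assumes "z \<in> carrier R" "\<And>i. i \<in> I \<Longrightarrow> i \<otimes> z \<in> I" "z \<otimes> z \<ominus> z \<in> I"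
  shows "z \<in> boolean_hull R I"
  using assms by (auto simp: boolean_hull_def)

lemma two_mem: "\<one> \<oplus> \<one> \<in> I"
proof -
  have "(\<one> \<oplus> \<one>) \<otimes> (\<one> \<oplus> \<one>) \<ominus> (\<one> \<oplus> \<one>) = \<one> \<oplus> \<one>"
    by algebra
  then show ?thesis
    using idem[of "\<one> \<oplus> \<one>"] K_closed(2,5) by simp
qed

lemma K_sub_hull: "K \<subseteq> boolean_hull R I"
proof
  fix k assume k: "k \<in> K"
  show "k \<in> boolean_hull R I"
  proof (rule hullI)
    fix i assume i: "i \<in> I"
    then show "i \<otimes> k \<in> I"
      using M_mult[OF k i] m_comm[OF M_carrier[OF i] K_carrier[OF k]] by simp
  qed (use K_carrier[OF k] idem[OF k] in simp_all)
qed

lemma hull_intermediate: "boolean_hull R I \<in> intermediate R K"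
proof -
  let ?B = "boolean_hull R I"
  have add: "z \<oplus> w \<in> ?B" if z: "z \<in> ?B" and w: "w \<in> ?B" for z w
  proof (rule hullI)
    note car = hullD(1)[OF z] hullD(1)[OF w]
    show "z \<oplus> w \<in> carrier R"
      using car by simp
    show "i \<otimes> (z \<oplus> w) \<in> I" if i: "i \<in> I" for i
      using M_add[OF hullD(2)[OF z i] hullD(2)[OF w i]] car M_carrier[OF i] by (simp add: r_distr)
    \<comment> \<open>The cross term \<open>2 z w\<close> lies in \<open>I\<close> because 2 does
      and \<open>I\<close> is stable under \<open>z\<close> and \<open>w\<close>.\<close>
    have "(z \<oplus> w) \<otimes> (z \<oplus> w) \<ominus> (z \<oplus> w)
        = (z \<otimes> z \<ominus> z) \<oplus> ((w \<otimes> w \<ominus> w) \<oplus> ((\<one> \<oplus> \<one>) \<otimes> z) \<otimes> w)"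
      using car by algebra
    also have "\<dots> \<in> I"
      using hullD(2)[OF w hullD(2)[OF z two_mem]] hullD(3)[OF z] hullD(3)[OF w] by (intro M_add)
    finally show "(z \<oplus> w) \<otimes> (z \<oplus> w) \<ominus> (z \<oplus> w) \<in> I" .
  qed
  have mult: "z \<otimes> w \<in> ?B" if z: "z \<in> ?B" and w: "w \<in> ?B" for z w
  proof (rule hullI)
    note car = hullD(1)[OF z] hullD(1)[OF w]
    show "z \<otimes> w \<in> carrier R"
      using car by simp
    show "i \<otimes> (z \<otimes> w) \<in> I" if i: "i \<in> I" for i
      using hullD(2)[OF w hullD(2)[OF z i]] car M_carrier[OF i] by (simp add: m_assoc)
    let ?a = "z \<otimes> z \<ominus> z" and ?b = "w \<otimes> w \<ominus> w"
    \<comment> \<open>Expand \<open>z^2 w^2 = (z + ?a) (w + ?b)\<close>; every term except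
      \<open>z w\<close> has a factor in \<open>I\<close>.\<close>
    have "(z \<otimes> w) \<otimes> (z \<otimes> w) \<ominus> z \<otimes> w = ?b \<otimes> z \<oplus> (?a \<otimes> w \<oplus> ?a \<otimes> ?b)"
      using car by algebra
    also have "\<dots> \<in> I"
      using hullD(2)[OF z hullD(3)[OF w]] hullD(2)[OF w hullD(3)[OF z]]
        M_mult[OF _ hullD(3)[OF w], of ?a] hullD(3)[OF z] M_sub by (intro M_add) auto
    finally show "(z \<otimes> w) \<otimes> (z \<otimes> w) \<ominus> z \<otimes> w \<in> I" .
  qed
  have "subring ?B R"
  proof (rule subringI)
    show "?B \<subseteq> carrier R"
      using hullD(1) by blast
    show "\<one> \<in> ?B"
      using K_sub_hull K_closed(2) by blast
    fix z assume z: "z \<in> ?B"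
    have "\<ominus> \<one> \<in> ?B"
      using K_sub_hull K_closed(2,3) by blast
    then have "\<ominus> \<one> \<otimes> z \<in> ?B"
      using mult z by blast
    then show "\<ominus> z \<in> ?B"
      using hullD(1)[OF z] by (simp add: l_minus)
  qed (use add mult in auto)
  then show ?thesis
    using K_sub_hull by (simp add: intermediate_def)
qed

lemma boolean_over_hull: "boolean_over R K (boolean_hull R I)"
  unfolding boolean_over_def using hullD M_sub by blast

text \<open>Cutting \<open>I\<close> down by the conductor of \<open>V\<close> keeps the quotient of
  \<open>K\<close> Boolean, since \<open>r^2 - r\<close> lies in both. The new ideal is moreover
  stable under \<open>V\<close>, although \<open>I\<close> need not be, and contains every
  \<open>z^2 - z\<close> with \<open>z\<close> in \<open>V\<close>.\<close>

lemma boolean_over_sub_hull: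
  assumes V: "subring V R" "K \<subseteq> V" and bool: "boolean_over R K V"
  defines "J \<equiv> I \<inter> conductor R K V"
  shows "boolean_ideal R K J" and "V \<subseteq> boolean_hull R J"
proof -
  note sub = subringE[OF V(1)]
  let ?C = "conductor R K V"
  have idem_C: "v \<otimes> v \<ominus> v \<in> ?C" if "v \<in> V" for v
    using boolean_overD[OF bool that] boolean_overD[OF bool that sub(3)] that sub(1)
    by (auto simp: conductor_def subset_iff)
  have "ideal J (restr R K)"
    unfolding J_def
    by (rule ring.i_intersect[OF subring_is_ring[OF subring] ideal_below ideal_conductor[OF subring sub(1)]])
  then show J: "boolean_ideal R K J"
    by (intro boolean_ideal.intro subring_ideal.intro cring_axioms subring_ideal_axioms.intro subring
        boolean_ideal_axioms.intro) (use idem idem_C V(2) in \<open>auto simp: J_def\<close>)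
  interpret J: boolean_ideal R K J by (rule J)
  show "V \<subseteq> boolean_hull R J"
  proof
    fix z assume z: "z \<in> V"
    have zc: "z \<in> carrier R"
      using z sub(1) by blast
    have stable: "i \<otimes> z \<in> J" if i: "i \<in> J" for i
    proof -
      have iK: "i \<in> K" "i \<in> I" "\<And>v. v \<in> V \<Longrightarrow> i \<otimes> v \<in> K"
        using i by (auto simp: J_def conductor_def)
      note ic = K_carrier[OF iK(1)]
      \<comment> \<open>Membership of \<open>i z\<close> in \<open>I\<close> is found by squaring:
        \<open>e^2 = (i z^2) i\<close> lies in \<open>I\<close> because \<open>i z^2\<close> is in
        \<open>K\<close>, and idempotence of \<open>e\<close> modulo \<open>I\<close> leads back
        from \<open>e^2\<close> to \<open>e\<close>.\<close>
      define e where "e = i \<otimes> z"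
      have eK: "e \<in> K"
        unfolding e_def using iK(3)[OF z] .
      note ec = K_carrier[OF eK]
      have "e \<otimes> v \<in> K" if "v \<in> V" for v
        using iK(3)[OF sub(6)[OF z that]] that sub(1) ic zc by (simp add: e_def m_assoc subset_iff)
      then have "e \<in> ?C"
        using eK by (simp add: conductor_def)
      moreover have "e \<otimes> e = (i \<otimes> (z \<otimes> z)) \<otimes> i"
        using ic zc by (simp add: e_def m_ac)
      then have "e \<otimes> e \<in> I"
        using M_mult[OF iK(3)[OF sub(6)[OF z z]] iK(2)] by simp
      then have "e \<otimes> e \<oplus> \<ominus> (e \<otimes> e \<ominus> e) \<in> I"
        using M_add M_uminus idem[OF eK] by blast
      moreover have "e = e \<otimes> e \<oplus> \<ominus> (e \<otimes> e \<ominus> e)"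
        using ec by algebra
      ultimately show ?thesis
        by (metis IntI J_def e_def)
    qed
    have "z \<otimes> z \<ominus> z \<in> J"
    proof -
      define r where "r = z \<otimes> z \<ominus> z"
      have r: "r \<in> ?C" "r \<in> K"
        using idem_C[OF z] by (auto simp: r_def conductor_def)
      note rc = K_carrier[OF r(2)]
      \<comment> \<open>A test element: with \<open>z^2 = z + r\<close>, idempotence of
        \<open>e\<close> modulo \<open>J\<close> puts \<open>(r^2 - r) z + r^3\<close> into
        \<open>J\<close>. The first summand is in \<open>J\<close> by stability, and
        \<open>r^3\<close> is congruent to \<open>r\<close>.\<close>
      define e where "e = r \<otimes> z"
      have eK: "e \<in> K"
        using r(1) z by (simp add: e_def conductor_def)
      have z2: "z \<otimes> z = z \<oplus> r"
        unfolding r_def using zc by algebra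
      have "e \<otimes> e \<ominus> e = (r \<otimes> r) \<otimes> (z \<otimes> z) \<ominus> r \<otimes> z"
        unfolding e_def using rc zc by algebra
      also have "\<dots> = (r \<otimes> r \<ominus> r) \<otimes> z \<oplus> r \<otimes> (r \<otimes> r)"
        unfolding z2 using rc zc by algebra
      finally have eq: "e \<otimes> e \<ominus> e = (r \<otimes> r \<ominus> r) \<otimes> z \<oplus> r \<otimes> (r \<otimes> r)" .
      have jr: "r \<otimes> r \<ominus> r \<in> J"
        using J.idem[OF r(2)] .
      have "r = (e \<otimes> e \<ominus> e) \<oplus> (\<ominus> ((r \<otimes> r \<ominus> r) \<otimes> z) \<oplus> (\<ominus> (r \<otimes> (r \<otimes> r \<ominus> r)) \<oplus> \<ominus> (r \<otimes> r \<ominus> r)))"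
        unfolding eq using rc zc by algebra
      also have "\<dots> \<in> J"
        using J.idem[OF eK] stable[OF jr] J.M_mult[OF r(2) jr] jr
        by (intro J.M_add J.M_uminus)
      finally show ?thesis
        by (simp add: r_def)
    qed
    then show "z \<in> boolean_hull R J"
      using J.hullI[OF zc stable] by blast
  qed
qed

text \<open>Not visible from the definition, where a smaller ideal makes the condition on
  \<open>z^2 - z\<close> stricter. But \<open>J\<close> times the hull of \<open>I\<close> stays in
  \<open>I\<close>, hence in \<open>K\<close>; so intersecting \<open>J\<close> with the conductor
  of that hull changes nothing, and \<open>boolean_over_sub_hull\<close> applies with base ideal
  \<open>J\<close>.\<close>

lemma hull_antimono:
  assumes "boolean_ideal R K J" "J \<subseteq> I"
  shows "boolean_hull R I \<subseteq> boolean_hull R J"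
proof -
  interpret J: boolean_ideal R K J by (rule assms(1))
  have "subring (boolean_hull R I) R" "K \<subseteq> boolean_hull R I"
    using hull_intermediate by (auto simp: intermediate_def)
  note sub = J.boolean_over_sub_hull[OF this boolean_over_hull]
  have "J \<inter> conductor R K (boolean_hull R I) = J"
    using assms(2) hullD(2) J.M_sub M_sub by (fastforce simp: conductor_def)
  then show ?thesis
    using sub(2) by simp
qed

end

lemma (in cring) boolean_over_directed:
  assumes K: "subring K R"
    and V: "V \<in> intermediate R K" "boolean_over R K V"
    and W: "W \<in> intermediate R K" "boolean_over R K W"
  shows "\<exists>B\<in>intermediate R K. boolean_over R K B \<and> V \<subseteq> B \<and> W \<subseteq> B"
proof -
  have V': "subring V R" "K \<subseteq> V" and W': "subring W R" "K \<subseteq> W"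
    using V(1) W(1) by (auto simp: intermediate_def)
  \<comment> \<open>The zero ring is Boolean, so \<open>K\<close> itself is a legitimate starting
    ideal; it is then cut down by the conductor of \<open>V\<close> and that of \<open>W\<close>,
    and \<open>hull_antimono\<close> keeps \<open>V\<close> inside through the second cut.\<close>
  have "boolean_ideal R K K"
    using subringE(5-7)[OF K] ring.oneideal[OF subring_is_ring[OF K]] K
    by (intro boolean_ideal.intro subring_ideal.intro cring_axioms subring_ideal_axioms.intro
        boolean_ideal_axioms.intro) (auto simp: a_minus_def)
  then interpret I: boolean_ideal R K K .
  interpret I1: boolean_ideal R K "K \<inter> conductor R K V"
    by (rule I.boolean_over_sub_hull(1)[OF V' V(2)])
  let ?J = "K \<inter> conductor R K V \<inter> conductor R K W"
  have J: "boolean_ideal R K ?J"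
    by (rule I1.boolean_over_sub_hull(1)[OF W' W(2)])
  interpret J: boolean_ideal R K ?J by (rule J)
  have "W \<subseteq> boolean_hull R ?J"
    by (rule I1.boolean_over_sub_hull(2)[OF W' W(2)])
  moreover have "V \<subseteq> boolean_hull R ?J"
    using I.boolean_over_sub_hull(2)[OF V' V(2)] I1.hull_antimono[OF J] by blast
  ultimately show ?thesis
    using J.hull_intermediate J.boolean_over_hull by blast
qed

lemma (in cring) boolean_over_greatest:
  assumes K: "subring K R"
  shows "\<exists>G\<in>intermediate R K. boolean_over R K G \<and>
    (\<forall>V\<in>intermediate R K. boolean_over R K V \<longrightarrow> V \<subseteq> G)"
proof -
  let ?F = "{V \<in> intermediate R K. boolean_over R K V}"
  note sub = subringE[OF K]
  have join: "\<exists>V\<in>?F. x \<in> V \<and> y \<in> V" if "x \<in> \<Union>?F" "y \<in> \<Union>?F" for x y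
    using that boolean_over_directed[OF K] by (smt (verit) Union_iff mem_Collect_eq subsetD)
  have ring: "subring V R" if "V \<in> ?F" for V
    using that by (simp add: intermediate_def)
  have "K \<in> ?F"
    using K sub(5-7) by (auto simp: intermediate_def boolean_over_def a_minus_def)
  then have K_sub: "K \<subseteq> \<Union>?F"
    by (rule Union_upper)
  have "subring (\<Union>?F) R"
  proof (rule subringI)
    show "\<Union>?F \<subseteq> carrier R"
      using subringE(1)[OF ring] by (intro Union_least)
    show "\<one> \<in> \<Union>?F"
      using K_sub sub(3) by (rule subsetD)
  next
    fix x assume "x \<in> \<Union>?F"
    then obtain V where V: "V \<in> ?F" "x \<in> V"
      by (rule UnionE)
    show "\<ominus> x \<in> \<Union>?F"
      using UnionI[OF V(1)] subringE(5)[OF ring[OF V(1)] V(2)] by simp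
  next
    fix x y assume "x \<in> \<Union>?F" "y \<in> \<Union>?F"
    then have "\<exists>V\<in>?F. x \<in> V \<and> y \<in> V"
      by (rule join)
    then obtain V where V: "V \<in> ?F" "x \<in> V" "y \<in> V"
      by (elim bexE conjE)
    show "x \<otimes> y \<in> \<Union>?F" "x \<oplus> y \<in> \<Union>?F"
      using UnionI[OF V(1)] subringE(6,7)[OF ring[OF V(1)] V(2,3)] by simp_all
  qed
  then have "\<Union>?F \<in> intermediate R K"
    using K_sub by (simp add: intermediate_def)
  moreover have "boolean_over R K (\<Union>?F)"
    unfolding boolean_over_def[of R K "\<Union>?F"]
  proof (intro ballI)
    fix x y assume "x \<in> \<Union>?F" "y \<in> \<Union>?F"
    then have "\<exists>V\<in>?F. x \<in> V \<and> y \<in> V"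
      by (rule join)
    then obtain V where "V \<in> ?F" "x \<in> V" "y \<in> V"
      by (elim bexE conjE)
    then show "(x \<otimes> x \<ominus> x) \<otimes> y \<in> K"
      using boolean_overD[of R K V] by simp
  qed
  ultimately show ?thesis
    by (intro bexI[of _ "\<Union>?F"]) auto
qed

section \<open>Passing to an intermediate ring, and conclusion\<close>

lemma (in cring) subring_restr_iff:
  assumes "subring V R" "W \<subseteq> V"
  shows "subring W (restr R V) \<longleftrightarrow> subring W R"
  using ring.subring_iff[OF subring_is_ring[OF assms(1)], of W] subring_iff[of W] assms
    subringE(1)[OF assms(1)] by (auto dest: subringE(1))

lemma (in cring) intermediate_restr:
  assumes "V \<in> intermediate R K"
  shows "intermediate (restr R V) K \<subseteq> intermediate R K"
  using assms subring_restr_iff[of V] subringE(1)[of _ "restr R V"]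
  by (auto simp: intermediate_def)

lemma FCP_mono:
  assumes "FCP A K" "intermediate B L \<subseteq> intermediate A K"
  shows "FCP B L"
  using assms by (auto simp: FCP_def subset_chain_def)

text \<open>FCP is inherited by both halves of the extension. Between \<open>K\<close> and
  \<open>V\<close> it stops the rings \<open>K + z^n K[z]\<close>; between \<open>V\<close> and
  \<open>R\<close>, together with semilocality of \<open>R\<close>, it yields the primes detecting
  the units of \<open>V\<close>.\<close>

lemma (in cring) FCP_boolean_over_iff:
  assumes one: "\<one> \<noteq> \<zero>" and K: "subring K R" and FCP: "FCP R K" and semi: "semilocal R"
    and V: "V \<in> intermediate R K"
  defines "B \<equiv> restr R V"
  shows "strongly_local B K \<longleftrightarrow> boolean_over R K V"
    and "seminormal B K \<and> infra_integral B K \<and>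
      (\<forall>M\<in>MSupp (restr R K) (quot_module B K). restr R K Quot M \<simeq> ZFact 2) \<longleftrightarrow> boolean_over R K V"
proof -
  have V': "subring V R" "K \<subseteq> V"
    using V by (auto simp: intermediate_def)
  interpret B: cring B
    unfolding B_def by (rule subring_cring[OF V'(1)])
  have KB: "subring K B"
    unfolding B_def using subring_restr_iff[OF V'] K by simp
  have bool: "boolean_over R K V \<longleftrightarrow> boolean_over B K (carrier B)"
    unfolding B_def using boolean_over_restr[OF V'(1)] by simp
  have oneB: "\<one>\<^bsub>B\<^esub> \<noteq> \<zero>\<^bsub>B\<^esub>"
    using one by (simp add: B_def)
  have restr: "restr B K = restr R K"
    by (simp add: B_def)
  have FCP_B: "FCP B K"
    unfolding B_def by (rule FCP_mono[OF FCP intermediate_restr[OF V]])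
  have FCP_V: "FCP R V"
    using V'(2) by (intro FCP_mono[OF FCP]) (auto simp: intermediate_def)
  show "strongly_local B K \<longleftrightarrow> boolean_over R K V"
  proof
    assume "strongly_local B K"
    then have units: "Units B \<subseteq> K"
      unfolding strongly_local_def restr by (auto simp: Units_def)
    obtain P where P: "finite P" "\<And>p. p \<in> P \<Longrightarrow> primeideal p B"
      "\<And>a. \<lbrakk>a \<in> V; \<And>p. p \<in> P \<Longrightarrow> a \<notin> p\<rbrakk> \<Longrightarrow> a \<in> Units B"
      using Units_subring_finite_primes[OF V'(1) FCP_V semi] unfolding B_def by metis
    have "a \<in> Units B" if "a \<in> carrier B" "\<And>p. p \<in> P \<Longrightarrow> a \<notin> p" for a
      using P(3)[of a] that by (simp add: B_def)
    then have "(x \<otimes>\<^bsub>B\<^esub> x \<ominus>\<^bsub>B\<^esub> x) \<otimes>\<^bsub>B\<^esub> y \<in> K" if "x \<in> carrier B" "y \<in> carrier B" for x y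
      using B.Units_subset_imp_idem_diff_mem[OF KB units P(1,2) _ that] by simp
    then have "boolean_over B K (carrier B)"
      unfolding boolean_over_def by (intro ballI)
    then show "boolean_over R K V"
      by (simp only: bool)
  next
    assume "boolean_over R K V"
    then show "strongly_local B K"
      unfolding bool by (rule B.boolean_over_imp_strongly_local[OF KB])
  qed
  show "seminormal B K \<and> infra_integral B K \<and>
      (\<forall>M\<in>MSupp (restr R K) (quot_module B K). restr R K Quot M \<simeq> ZFact 2) \<longleftrightarrow> boolean_over R K V"
    (is "?F \<longleftrightarrow> _")
  proof
    assume ?F
    then show "boolean_over R K V"
      unfolding bool using B.infra_integral_imp_boolean_over[OF KB FCP_B] restr by simp
  next
    assume "boolean_over R K V"
    then have "boolean_over B K (carrier B)"
      by (simp add: bool)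
    then show ?F
      using B.boolean_over_imp_seminormal[OF KB] B.boolean_over_imp_infra_integral[OF KB _ oneB]
        B.boolean_over_imp_Quot_iso[OF KB] restr by simp
  qed
qed

lemma (in cring) compositum_eq_greatest:
  assumes "F \<subseteq> intermediate R K" "G \<in> F" "\<And>V. V \<in> F \<Longrightarrow> V \<subseteq> G"
  shows "compositum R K F = G"
proof -
  have G: "subring G R" "K \<subseteq> G"
    using assms(1,2) by (auto simp: intermediate_def)
  have "K \<union> \<Union>F = G"
    using assms(2,3) G(2) by blast
  moreover have "G = generate_ring R G"
    by (rule generate_ringI[OF subringE(1)[OF G(1)] G(1) order_refl])
  ultimately show ?thesis
    by (simp add: compositum_def)
qed

theorem theorem8p10:
  fixes S :: "('a, 'b) ring_scheme" and R :: "'a set"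
  assumes "cring S" and "\<one>\<^bsub>S\<^esub> \<noteq> \<zero>\<^bsub>S\<^esub>" and "subring R S"
    and "FCP S R" and "semilocal S"
  shows "\<exists>T. greatest (intermediate_lattice S R) T
               {V \<in> intermediate S R. strongly_local (restr S V) R}
    \<and> T = compositum S R
            {V \<in> intermediate S R. seminormal (restr S V) R \<and> infra_integral (restr S V) R \<and>
               (\<forall>M \<in> MSupp (restr S R) (quot_module (restr S V) R).
                  restr S R Quot M \<simeq> ZFact 2)}
    \<and> T = compositum S R {V \<in> intermediate S R. strongly_local (restr S V) R}
    \<and> is_lub (intermediate_lattice S R) T
        {V \<in> intermediate S R. strongly_local (restr S V) R}
    \<and> T = \<Union> {V \<in> intermediate S R. strongly_local (restr S V) R}"
proof -
  interpret S: cring S by (rule assms(1))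
  let ?F = "{V \<in> intermediate S R. boolean_over S R V}"
  note iff = S.FCP_boolean_over_iff[OF assms(2-5)]
  have F1: "{V \<in> intermediate S R. strongly_local (restr S V) R} = ?F"
    using iff(1) by blast
  have F2: "{V \<in> intermediate S R. seminormal (restr S V) R \<and> infra_integral (restr S V) R \<and>
               (\<forall>M \<in> MSupp (restr S R) (quot_module (restr S V) R).
                  restr S R Quot M \<simeq> ZFact 2)} = ?F"
    using iff(2) by blast
  obtain G where G: "G \<in> ?F" "\<And>V. V \<in> ?F \<Longrightarrow> V \<subseteq> G"
    using S.boolean_over_greatest[OF assms(3)] by auto
  have "greatest (intermediate_lattice S R) G ?F"
    using G by (auto simp: greatest_def intermediate_lattice_def)
  moreover have "compositum S R ?F = G"
    by (rule S.compositum_eq_greatest[OF _ G]) auto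
  moreover have "is_lub (intermediate_lattice S R) G ?F"
    using G by (auto simp: least_def Upper_def intermediate_lattice_def)
  moreover have "\<Union>?F = G"
    using G by blast
  ultimately show ?thesis
    unfolding F1 F2 by metis
qed

end
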